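(* Let $\Omega\subset\mathbb{C}^n$ be a bounded domain with Bergman kernel $\mathcal{B}(z,\xi)$ and Bergman metric $g_B=\sum_{\alpha,\beta} g_{\alpha\overline\beta}\,dz_\alpha\otimes d\overline z_\beta$. Let $\Phi:\Omega\to\mathcal{P}(\Omega,dV)$ be given by $\Phi(z)=P(z,\xi)\,dV(\xi)$ with $P(z,\xi)=\frac{|\mathcal{B}(z,\xi)|^2}{\mathcal{B}(z,z)}$, where $dV$ is Lebesgue measure. Write $l=l(z,\xi)=\log P(z,\xi)$ and $\partial_\alpha=\frac{\partial}{\partial z_\alpha}$. Then: (1) $\Phi:\Omega\to\mathcal{P}(\Omega,dV)$ is a $2$-integrable statistical model, and for all $1\le\alpha,\beta\le n$, $$g_{\alpha\overline\beta}=\mathrm{Cov}[\partial_\alpha l,\partial_\beta l].$$ (2) If $\Omega$ satisfies Condition $C_4$, then the curvature $4$-tensor of $g_B$ satisfies $$R_{\alpha\overline\beta\gamma\overline\delta}=g_{\alpha\overline\beta}g_{\gamma\overline\delta}+g_{\alpha\overline\delta}g_{\gamma\overline\beta}-\mathrm{Cov}\Big[\partial_\alpha\partial_\gamma l+(\partial_\alpha l)(\partial_\gamma l)-\sum_{i=1}^n\Gamma^i_{\alpha\gamma}\,\partial_i l,\ \ \partial_\beta\partial_\delta l+(\partial_\beta l)(\partial_\delta l)-\sum_{j=1}^n\Gamma^j_{\beta\delta}\,\partial_j l\Big],$$ where $\Gamma^i_{\alpha\gamma}=\sum_\epsilon g^{i\overline\epsilon}(\partial_\alpha g_{\gamma\overline\epsilon})$.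 Moreover, $N_{\alpha\gamma}:=\partial_\alpha\partial_\gamma l+(\partial_\alpha l)(\partial_\gamma l)-\sum_{i}\Gamma^i_{\alpha\gamma}\,\partial_i l$ satisfies $N_{\alpha\gamma}\in T_{\Phi(z)}\mathcal{P}(\Omega)$ and $N_{\alpha\gamma}\perp T_{\Phi(z)}\Phi(\Omega)$ for every $z\in\Omega$.
   Context: $A^2(\Omega)$ is the Hilbert space of square-integrable holomorphic functions on $\Omega$ and $\mathcal{B}(z,\xi)=\sum_j s_j(z)\overline{s_j(\xi)}$ ($\{s_j\}$ any orthonormal basis) is its reproducing kernel; $g_{\alpha\overline\beta}(z)=\partial_\alpha\partial_{\overline\beta}\log\mathcal{B}(z,z)$, which is positive definite on a bounded domain. $(g^{\alpha\overline\epsilon})$ is defined by $\sum_\epsilon g^{\alpha\overline\epsilon}g_{\beta\overline\epsilon}=\delta^\alpha_\beta$. The curvature tensor is $R_{\alpha\overline\beta\gamma\overline\delta}=-\partial_\alpha\partial_{\overline\beta}g_{\gamma\overline\delta}+\sum_{\tau,\epsilon} g^{\tau\overline\epsilon}(\partial_\alpha g_{\gamma\overline\epsilon})(\partial_{\overline\beta}g_{\tau\overline\delta})$. For a function $f$ of $\xi$, at a given $z$: $\mathrm{E}[f]=\int_\Omega f(\xi)P(z,\xi)\,dV(\xi)$ and $\mathrm{Cov}[f,g]=\mathrm{E}[f\overline g]-\mathrm{E}[f]\,\overline{\mathrm{E}[g]}$. All derivatives of $l$ are in the variable $z$; $l$ is defined for $dV$-a.e. $\xi$ since $\{\xi:\mathcal{B}(z,\xi)=0\}$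 has measure zero. For a measurable space $\Xi$ and a $\sigma$-finite measure $\mu_0$: $\mathcal{S}(\Xi,\mu_0)=\{\phi\mu_0:\phi\in L^1(\Xi,\mu_0)\}$ with the total variation norm, and $\mathcal{P}(\Xi,\mu_0)=\{\phi\mu_0\in\mathcal{S}(\Xi,\mu_0):\phi>0\ \mu_0\text{-a.e.},\ \int\phi\,d\mu_0=1\}$. A statistical model is a Fréchet $C^1$ map $\Phi:M\to\mathcal{S}(\Xi,\mu_0)$ from a smooth manifold $M$ with $\Phi(M)\subset\mathcal{P}(\Xi,\mu_0)$. Its logarithmic derivative is $\partial_V\log P(x,\cdot)=\frac{d\{D\Phi(V)\}}{d\Phi(x)}\in L^1(\Xi,\Phi(x))$, $V\in T_xM$; the model is $k$-integrable if $V\mapsto\|\partial_V\log P(x,\cdot)\|_{L^k(\Xi,\Phi(x))}$ is (finite and) continuous on $TM$. Via Radon–Nikodym derivatives, $T_{\mu}\mathcal{P}(\Omega)\cong\{\phi\in L^1(\Omega,\mu):\int\phi\,d\mu=0\}$ (complex-valued functions allowed), $T_{\Phi(z)}\Phi(\Omega)$ is identified with the span of $\partial_1 l(z,\cdot),\dots,\partial_n l(z,\cdot)$, and $N_{\alpha\gamma}\perp T_{\Phi(z)}\Phi(\Omega)$ means $\mathrm{E}[N_{\alpha\gamma}\,\overline{\partial_\beta l}]=0$ for all $1\le\beta\le n$. Condition $C_k$ ($k\in\mathbb{N}$): for all nonzero multi-indices $\Gamma_1,\dots,\Gamma_A,\Lambda_1,\dots,\Lambda_B\in\mathbb{N}_0^n$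 with $\sum_i|\Gamma_i|+\sum_j|\Lambda_j|\le k$, the function $\prod_{i}(\partial^{\Gamma_i}l)\prod_j(\overline\partial^{\Lambda_j}l)$ of $\xi$ lies in $L^1(\Omega,\Phi(z))$ for each $z\in\Omega$, and its $L^1(\Omega,\Phi(z))$-norm is a continuous function of $z\in\Omega$. *)

theory Defs
  imports "HOL-Analysis.Analysis"
begin

text \<open>The real partial derivatives along the \<open>x\<^sub>\<alpha>\<close>- and \<open>y\<^sub>\<alpha>\<close>-axes are read off the real
  Frechet derivative; the operators are only meaningful where the function is real-differentiable.\<close>

definition wirt :: "'n::finite \<Rightarrow> (complex^'n \<Rightarrow> complex) \<Rightarrow> complex^'n \<Rightarrow> complex" where
  "wirt \<alpha> f z = (frechet_derivative f (at z) (axis \<alpha> 1)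
                  - \<i> * frechet_derivative f (at z) (axis \<alpha> \<i>)) / 2"

definition wirt_bar :: "'n::finite \<Rightarrow> (complex^'n \<Rightarrow> complex) \<Rightarrow> complex^'n \<Rightarrow> complex" where
  "wirt_bar \<alpha> f z = (frechet_derivative f (at z) (axis \<alpha> 1)
                  + \<i> * frechet_derivative f (at z) (axis \<alpha> \<i>)) / 2"

text \<open>Multi-indices are functions \<open>'n \<Rightarrow> nat\<close>. The iterated derivative runs through an arbitrary
  enumeration of the coordinates; on smooth functions the order is irrelevant.\<close>

definition coord_list :: "'n::finite list" where
  "coord_list = (SOME xs. distinct xs \<and> set xs = UNIV)"

definition wirt_multi ::
    "('n::finite \<Rightarrow> nat) \<Rightarrow> (complex^'n \<Rightarrow> complex) \<Rightarrow> complex^'n \<Rightarrow> complex" where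
  "wirt_multi \<Gamma> f = foldr (\<lambda>i. wirt i ^^ \<Gamma> i) coord_list f"

definition wirt_bar_multi ::
    "('n::finite \<Rightarrow> nat) \<Rightarrow> (complex^'n \<Rightarrow> complex) \<Rightarrow> complex^'n \<Rightarrow> complex" where
  "wirt_bar_multi \<Lambda> f = foldr (\<lambda>i. wirt_bar i ^^ \<Lambda> i) coord_list f"

definition multi_order :: "('n::finite \<Rightarrow> nat) \<Rightarrow> nat" where
  "multi_order \<Gamma> = (\<Sum>i\<in>UNIV. \<Gamma> i)"

definition holomorphic_Cn :: "(complex^'n::finite \<Rightarrow> complex) \<Rightarrow> (complex^'n) set \<Rightarrow> bool" where
  "holomorphic_Cn f \<Omega> \<longleftrightarrow>
     (\<forall>z\<in>\<Omega>. \<exists>D. (f has_derivative D) (at z) \<and> (\<forall>c v. D (c *s v) = c * D v))"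

text \<open>Members are set to zero outside \<open>\<Omega>\<close>, so that each element of \<open>A\<^sup>2(\<Omega>)\<close> is represented by
  exactly one total function.\<close>

definition bergman_space :: "(complex^'n::finite) set \<Rightarrow> (complex^'n \<Rightarrow> complex) set" where
  "bergman_space \<Omega> = {f. holomorphic_Cn f \<Omega>
      \<and> integrable (lebesgue_on \<Omega>) (\<lambda>z. (cmod (f z))\<^sup>2) \<and> (\<forall>z. z \<notin> \<Omega> \<longrightarrow> f z = 0)}"

definition bergman_inner ::
    "(complex^'n::finite) set \<Rightarrow> (complex^'n \<Rightarrow> complex) \<Rightarrow> (complex^'n \<Rightarrow> complex) \<Rightarrow> complex" where
  "bergman_inner \<Omega> f g = (\<integral>z. f z * cnj (g z) \<partial>lebesgue_on \<Omega>)"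

definition bergman_orthonormal_basis ::
    "(complex^'n::finite) set \<Rightarrow> (complex^'n \<Rightarrow> complex) set \<Rightarrow> bool" where
  "bergman_orthonormal_basis \<Omega> S \<longleftrightarrow>
     S \<subseteq> bergman_space \<Omega>
     \<and> (\<forall>s\<in>S. \<forall>t\<in>S. bergman_inner \<Omega> s t = (if s = t then 1 else 0))
     \<and> (\<forall>f\<in>bergman_space \<Omega>. \<forall>\<epsilon>>0. \<exists>F c. finite F \<and> F \<subseteq> S
            \<and> (\<integral>z. (cmod (f z - (\<Sum>s\<in>F. c s * s z)))\<^sup>2 \<partial>lebesgue_on \<Omega>) < \<epsilon>)"

text \<open>The value does not depend on the chosen basis.\<close>

definition bergman_kernel :: "(complex^'n::finite) set \<Rightarrow> complex^'n \<Rightarrow> complex^'n \<Rightarrow> complex" where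
  "bergman_kernel \<Omega> z \<xi> =
     (\<Sum>\<^sub>\<infinity>s\<in>(SOME S. bergman_orthonormal_basis \<Omega> S). s z * cnj (s \<xi>))"

text \<open>The diagonal value \<open>bergman_kernel \<Omega> z z\<close> is a positive real number for \<open>z \<in> \<Omega>\<close>;
  \<open>Re\<close> merely turns it into one of type \<open>real\<close>.\<close>

definition bergman_metric ::
    "(complex^'n::finite) set \<Rightarrow> 'n \<Rightarrow> 'n \<Rightarrow> complex^'n \<Rightarrow> complex" where
  "bergman_metric \<Omega> \<alpha> \<beta> =
     wirt \<alpha> (wirt_bar \<beta> (\<lambda>z. complex_of_real (ln (Re (bergman_kernel \<Omega> z z)))))"

text \<open>\<open>bergman_metric_inv \<Omega> \<alpha> \<epsilon> z\<close> is \<open>g\<^sup>\<alpha>\<^sup>\<epsilon>\<close>, normalised by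
  \<open>\<Sum>\<epsilon>. g\<^sup>\<alpha>\<^sup>\<epsilon> g\<^sub>\<beta>\<^sub>\<epsilon> = \<delta>\<^sub>\<alpha>\<^sub>\<beta>\<close> (second indices barred); whence the transpose.\<close>

definition bergman_metric_inv ::
    "(complex^'n::finite) set \<Rightarrow> 'n \<Rightarrow> 'n \<Rightarrow> complex^'n \<Rightarrow> complex" where
  "bergman_metric_inv \<Omega> \<alpha> \<epsilon> z =
     matrix_inv (transpose (\<chi> \<beta> \<delta>. bergman_metric \<Omega> \<beta> \<delta> z)) $ \<alpha> $ \<epsilon>"

definition bergman_christoffel ::
    "(complex^'n::finite) set \<Rightarrow> 'n \<Rightarrow> 'n \<Rightarrow> 'n \<Rightarrow> complex^'n \<Rightarrow> complex" where
  "bergman_christoffel \<Omega> i \<alpha> \<gamma> z =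
     (\<Sum>\<epsilon>\<in>UNIV. bergman_metric_inv \<Omega> i \<epsilon> z * wirt \<alpha> (bergman_metric \<Omega> \<gamma> \<epsilon>) z)"

text \<open>In \<open>bergman_curvature \<Omega> \<alpha> \<beta> \<gamma> \<delta>\<close> the indices \<open>\<beta>\<close> and \<open>\<delta>\<close> are the barred ones.\<close>

definition bergman_curvature ::
    "(complex^'n::finite) set \<Rightarrow> 'n \<Rightarrow> 'n \<Rightarrow> 'n \<Rightarrow> 'n \<Rightarrow> complex^'n \<Rightarrow> complex" where
  "bergman_curvature \<Omega> \<alpha> \<beta> \<gamma> \<delta> z =
     - wirt \<alpha> (wirt_bar \<beta> (bergman_metric \<Omega> \<gamma> \<delta>)) z
     + (\<Sum>\<tau>\<in>UNIV. \<Sum>\<epsilon>\<in>UNIV. bergman_metric_inv \<Omega> \<tau> \<epsilon> z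
          * wirt \<alpha> (bergman_metric \<Omega> \<gamma> \<epsilon>) z * wirt_bar \<beta> (bergman_metric \<Omega> \<tau> \<delta>) z)"

text \<open>A finite signed measure on \<open>\<mu>\<close>'s \<open>\<sigma>\<close>-algebra is a real set function which is zero on
  non-measurable sets; \<open>signed_density \<mu> \<phi>\<close> is the signed measure \<open>\<phi>\<mu>\<close>.\<close>

definition signed_density :: "'x measure \<Rightarrow> ('x \<Rightarrow> real) \<Rightarrow> 'x set \<Rightarrow> real" where
  "signed_density \<mu> \<phi> A = (if A \<in> sets \<mu> then (LINT x:A|\<mu>. \<phi> x) else 0)"

definition ac_signed_measures :: "'x measure \<Rightarrow> ('x set \<Rightarrow> real) set" where
  "ac_signed_measures \<mu> = {signed_density \<mu> \<phi> | \<phi>. integrable \<mu> \<phi>}"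

definition positive_prob_measures :: "'x measure \<Rightarrow> ('x set \<Rightarrow> real) set" where
  "positive_prob_measures \<mu> = {signed_density \<mu> \<phi> | \<phi>.
      integrable \<mu> \<phi> \<and> (AE x in \<mu>. \<phi> x > 0) \<and> (\<integral>x. \<phi> x \<partial>\<mu>) = 1}"

definition tv_norm :: "'x measure \<Rightarrow> ('x set \<Rightarrow> real) \<Rightarrow> real" where
  "tv_norm \<mu> \<nu> = (SUP \<A>\<in>{\<A>. finite \<A> \<and> \<A> \<subseteq> sets \<mu> \<and> disjoint \<A>}. \<Sum>A\<in>\<A>. \<bar>\<nu> A\<bar>)"

text \<open>Only meaningful for \<open>\<nu> \<ge> 0\<close>, such as elements of \<open>positive_prob_measures \<mu>\<close>.\<close>

definition as_measure :: "'x measure \<Rightarrow> ('x set \<Rightarrow> real) \<Rightarrow> 'x measure" where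
  "as_measure \<mu> \<nu> = measure_of (space \<mu>) (sets \<mu>) (\<lambda>A. ennreal (\<nu> A))"

text \<open>Frechet differentiability of a map into the normed space
  \<open>(ac_signed_measures \<mu>, tv_norm \<mu>)\<close>.\<close>

definition has_tv_derivative ::
    "'x measure \<Rightarrow> ('a::euclidean_space \<Rightarrow> 'x set \<Rightarrow> real) \<Rightarrow> ('a \<Rightarrow> 'x set \<Rightarrow> real) \<Rightarrow> 'a \<Rightarrow> bool" where
  "has_tv_derivative \<mu> \<Phi> D x \<longleftrightarrow>
     (\<forall>v. D v \<in> ac_signed_measures \<mu>)
     \<and> (\<forall>A. linear (\<lambda>v. D v A))
     \<and> (\<exists>C. \<forall>v. tv_norm \<mu> (D v) \<le> C * norm v)
     \<and> ((\<lambda>h. tv_norm \<mu> (\<lambda>A. \<Phi> (x + h) A - \<Phi> x A - D h A) / norm h) \<longlongrightarrow> 0) (at 0)"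

text \<open>Models are over open subsets \<open>M\<close> of a Euclidean space, whose tangent bundle is
  \<open>M \<times> UNIV\<close>.\<close>

definition tv_C1 ::
    "'x measure \<Rightarrow> 'a::euclidean_space set \<Rightarrow> ('a \<Rightarrow> 'x set \<Rightarrow> real) \<Rightarrow> bool" where
  "tv_C1 \<mu> M \<Phi> \<longleftrightarrow> (\<exists>D. (\<forall>x\<in>M. has_tv_derivative \<mu> \<Phi> (D x) x)
     \<and> (\<forall>x\<in>M. \<forall>\<epsilon>>0. \<exists>\<delta>>0. \<forall>y\<in>M. dist y x < \<delta> \<longrightarrow>
          (\<forall>v. tv_norm \<mu> (\<lambda>A. D y v A - D x v A) \<le> \<epsilon> * norm v)))"

definition statistical_model ::
    "'x measure \<Rightarrow> 'a::euclidean_space set \<Rightarrow> ('a \<Rightarrow> 'x set \<Rightarrow> real) \<Rightarrow> bool" where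
  "statistical_model \<mu> M \<Phi> \<longleftrightarrow> sigma_finite_measure \<mu> \<and> open M
     \<and> \<Phi> ` M \<subseteq> positive_prob_measures \<mu> \<and> tv_C1 \<mu> M \<Phi>"

definition is_signed_RN_deriv ::
    "'x measure \<Rightarrow> ('x set \<Rightarrow> real) \<Rightarrow> ('x set \<Rightarrow> real) \<Rightarrow> ('x \<Rightarrow> real) \<Rightarrow> bool" where
  "is_signed_RN_deriv \<mu> \<nu> \<rho> \<psi> \<longleftrightarrow>
     integrable (as_measure \<mu> \<rho>) \<psi> \<and> \<nu> = signed_density (as_measure \<mu> \<rho>) \<psi>"

definition is_log_derivative ::
    "'x measure \<Rightarrow> ('a::euclidean_space \<Rightarrow> 'x set \<Rightarrow> real) \<Rightarrow> 'a \<Rightarrow> 'a \<Rightarrow> ('x \<Rightarrow> real) \<Rightarrow> bool" where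
  "is_log_derivative \<mu> \<Phi> x V \<psi> \<longleftrightarrow>
     (\<exists>D. has_tv_derivative \<mu> \<Phi> D x \<and> is_signed_RN_deriv \<mu> (D V) (\<Phi> x) \<psi>)"

text \<open>On an open \<open>M\<close> the logarithmic derivative is unique up to null sets, so the choice of the
  representatives \<open>L x V\<close> is immaterial.\<close>

definition k_integrable_model ::
    "nat \<Rightarrow> 'x measure \<Rightarrow> 'a::euclidean_space set \<Rightarrow> ('a \<Rightarrow> 'x set \<Rightarrow> real) \<Rightarrow> bool" where
  "k_integrable_model k \<mu> M \<Phi> \<longleftrightarrow> statistical_model \<mu> M \<Phi> \<and>
     (\<exists>L. (\<forall>x\<in>M. \<forall>V. is_log_derivative \<mu> \<Phi> x V (L x V)
              \<and> integrable (as_measure \<mu> (\<Phi> x)) (\<lambda>\<xi>. \<bar>L x V \<xi>\<bar> ^ k))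
        \<and> continuous_on (M \<times> UNIV)
            (\<lambda>(x, V). root k (\<integral>\<xi>. \<bar>L x V \<xi>\<bar> ^ k \<partial>as_measure \<mu> (\<Phi> x))))"

definition bergman_density :: "(complex^'n::finite) set \<Rightarrow> complex^'n \<Rightarrow> complex^'n \<Rightarrow> real" where
  "bergman_density \<Omega> z \<xi> = (cmod (bergman_kernel \<Omega> z \<xi>))\<^sup>2 / Re (bergman_kernel \<Omega> z z)"

definition bergman_model :: "(complex^'n::finite) set \<Rightarrow> complex^'n \<Rightarrow> (complex^'n) set \<Rightarrow> real" where
  "bergman_model \<Omega> z = signed_density (lebesgue_on \<Omega>) (bergman_density \<Omega> z)"

abbreviation bergman_prob :: "(complex^'n::finite) set \<Rightarrow> complex^'n \<Rightarrow> (complex^'n) measure" where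
  "bergman_prob \<Omega> z \<equiv> as_measure (lebesgue_on \<Omega>) (bergman_model \<Omega> z)"

text \<open>The point \<open>\<xi>\<close> comes first: \<open>loglik \<Omega> \<xi>\<close> is the function of \<open>z\<close> that gets differentiated.
  Where \<open>bergman_kernel \<Omega> z \<xi> = 0\<close> (a null set of \<open>\<xi>\<close> for each \<open>z\<close>) its value is meaningless.\<close>

definition loglik :: "(complex^'n::finite) set \<Rightarrow> complex^'n \<Rightarrow> complex^'n \<Rightarrow> complex" where
  "loglik \<Omega> \<xi> z = complex_of_real (ln (bergman_density \<Omega> z \<xi>))"

definition expect ::
    "(complex^'n::finite) set \<Rightarrow> complex^'n \<Rightarrow> (complex^'n \<Rightarrow> complex) \<Rightarrow> complex" where
  "expect \<Omega> z f = (\<integral>\<xi>. f \<xi> * complex_of_real (bergman_density \<Omega> z \<xi>) \<partial>lebesgue_on \<Omega>)"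

definition Cov :: "(complex^'n::finite) set \<Rightarrow> complex^'n
    \<Rightarrow> (complex^'n \<Rightarrow> complex) \<Rightarrow> (complex^'n \<Rightarrow> complex) \<Rightarrow> complex" where
  "Cov \<Omega> z f g = expect \<Omega> z (\<lambda>\<xi>. f \<xi> * cnj (g \<xi>)) - expect \<Omega> z f * cnj (expect \<Omega> z g)"

text \<open>Bochner integrals of non-integrable functions are zero; \<open>Cov_exists\<close> says that all three
  expectations in \<open>Cov\<close> are genuine.\<close>

definition Cov_exists :: "(complex^'n::finite) set \<Rightarrow> complex^'n
    \<Rightarrow> (complex^'n \<Rightarrow> complex) \<Rightarrow> (complex^'n \<Rightarrow> complex) \<Rightarrow> bool" where
  "Cov_exists \<Omega> z f g \<longleftrightarrow> integrable (bergman_prob \<Omega> z) f \<and> integrable (bergman_prob \<Omega> z) g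
     \<and> integrable (bergman_prob \<Omega> z) (\<lambda>\<xi>. f \<xi> * cnj (g \<xi>))"

definition score :: "(complex^'n::finite) set \<Rightarrow> complex^'n \<Rightarrow> 'n \<Rightarrow> complex^'n \<Rightarrow> complex" where
  "score \<Omega> z \<alpha> \<xi> = wirt \<alpha> (loglik \<Omega> \<xi>) z"

definition normal_field ::
    "(complex^'n::finite) set \<Rightarrow> complex^'n \<Rightarrow> 'n \<Rightarrow> 'n \<Rightarrow> complex^'n \<Rightarrow> complex" where
  "normal_field \<Omega> z \<alpha> \<gamma> \<xi> =
     wirt \<alpha> (wirt \<gamma> (loglik \<Omega> \<xi>)) z + score \<Omega> z \<alpha> \<xi> * score \<Omega> z \<gamma> \<xi>
     - (\<Sum>i\<in>UNIV. bergman_christoffel \<Omega> i \<alpha> \<gamma> z * score \<Omega> z i \<xi>)"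

definition tangent_prob :: "'x measure \<Rightarrow> ('x \<Rightarrow> complex) set" where
  "tangent_prob \<mu> = {\<phi>. integrable \<mu> \<phi> \<and> (\<integral>x. \<phi> x \<partial>\<mu>) = 0}"

definition orthogonal_to_model ::
    "(complex^'n::finite) set \<Rightarrow> complex^'n \<Rightarrow> (complex^'n \<Rightarrow> complex) \<Rightarrow> bool" where
  "orthogonal_to_model \<Omega> z \<phi> \<longleftrightarrow>
     (\<forall>\<beta>. integrable (bergman_prob \<Omega> z) (\<lambda>\<xi>. \<phi> \<xi> * cnj (score \<Omega> z \<beta> \<xi>))
        \<and> expect \<Omega> z (\<lambda>\<xi>. \<phi> \<xi> * cnj (score \<Omega> z \<beta> \<xi>)) = 0)"

definition derivative_monomial :: "(complex^'n::finite) set \<Rightarrow> ('n \<Rightarrow> nat) list \<Rightarrow> ('n \<Rightarrow> nat) list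
    \<Rightarrow> complex^'n \<Rightarrow> complex^'n \<Rightarrow> complex" where
  "derivative_monomial \<Omega> \<Gamma>s \<Lambda>s z \<xi> =
     (\<Prod>\<Gamma>\<leftarrow>\<Gamma>s. wirt_multi \<Gamma> (loglik \<Omega> \<xi>) z) * (\<Prod>\<Lambda>\<leftarrow>\<Lambda>s. wirt_bar_multi \<Lambda> (loglik \<Omega> \<xi>) z)"

definition condition_C :: "nat \<Rightarrow> (complex^'n::finite) set \<Rightarrow> bool" where
  "condition_C k \<Omega> \<longleftrightarrow>
     (\<forall>\<Gamma>s \<Lambda>s. (\<lambda>_. 0) \<notin> set \<Gamma>s \<union> set \<Lambda>s
        \<and> (\<Sum>\<Gamma>\<leftarrow>\<Gamma>s. multi_order \<Gamma>) + (\<Sum>\<Lambda>\<leftarrow>\<Lambda>s. multi_order \<Lambda>) \<le> k \<longrightarrow>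
        (\<forall>z\<in>\<Omega>. integrable (bergman_prob \<Omega> z) (derivative_monomial \<Omega> \<Gamma>s \<Lambda>s z))
        \<and> continuous_on \<Omega>
            (\<lambda>z. \<integral>\<xi>. cmod (derivative_monomial \<Omega> \<Gamma>s \<Lambda>s z \<xi>) \<partial>bergman_prob \<Omega> z))"

end

theory Submission
  imports Defs "HOL-Complex_Analysis.Conformal_Mappings"
begin

text \<open>Let \<open>K\<close> be the Bergman kernel. Off the null set where \<open>K z \<xi> = 0\<close>, the score
  \<open>\<partial>\<^sub>\<alpha> l\<close> equals \<open>\<partial>\<^sub>\<alpha>K z \<xi> / K z \<xi> - \<partial>\<^sub>\<alpha> log K z z\<close>. In \<open>\<partial>\<^sub>\<alpha>\<partial>\<^sub>\<gamma> l + \<partial>\<^sub>\<alpha> l \<partial>\<^sub>\<gamma> l\<close> the terms quadratic in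
  \<open>\<partial>K / K\<close> cancel, so that it too is a linear combination of quotients \<open>\<partial>\<^sup>IK z \<xi> / K z \<xi>\<close>. Differentiating
  \<open>\<integral> |K z \<xi>|\<^sup>2 d\<xi> = K z z\<close> under the integral sign shows that the covariances of these quotients under
  the density \<open>|K z \<xi>|\<^sup>2 / K z z\<close> are the mixed derivatives of \<open>K z z\<close> divided by \<open>K z z\<close>. Metric and
  curvature are polynomials in the same quotients, which reduces both formulas to polynomial identities.
  The dominating functions come from the sub-mean value inequality \<open>|f z|\<^sup>2 |B| \<le> \<integral>\<^sub>B |f|\<^sup>2\<close> on balls
  \<open>B\<close> about \<open>z\<close>, applied to \<open>z \<mapsto> K z \<xi>\<close>, and from Cauchy estimates.\<close>

section \<open>Isometry invariance of Lebesgue measure and the sub-mean value inequality\<close>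

text \<open>The kernel is a sum over a basis chosen by \<open>SOME\<close>, so nothing can be read
  off its terms. Zorn's lemma provides a basis, and Parseval's identity identifies the kernel with
  the Riesz representers of point evaluation, which do not depend on the choice. A dominating
  function must bound \<open>|K w \<xi>|^2\<close> for all \<open>w\<close> near \<open>z\<close> at
  once and still be integrable in \<open>\<xi>\<close>. The average of \<open>|K u \<xi>|^2\<close>
  over \<open>u\<close> in a ball does both: the sub-mean value inequality gives the bound, and
  Tonelli gives integrability because the norms of \<open>K u\<close> are locally bounded. That
  inequality comes from averaging circle means over all directions, which uses the invariance of
  Lebesgue measure under multiplication by unit complex numbers; hence the detour through
  isometries. The other obstacle is the zero set of \<open>K z\<close>, where \<open>l\<close> has
  no meaningful value. It is a null set, so statements about scores are proved for representatives
  built from kernel quotients and transferred almost everywhere.\<close>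

lemma nn_integral_lborel_shift:
  fixes c :: "'a::euclidean_space"
  assumes [measurable]: "f \<in> borel_measurable borel"
  shows "(\<integral>\<^sup>+x. f (c + x) \<partial>lborel) = (\<integral>\<^sup>+x. f x \<partial>lborel)"
proof -
  have "(\<integral>\<^sup>+x. f x \<partial>lborel) = (\<integral>\<^sup>+x. f x \<partial>distr lborel borel ((+) c))"
    by (simp add: lborel_distr_plus)
  also have "\<dots> = (\<integral>\<^sup>+x. f (c + x) \<partial>lborel)"
    by (subst nn_integral_distr) auto
  finally show ?thesis by simp
qed

lemma nn_integral_lborel_reflect:
  fixes c :: "'a::euclidean_space"
  assumes [measurable]: "f \<in> borel_measurable borel"
  shows "(\<integral>\<^sup>+x. f (c - x) \<partial>lborel) = (\<integral>\<^sup>+x. f x \<partial>lborel)"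
proof -
  have "lborel = distr lborel borel (\<lambda>x::'a. c - x)"
    using lborel_affine[of "-1" c] by (simp add: density_1)
  then have "(\<integral>\<^sup>+x. f x \<partial>lborel) = (\<integral>\<^sup>+x. f x \<partial>distr lborel borel (\<lambda>x::'a. c - x))"
    by simp
  also have "\<dots> = (\<integral>\<^sup>+x. f (c - x) \<partial>lborel)"
    by (subst nn_integral_distr) auto
  finally show ?thesis by simp
qed

text \<open>Uniqueness of Haar measure: by Fubini and translation invariance,
  \<open>|A| |U\<inverse>B| = |U\<inverse>A| |B|\<close> for all Borel sets; take for \<open>B\<close> the unit ball.\<close>

lemma emeasure_isometry_vimage:
  fixes U :: "'a::euclidean_space \<Rightarrow> 'a"
  assumes "linear U" and iso: "\<And>x. norm (U x) = norm x" and A[measurable]: "A \<in> sets borel"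
  shows "emeasure lborel (U -` A) = emeasure lborel A"
proof -
  have cU: "continuous_on UNIV U"
    by (rule linear_continuous_on[OF linear_linear[THEN iffD2, OF \<open>linear U\<close>]])
  have [measurable]: "U \<in> borel_measurable borel"
    by (rule borel_measurable_continuous_onI[OF cU])
  have "inj U"
    using \<open>linear U\<close> iso by (metis linear_injective_0 norm_eq_zero)
  then have "surj U" using \<open>linear U\<close> by (simp add: linear_injective_imp_surjective)
  have Uadd: "U (x + y) = U x + U y" for x y using \<open>linear U\<close> by (rule linear_add)
  define B where "B = ball (0::'a) 1"
  have [measurable]: "B \<in> sets borel" by (simp add: B_def)
  \<comment> \<open>An isometry preserves the unit ball, so \<open>B\<close> may be replaced by its
    preimage on the left-hand side; this makes the constant in the uniqueness of Haar measure equal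
    to 1.\<close>
  have UB: "indicator B (U y) = (indicator B y :: ennreal)" for y
    by (auto simp: B_def iso indicator_def)
  let ?i = "\<lambda>S x. indicator S x :: ennreal"
  have vA: "(\<integral>\<^sup>+y. ?i A (U y) \<partial>lborel) = emeasure lborel (U -` A)"
    using measurable_sets_borel[OF \<open>U \<in> borel_measurable borel\<close> A]
    by (subst nn_integral_indicator[symmetric]) (auto intro!: nn_integral_cong simp: indicator_def simp del: nn_integral_indicator)
  have "emeasure lborel A * emeasure lborel B = (\<integral>\<^sup>+y. ?i B (U y) * (\<integral>\<^sup>+x. ?i A x \<partial>lborel) \<partial>lborel)"
    by (simp add: UB nn_integral_multc mult.commute)
  also have "\<dots> = (\<integral>\<^sup>+y. (\<integral>\<^sup>+x. ?i B (U y) * ?i A (U y + x) \<partial>lborel) \<partial>lborel)"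
    by (intro nn_integral_cong, subst nn_integral_cmult, simp, subst nn_integral_lborel_shift) auto
  also have "\<dots> = (\<integral>\<^sup>+x. (\<integral>\<^sup>+y. ?i B (U y) * ?i A (U y + x) \<partial>lborel) \<partial>lborel)"
    by (rule lborel_pair.Fubini') measurable
  also have "\<dots> = (\<integral>\<^sup>+x. (\<integral>\<^sup>+y. ?i B (U y - x) * ?i A (U y) \<partial>lborel) \<partial>lborel)"
  proof (rule nn_integral_cong)
    fix x
    \<comment> \<open>Translating \<open>y\<close> by a preimage of \<open>-x\<close> moves the
      shift from the argument of \<open>A\<close> to that of \<open>B\<close>, so that
      \<open>x\<close> can be integrated out.\<close>
    obtain w where w: "U w = - x" using \<open>surj U\<close> by (metis surjD)
    have "(\<integral>\<^sup>+y. ?i B (U y) * ?i A (U y + x) \<partial>lborel)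
        = (\<integral>\<^sup>+y. ?i B (U (w + y)) * ?i A (U (w + y) + x) \<partial>lborel)"
      by (rule nn_integral_lborel_shift[symmetric]) simp
    then show "(\<integral>\<^sup>+y. ?i B (U y) * ?i A (U y + x) \<partial>lborel) = (\<integral>\<^sup>+y. ?i B (U y - x) * ?i A (U y) \<partial>lborel)"
      by (simp add: Uadd w)
  qed
  also have "\<dots> = (\<integral>\<^sup>+y. (\<integral>\<^sup>+x. ?i B (U y - x) * ?i A (U y) \<partial>lborel) \<partial>lborel)"
    by (rule lborel_pair.Fubini'[symmetric]) measurable
  also have "\<dots> = (\<integral>\<^sup>+y. emeasure lborel B * ?i A (U y) \<partial>lborel)"
    by (intro nn_integral_cong, subst nn_integral_multc, simp, subst nn_integral_lborel_reflect) auto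
  also have "\<dots> = emeasure lborel B * emeasure lborel (U -` A)"
    by (subst nn_integral_cmult) (auto simp: vA)
  finally have eq: "emeasure lborel A * emeasure lborel B = emeasure lborel B * emeasure lborel (U -` A)" .
  have "emeasure lborel B \<noteq> 0" "emeasure lborel B \<noteq> \<infinity>"
    using emeasure_lborel_ball_finite[of 0 1] content_ball_pos[of 1 "0::'a"]
    by (auto simp: B_def measure_def less_top)
  then show ?thesis using eq
    by (metis ennreal_mult_cancel_left infinity_ennreal_def mult.commute)
qed

lemma lborel_distr_isometry:
  fixes U :: "'a::euclidean_space \<Rightarrow> 'a"
  assumes "linear U" and iso: "\<And>x. norm (U x) = norm x"
  shows "distr lborel borel U = lborel"
proof (rule measure_eqI)
  have [measurable]: "U \<in> borel_measurable borel"
    by (rule borel_measurable_continuous_onI[OF linear_continuous_on[OF linear_linear[THEN iffD2, OF \<open>linear U\<close>]]])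
  show "emeasure (distr lborel borel U) A = emeasure lborel A" if "A \<in> sets (distr lborel borel U)" for A
    using that emeasure_isometry_vimage[OF assms] by (simp add: emeasure_distr)
qed simp

section \<open>Complex lines and circle means\<close>

lemma bounded_bilinear_vector_smult:
  "bounded_bilinear ((*s) :: complex \<Rightarrow> complex^'n \<Rightarrow> complex^'n::finite)"
proof
  show "\<exists>K. \<forall>(a::complex) (b::complex^'n). norm (a *s b) \<le> norm a * norm b * K"
    by (rule exI[of _ 1]) (auto simp: norm_vec_def vector_scalar_mult_def norm_mult L2_set_right_distrib)
qed (auto simp: vec_eq_iff algebra_simps)

lemma norm_vector_smult: "norm (c *s v) = cmod c * norm (v :: complex^'n::finite)"
  by (auto simp: norm_vec_def vector_scalar_mult_def norm_mult L2_set_right_distrib)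

lemma linear_vector_smult: "linear ((*s) c :: complex^'n \<Rightarrow> complex^'n::finite)"
  by (auto intro!: linearI simp: vec_eq_iff algebra_simps)

lemma holomorphic_Cn_imp_differentiable:
  "holomorphic_Cn f \<Omega> \<Longrightarrow> z \<in> \<Omega> \<Longrightarrow> f differentiable (at z)"
  unfolding holomorphic_Cn_def differentiable_def by blast

lemma holomorphic_Cn_frechet:
  assumes "holomorphic_Cn f \<Omega>" "z \<in> \<Omega>"
  shows "(f has_derivative frechet_derivative f (at z)) (at z)"
    and "frechet_derivative f (at z) (c *s v) = c * frechet_derivative f (at z) v"
proof -
  show 1: "(f has_derivative frechet_derivative f (at z)) (at z)"
    using holomorphic_Cn_imp_differentiable[OF assms] frechet_derivative_works by blast
  obtain D where "(f has_derivative D) (at z)" "\<forall>c v. D (c *s v) = c * D v"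
    using assms unfolding holomorphic_Cn_def by blast
  with 1 show "frechet_derivative f (at z) (c *s v) = c * frechet_derivative f (at z) v"
    by (metis has_derivative_unique)
qed

lemma holomorphic_Cn_continuous_on: "holomorphic_Cn f \<Omega> \<Longrightarrow> continuous_on \<Omega> f"
  by (intro continuous_at_imp_continuous_on ballI differentiable_imp_continuous_within
      holomorphic_Cn_imp_differentiable)

text \<open>Complex linearity of the derivative \<open>D\<close> turns the chain rule's
  \<open>h \<mapsto> D (h v)\<close> into multiplication by \<open>D v\<close>. Restriction to lines
  is how one-variable Cauchy theory enters throughout.\<close>

lemma holomorphic_Cn_line_deriv:
  assumes "holomorphic_Cn f \<Omega>" "z + \<zeta> *s v \<in> \<Omega>"
  shows "((\<lambda>\<zeta>. f (z + \<zeta> *s v)) has_field_derivative frechet_derivative f (at (z + \<zeta> *s v)) v) (at \<zeta>)"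
proof -
  note D = holomorphic_Cn_frechet[OF assms]
  have "((\<lambda>\<zeta>. z + \<zeta> *s v) has_derivative (\<lambda>h. h *s v)) (at \<zeta>)"
    using bounded_bilinear.FDERIV[OF bounded_bilinear_vector_smult has_derivative_ident has_derivative_const[of v]]
    by (auto intro!: derivative_eq_intros)
  from diff_chain_at[OF this D(1)] show ?thesis
    by (simp add: D(2) has_field_derivative_def o_def mult_commute_abs)
qed

lemma holomorphic_Cn_line:
  assumes "holomorphic_Cn f \<Omega>" "\<And>\<zeta>. \<zeta> \<in> S \<Longrightarrow> z + \<zeta> *s v \<in> \<Omega>"
  shows "(\<lambda>\<zeta>. f (z + \<zeta> *s v)) holomorphic_on S"
  unfolding holomorphic_on_def field_differentiable_def
  using holomorphic_Cn_line_deriv[OF assms(1) assms(2)] has_field_derivative_at_within by blast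

text \<open>Cauchy's formula at the centre: on the unit circle the velocity is \<open>2 pi i\<close>
  times the position, so the Cauchy kernel cancels and a plain average over \<open>t\<close>
  remains.\<close>

lemma circle_mean_has_integral:
  assumes g: "continuous_on (cball 0 1) g" "g holomorphic_on ball 0 1"
  shows "((\<lambda>t. g (exp (2 * of_real pi * \<i> * of_real t))) has_integral g 0) {0..1}"
proof -
  have "((\<lambda>u. g u / (u - 0)) has_contour_integral (2 * of_real pi * \<i> * g 0)) (circlepath 0 1)"
    using g by (intro Cauchy_integral_circlepath) auto
  then have "((\<lambda>x. g (circlepath 0 1 x) / circlepath 0 1 x * vector_derivative (circlepath 0 1) (at x within {0..1}))
     has_integral (2 * of_real pi * \<i> * g 0)) {0..1}"
    by (simp add: has_contour_integral_def)
  then have "((\<lambda>x. 2 * of_real pi * \<i> * g (exp (2 * of_real pi * \<i> * of_real x)))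
     has_integral (2 * of_real pi * \<i> * g 0)) {0..1}"
    by (rule has_integral_eq[rotated]) (simp add: vector_derivative_circlepath01 circlepath[unfolded fun_eq_iff])
  from has_integral_mult_right[OF this, of "1 / (2 * of_real pi * \<i>)"] show ?thesis by simp
qed

lemma circle_mean_nn_integral:
  assumes g: "continuous_on (cball 0 1) g" "g holomorphic_on ball 0 1"
  shows "ennreal (cmod (g 0)) \<le> (\<integral>\<^sup>+t\<in>{0..1}. ennreal (cmod (g (exp (2 * of_real pi * \<i> * of_real t)))) \<partial>lborel)"
proof -
  define h where "h t = g (exp (2 * of_real pi * \<i> * of_real t))" for t :: real
  have "continuous_on {0..1} h"
    unfolding h_def by (intro continuous_on_compose2[OF g(1)] continuous_intros) (auto simp: norm_exp_eq_Re)
  then have si: "set_integrable lborel {0..1} h"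
    unfolding set_integrable_def by (rule borel_integrable_compact[OF compact_Icc])
  have "(h has_integral g 0) {0..1}" using circle_mean_has_integral[OF g] unfolding h_def .
  then have "g 0 = (LINT t:{0..1}|lborel. h t)"
    using si set_borel_integral_eq_integral(2)[OF si] by (simp add: integral_unique)
  then have "cmod (g 0) \<le> (LINT t:{0..1}|lborel. cmod (h t))"
    using set_integral_norm_bound[OF si] by simp
  also have "ennreal \<dots> = (\<integral>\<^sup>+t\<in>{0..1}. ennreal (cmod (h t)) \<partial>lborel)"
    using set_integrable_norm[OF si]
    by (subst nn_integral_set_ennreal) (auto simp: set_lebesgue_integral_def set_integrable_def mult.commute nn_integral_eq_integral)
  finally show ?thesis by (simp add: h_def ennreal_leI)
qed

text \<open>For each \<open>x\<close> the value at \<open>p\<close> is at most the mean over the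
  circle \<open>p + e t *s x\<close>. Integrate this over \<open>x\<close> in the ball and exchange
  the integrals; each rotated integral over \<open>x\<close> has the same value, so the average over
  \<open>t\<close> disappears.\<close>

lemma holomorphic_Cn_sub_mean:
  fixes f :: "complex^'n::finite \<Rightarrow> complex"
  assumes f: "holomorphic_Cn f \<Omega>" and sub: "ball p r \<subseteq> \<Omega>"
  shows "ennreal ((cmod (f p))\<^sup>2) * emeasure lborel (ball p r) \<le> (\<integral>\<^sup>+x\<in>ball p r. ennreal ((cmod (f x))\<^sup>2) \<partial>lborel)"
proof -
  define e where "e t = exp (2 * of_real pi * \<i> * of_real t)" for t :: real
  have ne: "cmod (e t) = 1" for t by (simp add: e_def norm_exp_eq_Re)
  define F where "F y = indicator (ball p r) y * ennreal ((cmod (f y))\<^sup>2)" for y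
  have cf: "continuous_on (ball p r) f"
    using holomorphic_Cn_continuous_on[OF f] sub continuous_on_subset by blast
  have "(\<lambda>y. indicator (ball p r) y *\<^sub>R ((cmod (f y))\<^sup>2)) \<in> borel_measurable borel"
    by (intro borel_measurable_continuous_on_indicator continuous_intros cf) auto
  then have "(\<lambda>y. ennreal (indicator (ball p r) y *\<^sub>R ((cmod (f y))\<^sup>2))) \<in> borel_measurable borel"
    by measurable
  also have "(\<lambda>y. ennreal (indicator (ball p r) y *\<^sub>R ((cmod (f y))\<^sup>2))) = F"
    by (auto simp: F_def indicator_def)
  finally have F[measurable]: "F \<in> borel_measurable borel" .
  have ce: "continuous_on UNIV (\<lambda>q::real \<times> (complex^'n). p + e (fst q) *s snd q)"
    unfolding e_def
    by (intro continuous_intros bounded_bilinear.continuous_on[OF bounded_bilinear_vector_smult])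
  have [measurable]: "(\<lambda>q::real \<times> (complex^'n). p + e (fst q) *s snd q) \<in> borel_measurable (borel \<Otimes>\<^sub>M borel)"
    unfolding borel_prod by (rule borel_measurable_continuous_onI[OF ce])
  have mF: "(\<lambda>(t, x). F (p + e t *s x)) \<in> borel_measurable (borel \<Otimes>\<^sub>M borel)"
    using measurable_compose[OF _ F, of "\<lambda>q. p + e (fst q) *s snd q"] by (simp add: case_prod_unfold)
  note [measurable (raw)] = mF[unfolded case_prod_unfold]
  have mFx: "(\<lambda>q. F (p + e (snd q) *s fst q)) \<in> borel_measurable ((borel::(complex^'n) measure) \<Otimes>\<^sub>M (borel::real measure))"
    using measurable_compose[OF measurable_pair_swap' mF] by (simp add: case_prod_unfold)
  have 1: "ennreal ((cmod (f p))\<^sup>2) * indicator (ball 0 r) x \<le> (\<integral>\<^sup>+t\<in>{0..1}. F (p + e t *s x) \<partial>lborel)" for x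
  proof (cases "x \<in> ball 0 r")
    case True
    have in_ball: "p + \<zeta> *s x \<in> ball p r" if "cmod \<zeta> \<le> 1" for \<zeta>
      using that True mult_mono[of "cmod \<zeta>" 1 "norm x" "norm x"] by (simp add: dist_norm norm_vector_smult)
    \<comment> \<open>The square is taken before the modulus: \<open>f^2\<close> is itself
      holomorphic, so its mean value property bounds \<open>|f|^2\<close> directly.\<close>
    have hol: "(\<lambda>\<zeta>. (f (p + \<zeta> *s x))\<^sup>2) holomorphic_on cball 0 1"
      using sub in_ball by (intro holomorphic_intros holomorphic_Cn_line[OF f]) auto
    have "ennreal (cmod ((f (p + 0 *s x))\<^sup>2))
       \<le> (\<integral>\<^sup>+t\<in>{0..1}. ennreal (cmod ((f (p + e t *s x))\<^sup>2)) \<partial>lborel)"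
      unfolding e_def
      using circle_mean_nn_integral[OF holomorphic_on_imp_continuous_on[OF hol] holomorphic_on_subset[OF hol]] by auto
    also have "\<dots> = (\<integral>\<^sup>+t\<in>{0..1}. F (p + e t *s x) \<partial>lborel)"
      using in_ball by (intro nn_integral_cong) (auto simp: F_def ne norm_power indicator_def)
    finally show ?thesis using True by (simp add: norm_power)
  qed simp
  \<comment> \<open>After centring at \<open>p\<close>, multiplication by the unit number
    \<open>e t\<close> is a linear isometry and preserves Lebesgue measure.\<close>
  have 2: "(\<integral>\<^sup>+x. F (p + e t *s x) \<partial>lborel) = (\<integral>\<^sup>+x. F x \<partial>lborel)" for t
  proof -
    have U[measurable]: "(*s) (e t) \<in> borel_measurable (borel :: (complex^'n) measure)"
      by (rule borel_measurable_continuous_onI[OF linear_continuous_on[OF linear_linear[THEN iffD2, OF linear_vector_smult]]])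
    have "(\<integral>\<^sup>+x. F x \<partial>lborel) = (\<integral>\<^sup>+x. F (p + x) \<partial>lborel)"
      by (rule nn_integral_lborel_shift[symmetric]) simp
    also have "\<dots> = (\<integral>\<^sup>+x. F (p + x) \<partial>distr lborel borel ((*s) (e t)))"
      by (subst lborel_distr_isometry) (auto simp: linear_vector_smult norm_vector_smult ne)
    also have "\<dots> = (\<integral>\<^sup>+x. F (p + e t *s x) \<partial>lborel)"
      by (subst nn_integral_distr) auto
    finally show ?thesis by simp
  qed
  have "emeasure lborel (ball p r) = (\<integral>\<^sup>+x. indicator (ball p r) x \<partial>lborel)" by simp
  also have "\<dots> = (\<integral>\<^sup>+x. indicator (ball p r) (p + x) \<partial>lborel)"
    by (rule nn_integral_lborel_shift[symmetric]) (auto intro!: borel_measurable_indicator)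
  also have "\<dots> = (\<integral>\<^sup>+x. indicator (ball (0::complex^'n) r) x \<partial>lborel)"
    by (rule nn_integral_cong) (auto simp: indicator_def dist_norm)
  finally have "ennreal ((cmod (f p))\<^sup>2) * emeasure lborel (ball p r)
      = (\<integral>\<^sup>+x. ennreal ((cmod (f p))\<^sup>2) * indicator (ball (0::complex^'n) r) x \<partial>lborel)"
    by (subst nn_integral_cmult_indicator) simp_all
  also have "\<dots> \<le> (\<integral>\<^sup>+x. (\<integral>\<^sup>+t\<in>{0..1}. F (p + e t *s x) \<partial>lborel) \<partial>lborel)"
    by (intro nn_integral_mono 1)
  also have "\<dots> = (\<integral>\<^sup>+t. (\<integral>\<^sup>+x. F (p + e t *s x) * indicator {0..1} t \<partial>lborel) \<partial>lborel)"
    using mFx by (intro lborel_pair.Fubini') (simp add: case_prod_unfold)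
  also have "\<dots> = (\<integral>\<^sup>+t. indicator {0..1::real} t * (\<integral>\<^sup>+x. F x \<partial>lborel) \<partial>lborel)"
  proof (rule nn_integral_cong)
    fix t
    have "(\<lambda>x. F (p + e t *s x)) \<in> borel_measurable borel"
      using measurable_compose[OF _ mF, of "Pair t" borel] by simp
    then show "(\<integral>\<^sup>+x. F (p + e t *s x) * indicator {0..1} t \<partial>lborel)
        = indicator {0..1} t * (\<integral>\<^sup>+x. F x \<partial>lborel)"
      by (subst nn_integral_multc) (auto simp: 2 mult.commute)
  qed
  also have "\<dots> = (\<integral>\<^sup>+x. F x \<partial>lborel)"
    by (subst nn_integral_multc) auto
  finally show ?thesis by (simp add: F_def mult.commute)
qed

section \<open>Holomorphic functions of several variables\<close>

text \<open>One-variable Cauchy inequality on the complex line through \<open>z\<close> in the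
  normalised direction of \<open>v\<close>, where the disc still has radius
  \<open>r\<close>.\<close>

lemma holomorphic_Cn_Cauchy_estimate:
  fixes f :: "complex^'n::finite \<Rightarrow> complex"
  assumes f: "holomorphic_Cn f \<Omega>" and sub: "cball z r \<subseteq> \<Omega>" and "r > 0"
    and M: "\<And>w. w \<in> cball z r \<Longrightarrow> cmod (f w) \<le> M"
  shows "cmod (frechet_derivative f (at z) v) \<le> M / r * norm v"
proof (cases "v = 0")
  case True
  have "z \<in> \<Omega>" using sub \<open>r > 0\<close> by auto
  from holomorphic_Cn_frechet(1)[OF f this] have "linear (frechet_derivative f (at z))"
    using has_derivative_linear by blast
  with True show ?thesis by (simp add: linear_0)
next
  case False
  define u where "u = (1 / norm v) *\<^sub>R v"
  have nu: "norm u = 1" using False by (simp add: u_def)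
  have v: "v = of_real (norm v) *s u"
    using False by (subst vec_eq_iff) (simp add: u_def scaleR_conv_of_real[of _ "v $ i" for i])
  have inb: "z + \<zeta> *s u \<in> cball z r" if "cmod \<zeta> \<le> r" for \<zeta>
    using that by (simp add: dist_norm norm_vector_smult nu)
  have hol: "(\<lambda>\<zeta>. f (z + \<zeta> *s u)) holomorphic_on cball 0 r"
    using inb sub by (intro holomorphic_Cn_line[OF f]) auto
  have z: "z + 0 *s u \<in> \<Omega>" using sub \<open>r > 0\<close> by auto
  have "cmod ((deriv ^^ 1) (\<lambda>\<zeta>. f (z + \<zeta> *s u)) 0) \<le> fact 1 * M / r ^ 1"
    using inb M
    by (intro Cauchy_inequality holomorphic_on_subset[OF hol] holomorphic_on_imp_continuous_on[OF hol] \<open>r > 0\<close>) auto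
  then have "cmod (frechet_derivative f (at z) u) \<le> M / r"
    using DERIV_imp_deriv[OF holomorphic_Cn_line_deriv[OF f z]] by simp
  then have "norm v * cmod (frechet_derivative f (at z) u) \<le> norm v * (M / r)"
    by (intro mult_left_mono) auto
  moreover have "frechet_derivative f (at z) v = of_real (norm v) * frechet_derivative f (at z) u"
    using z by (subst v, subst holomorphic_Cn_frechet(2)[OF f]) auto
  ultimately show ?thesis by (simp add: norm_mult mult.commute)
qed

section \<open>Closure properties, uniform limits and derivatives\<close>

lemma holomorphic_CnI:
  assumes "\<And>z. z \<in> \<Omega> \<Longrightarrow> \<exists>D. (f has_derivative D) (at z) \<and> (\<forall>c v. D (c *s v) = c * D v)"
  shows "holomorphic_Cn f \<Omega>"
  using assms unfolding holomorphic_Cn_def by blast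

lemma holomorphic_Cn_subset: "holomorphic_Cn f \<Omega> \<Longrightarrow> S \<subseteq> \<Omega> \<Longrightarrow> holomorphic_Cn f S"
  unfolding holomorphic_Cn_def by blast

lemma holomorphic_Cn_const [simp]: "holomorphic_Cn (\<lambda>z. c) \<Omega>"
  by (rule holomorphic_CnI, rule exI[of _ "\<lambda>_. 0"]) auto

lemma holomorphic_Cn_add:
  assumes "holomorphic_Cn f \<Omega>" "holomorphic_Cn g \<Omega>"
  shows "holomorphic_Cn (\<lambda>z. f z + g z) \<Omega>"
proof (rule holomorphic_CnI)
  fix z assume z: "z \<in> \<Omega>"
  show "\<exists>D. ((\<lambda>z. f z + g z) has_derivative D) (at z) \<and> (\<forall>c v. D (c *s v) = c * D v)"
    using has_derivative_add[OF holomorphic_Cn_frechet(1)[OF assms(1) z] holomorphic_Cn_frechet(1)[OF assms(2) z]]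
    by (intro exI conjI allI) (auto simp: holomorphic_Cn_frechet(2)[OF assms(1) z] holomorphic_Cn_frechet(2)[OF assms(2) z] algebra_simps)
qed

lemma holomorphic_Cn_cmult:
  assumes "holomorphic_Cn f \<Omega>"
  shows "holomorphic_Cn (\<lambda>z. a * f z) \<Omega>"
proof (rule holomorphic_CnI)
  fix z assume z: "z \<in> \<Omega>"
  show "\<exists>D. ((\<lambda>z. a * f z) has_derivative D) (at z) \<and> (\<forall>c v. D (c *s v) = c * D v)"
    using has_derivative_mult_right[OF holomorphic_Cn_frechet(1)[OF assms z], of a]
    by (intro exI conjI allI) (auto simp: holomorphic_Cn_frechet(2)[OF assms z] algebra_simps)
qed

lemma holomorphic_Cn_diff:
  assumes "holomorphic_Cn f \<Omega>" "holomorphic_Cn g \<Omega>"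
  shows "holomorphic_Cn (\<lambda>z. f z - g z) \<Omega>"
  using holomorphic_Cn_add[OF assms(1) holomorphic_Cn_cmult[OF assms(2), of "-1"]] by simp

lemma holomorphic_Cn_translate:
  assumes f: "holomorphic_Cn f \<Omega>" and "\<And>z. z \<in> S \<Longrightarrow> z + a \<in> \<Omega>"
  shows "holomorphic_Cn (\<lambda>z. f (z + a)) S"
proof (rule holomorphic_CnI)
  fix z assume "z \<in> S"
  then have z: "z + a \<in> \<Omega>" using assms(2) by blast
  have "((\<lambda>z. z + a) has_derivative (\<lambda>h. h)) (at z)" by (auto intro!: derivative_eq_intros)
  from diff_chain_at[OF this holomorphic_Cn_frechet(1)[OF f z]]
  show "\<exists>D. ((\<lambda>z. f (z + a)) has_derivative D) (at z) \<and> (\<forall>c v. D (c *s v) = c * D v)"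
    by (intro exI conjI allI) (auto simp: holomorphic_Cn_frechet(2)[OF f z] o_def)
qed

lemma holomorphic_Cn_cong_open:
  assumes "open S" "\<And>z. z \<in> S \<Longrightarrow> f z = g z"
  shows "holomorphic_Cn f S \<longleftrightarrow> holomorphic_Cn g S"
  unfolding holomorphic_Cn_def
  by (intro ball_cong refl, metis assms has_derivative_transform_within_open)

lemma holomorphic_Cn_coord: "holomorphic_Cn (\<lambda>z::complex^'n::finite. z $ i) \<Omega>"
  by (rule holomorphic_CnI, rule exI[of _ "\<lambda>z. z $ i"])
     (auto intro!: bounded_linear_imp_has_derivative bounded_linear_vec_nth)

text \<open>Weierstrass: Cauchy estimates on a smaller ball upgrade uniform convergence of the
  functions to uniform convergence of the derivatives, so sequences may be differentiated term by
  term. Complex linearity of the derivative survives pointwise limits.\<close>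

lemma holomorphic_Cn_uniform_limit:
  fixes F :: "nat \<Rightarrow> complex^'n::finite \<Rightarrow> complex"
  assumes F: "\<And>n. holomorphic_Cn (F n) \<Omega>"
    and lim: "\<And>z. z \<in> \<Omega> \<Longrightarrow> \<exists>r>0. cball z r \<subseteq> \<Omega> \<and> uniform_limit (cball z r) F f sequentially"
  shows "holomorphic_Cn f \<Omega>"
proof (rule holomorphic_CnI)
  fix z assume "z \<in> \<Omega>"
  then obtain r where r: "r > 0" "cball z r \<subseteq> \<Omega>" and u: "uniform_limit (cball z r) F f sequentially"
    using lim by blast
  \<comment> \<open>Half the radius, so that a closed ball of radius \<open>r/2\<close> about any
    point of \<open>S\<close> still lies in the region of uniform convergence.\<close>
  define S where "S = ball z (r/2)"
  have sub: "cball w (r/2) \<subseteq> cball z r" if "w \<in> S" for w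
  proof
    fix x assume "x \<in> cball w (r/2)"
    then show "x \<in> cball z r" using that dist_triangle[of z x w] by (simp add: S_def)
  qed
  have S\<Omega>: "w \<in> \<Omega>" if "w \<in> S" for w using that r unfolding S_def by auto
  define D where "D n w = frechet_derivative (F n) (at w)" for n w
  have D: "(F n has_derivative D n w) (at w)" "D n w (c *s v) = c * D n w v" if "w \<in> S" for n w c v
    using holomorphic_Cn_frechet[OF F S\<Omega>[OF that]] unfolding D_def by auto
  have Cau: "\<exists>N. \<forall>m\<ge>N. \<forall>n\<ge>N. \<forall>w\<in>S. \<forall>v. cmod (D m w v - D n w v) \<le> e * norm v" if "e > 0" for e
  proof -
    have "\<forall>\<^sub>F n in sequentially. \<forall>x\<in>cball z r. dist (F n x) (f x) < e * r / 4"
      using uniform_limitD[OF u, of "e * r / 4"] that r(1) by simp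
    then obtain N where N: "\<And>n x. n \<ge> N \<Longrightarrow> x \<in> cball z r \<Longrightarrow> dist (F n x) (f x) < e * r / 4"
      unfolding eventually_sequentially by blast
    \<comment> \<open>Two errors \<open>e r / 4\<close> bound the difference by
      \<open>e r / 2\<close>, and the Cauchy estimate on radius \<open>r / 2\<close> turns this into
      exactly \<open>e\<close>.\<close>
    have "cmod (D m w v - D n w v) \<le> e * norm v" if "m \<ge> N" "n \<ge> N" "w \<in> S" for m n w v
    proof -
      have fd: "frechet_derivative (\<lambda>x. F m x - F n x) (at w) = (\<lambda>v. D m w v - D n w v)"
        by (rule frechet_derivative_at[symmetric]) (intro has_derivative_diff D that)
      have "cmod (F m x - F n x) \<le> e * r / 2" if "x \<in> cball w (r/2)" for x
      proof -
        have "x \<in> cball z r" using that sub \<open>w \<in> S\<close> by blast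
        from N[OF \<open>m \<ge> N\<close> this] N[OF \<open>n \<ge> N\<close> this] show ?thesis
          using dist_triangle2[of "F m x" "F n x" "f x"] by (simp add: dist_norm)
      qed
      then have "cmod (frechet_derivative (\<lambda>x. F m x - F n x) (at w) v) \<le> e * r / 2 / (r / 2) * norm v"
        using sub[OF \<open>w \<in> S\<close>] r
        by (intro holomorphic_Cn_Cauchy_estimate[OF holomorphic_Cn_diff[OF F F]]) auto
      then show ?thesis unfolding fd using r by simp
    qed
    then show ?thesis by blast
  qed
  define g where "g w v = lim (\<lambda>n. D n w v)" for w v
  have glim: "(\<lambda>n. D n w v) \<longlonglongrightarrow> g w v" if "w \<in> S" for w v
  proof -
    have "Cauchy (\<lambda>n. D n w v)"
    proof (rule metric_CauchyI)
      fix e :: real assume "e > 0"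
      then have "e / (norm v + 1) > 0" by (simp add: add_nonneg_pos)
      from Cau[OF this] obtain N where N: "\<forall>m\<ge>N. \<forall>n\<ge>N. \<forall>w\<in>S. \<forall>u. cmod (D m w u - D n w u) \<le> e / (norm v + 1) * norm u" ..
      have "e / (norm v + 1) * norm v = e * (norm v / (norm v + 1))" by simp
      also have "\<dots> < e * 1"
        using \<open>e > 0\<close> by (intro mult_strict_left_mono) (auto simp: divide_less_eq add_nonneg_pos)
      finally have "dist (D m w v) (D n w v) < e" if "m \<ge> N" "n \<ge> N" for m n
        using N[rule_format, OF that \<open>w \<in> S\<close>, of v] by (simp add: dist_norm)
      then show "\<exists>M. \<forall>m\<ge>M. \<forall>n\<ge>M. dist (D m w v) (D n w v) < e"
        by blast
    qed
    then show ?thesis unfolding g_def by (simp add: Cauchy_convergent_iff convergent_LIMSEQ_iff)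
  qed
  have "\<exists>h. \<forall>x\<in>S. (\<lambda>n. F n x) \<longlonglongrightarrow> h x \<and> (h has_derivative g x) (at x within S)"
  proof (rule has_derivative_sequence)
    show "convex S" by (simp add: S_def)
    show "(F n has_derivative D n x) (at x within S)" if "x \<in> S" for n x
      using D(1)[OF that] has_derivative_at_withinI by blast
    show "\<forall>\<^sub>F n in sequentially. \<forall>x\<in>S. \<forall>h. cmod (D n x h - g x h) \<le> e * norm h" if "e > 0" for e
    proof -
      from Cau[OF that] obtain N where N: "\<And>m n w v. m \<ge> N \<Longrightarrow> n \<ge> N \<Longrightarrow> w \<in> S \<Longrightarrow> cmod (D m w v - D n w v) \<le> e * norm v"
        by blast
      have "cmod (D n x h - g x h) \<le> e * norm h" if "n \<ge> N" "x \<in> S" for n x h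
        by (rule tendsto_upperbound[OF tendsto_norm[OF tendsto_diff[OF tendsto_const glim[OF \<open>x \<in> S\<close>]]]])
           (use N that in \<open>auto simp: eventually_sequentially intro!: exI[of _ N]\<close>)
      then show ?thesis unfolding eventually_sequentially by blast
    qed
    show "z \<in> S" using r by (simp add: S_def)
    show "(\<lambda>n. F n z) \<longlonglongrightarrow> f z" using r by (intro tendsto_uniform_limitI[OF u]) auto
  qed
  then obtain h where h: "\<And>x. x \<in> S \<Longrightarrow> (\<lambda>n. F n x) \<longlonglongrightarrow> h x" "\<And>x. x \<in> S \<Longrightarrow> (h has_derivative g x) (at x within S)"
    by blast
  have hf: "h x = f x" if "x \<in> S" for x
  proof -
    have "x \<in> cball z r" using that r by (auto simp: S_def)
    then show ?thesis using tendsto_uniform_limitI[OF u] h(1)[OF that] LIMSEQ_unique by blast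
  qed
  have zS: "z \<in> S" using r by (simp add: S_def)
  have "(h has_derivative g z) (at z)"
    using h(2)[OF zS] at_within_open[OF zS] by (simp add: S_def)
  then have "(f has_derivative g z) (at z)"
    by (rule has_derivative_transform_within_open[of _ _ _ _ S]) (use hf zS in \<open>auto simp: S_def\<close>)
  moreover have "g z (c *s v) = c * g z v" for c v
  proof (rule LIMSEQ_unique[OF glim[OF zS]])
    show "(\<lambda>n. D n z (c *s v)) \<longlonglongrightarrow> c * g z v"
      unfolding D(2)[OF zS] by (intro tendsto_mult_left glim zS)
  qed
  ultimately show "\<exists>D. (f has_derivative D) (at z) \<and> (\<forall>c v. D (c *s v) = c * D v)" by blast
qed

text \<open>First-order Taylor remainder; \<open>18 = 2! * 3^2\<close> is Cauchy's bound for the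
  second derivative on discs of radius \<open>d / 3\<close>. The bound sees \<open>g\<close> only
  through \<open>M\<close>, which makes it uniform in a family of functions.\<close>

lemma difference_quotient_bound:
  assumes g: "g holomorphic_on ball 0 d" and M: "\<And>\<zeta>. \<zeta> \<in> ball 0 d \<Longrightarrow> cmod (g \<zeta>) \<le> M"
    and "0 < d" "h \<noteq> 0" "cmod h \<le> d / 3"
  shows "cmod ((g h - g 0) / h - deriv g 0) \<le> 18 * M / d\<^sup>2 * cmod h"
proof -
  let ?S = "cball (0::complex) (d/3)"
  have d: "((deriv ^^ i) g has_field_derivative (deriv ^^ Suc i) g x) (at x)" if "x \<in> ball 0 d" for i x
    using holomorphic_derivI[OF holomorphic_higher_deriv[OF g, of i], of x] that by auto
  have B: "cmod ((deriv ^^ Suc 1) g x) \<le> 18 * M / d\<^sup>2" if "x \<in> ?S" for x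
  proof -
    have s: "cball x (d/3) \<subseteq> ball 0 d"
      using that \<open>0 < d\<close> by (simp add: cball_subset_ball_iff dist_norm)
    have hol: "g holomorphic_on cball x (d/3)" by (rule holomorphic_on_subset[OF g s])
    have "cmod ((deriv ^^ 2) g x) \<le> fact 2 * M / (d/3) ^ 2"
    proof (rule Cauchy_inequality)
      show "g holomorphic_on ball x (d/3)" by (rule holomorphic_on_subset[OF hol ball_subset_cball])
      show "continuous_on (cball x (d/3)) g" by (rule holomorphic_on_imp_continuous_on[OF hol])
      show "cmod (g y) \<le> M" if "cmod (x - y) = d/3" for y
        using that by (intro M subsetD[OF s]) (simp add: dist_norm)
    qed (use \<open>0 < d\<close> in simp)
    then show ?thesis by (simp add: power_divide numeral_2_eq_2)
  qed
  have "cmod ((deriv ^^ 0) g h - (\<Sum>i\<le>1. (deriv ^^ i) g 0 * (h - 0) ^ i / fact i))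
      \<le> 18 * M / d\<^sup>2 * cmod (h - 0) ^ Suc 1 / fact 1"
    by (rule complex_Taylor[where S = ?S])
       (use assms B in \<open>auto simp del: funpow.simps intro!: has_field_derivative_at_within d\<close>)
  then have "cmod (g h - g 0 - deriv g 0 * h) \<le> 18 * M / d\<^sup>2 * (cmod h)\<^sup>2"
    by (simp add: power2_eq_square algebra_simps)
  moreover have "(g h - g 0) / h - deriv g 0 = (g h - g 0 - deriv g 0 * h) / h"
    using \<open>h \<noteq> 0\<close> by (simp add: field_simps)
  ultimately show ?thesis
    using \<open>h \<noteq> 0\<close> by (simp add: norm_divide pos_divide_le_eq power2_eq_square mult.assoc)
qed

text \<open>Difference quotients in direction \<open>v\<close> are holomorphic and converge locally
  uniformly, by the Taylor bound on complex lines; hence their limit is holomorphic.\<close>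

lemma holomorphic_Cn_directional_derivative:
  fixes f :: "complex^'n::finite \<Rightarrow> complex"
  assumes f: "holomorphic_Cn f \<Omega>" and "open \<Omega>"
  shows "holomorphic_Cn (\<lambda>z. frechet_derivative f (at z) v) \<Omega>"
proof -
  have "\<exists>R>0. ball z R \<subseteq> \<Omega> \<and> holomorphic_Cn (\<lambda>z. frechet_derivative f (at z) v) (ball z R)" if "z \<in> \<Omega>" for z
  proof -
    obtain R where R: "R > 0" "cball z R \<subseteq> \<Omega>" using \<open>open \<Omega>\<close> \<open>z \<in> \<Omega>\<close> open_contains_cball by blast
    have "compact (f ` cball z R)"
      using holomorphic_Cn_continuous_on[OF f] R continuous_on_subset by (intro compact_continuous_image) auto
    then obtain M where M: "\<And>w. w \<in> cball z R \<Longrightarrow> cmod (f w) \<le> M"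
      using compact_imp_bounded bounded_iff by (metis image_eqI)
    \<comment> \<open>Chosen so that \<open>d * norm v < R / 2\<close>: from any \<open>w\<close> in
      the half ball, moving by \<open>\<zeta> *s v\<close> with \<open>|\<zeta>| <= d\<close> stays
      where \<open>f\<close> is bounded by \<open>M\<close>. The \<open>+ 1\<close> covers
      \<open>v = 0\<close>.\<close>
    define d where "d = R / (2 * (norm v + 1))"
    have d: "d > 0" "d * norm v < R / 2"
      using R by (auto simp: d_def divide_simps add_nonneg_pos) 
    define h where "h n = d / 3 * inverse (real (Suc n))" for n :: nat
    have h: "h n > 0" "h n \<le> d / 3" for n using d by (auto simp: h_def divide_simps)
    have inb: "w + \<zeta> *s v \<in> cball z R" if "w \<in> ball z (R/2)" "cmod \<zeta> \<le> d" for w \<zeta>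
    proof -
      have "dist z (w + \<zeta> *s v) \<le> dist z w + cmod \<zeta> * norm v"
        using dist_triangle[of z "w + \<zeta> *s v" w] by (simp add: dist_norm norm_vector_smult)
      also have "cmod \<zeta> * norm v \<le> d * norm v" using that by (intro mult_right_mono) auto
      finally show ?thesis using d that by auto
    qed
    define F where "F n w = (1 / complex_of_real (h n)) * (f (w + complex_of_real (h n) *s v) - f w)" for n w
    have F: "holomorphic_Cn (F n) (ball z (R/2))" for n
    proof -
      have "w + complex_of_real (h n) *s v \<in> \<Omega>" if "w \<in> ball z (R/2)" for w
        using inb[OF that, of "of_real (h n)"] h[of n] d R by auto
      moreover have "ball z (R/2) \<subseteq> \<Omega>" using inb[of _ 0] d R by auto
      ultimately show ?thesis
        unfolding F_def
        by (intro holomorphic_Cn_cmult holomorphic_Cn_diff holomorphic_Cn_translate[OF f]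
            holomorphic_Cn_subset[OF f])
    qed
    have bound: "cmod (F n w - frechet_derivative f (at w) v) \<le> 18 * M / d\<^sup>2 * h n" if "w \<in> ball z (R/2)" for n w
    proof -
      let ?g = "\<lambda>\<zeta>. f (w + \<zeta> *s v)"
      have "?g holomorphic_on ball 0 d"
        using inb[OF that] R by (intro holomorphic_Cn_line[OF f]) auto
      moreover have "\<And>\<zeta>. \<zeta> \<in> ball 0 d \<Longrightarrow> cmod (?g \<zeta>) \<le> M" using inb[OF that] M by auto
      ultimately have "cmod ((?g (of_real (h n)) - ?g 0) / of_real (h n) - deriv ?g 0) \<le> 18 * M / d\<^sup>2 * cmod (of_real (h n))"
        using d h[of n] by (intro difference_quotient_bound) auto
      moreover have "deriv ?g 0 = frechet_derivative f (at w) v"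
        using inb[OF that, of 0] R d DERIV_imp_deriv[OF holomorphic_Cn_line_deriv[OF f, of w 0 v]] by auto
      ultimately show ?thesis using h[of n] by (simp add: F_def)
    qed
    have "h \<longlonglongrightarrow> 0" unfolding h_def by (rule tendsto_mult_right_zero[OF LIMSEQ_inverse_real_of_nat])
    then have h0: "(\<lambda>n. 18 * M / d\<^sup>2 * h n) \<longlonglongrightarrow> 0" by (rule tendsto_mult_right_zero)
    have ul: "uniform_limit (ball z (R/2)) F (\<lambda>w. frechet_derivative f (at w) v) sequentially"
      unfolding uniform_limit_iff
    proof (intro allI impI)
      fix e :: real assume "e > 0"
      then have "\<forall>\<^sub>F n in sequentially. 18 * M / d\<^sup>2 * h n < e" using h0 order_tendstoD(2) by blast
      then show "\<forall>\<^sub>F n in sequentially. \<forall>x\<in>ball z (R/2). dist (F n x) (frechet_derivative f (at x) v) < e"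
        by (rule eventually_mono) (auto simp: dist_norm intro: le_less_trans[OF bound])
    qed
    have "holomorphic_Cn (\<lambda>w. frechet_derivative f (at w) v) (ball z (R/2))"
    proof (rule holomorphic_Cn_uniform_limit[OF F])
      fix w assume "w \<in> ball z (R/2)"
      then obtain r where "r > 0" "cball w r \<subseteq> ball z (R/2)" using open_contains_cball open_ball by blast
      then show "\<exists>r>0. cball w r \<subseteq> ball z (R/2) \<and> uniform_limit (cball w r) F (\<lambda>w. frechet_derivative f (at w) v) sequentially"
        using uniform_limit_on_subset[OF ul] by blast
    qed
    moreover have "ball z (R/2) \<subseteq> \<Omega>" using R by (auto simp: subset_iff)
    ultimately show ?thesis using \<open>R > 0\<close> by (intro exI[of _ "R/2"]) auto
  qed
  then show ?thesis unfolding holomorphic_Cn_def by (metis centre_in_ball)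
qed

section \<open>Square-integrable functions and the Bergman space\<close>

text \<open>Functions, not classes modulo null sets; \<open>l2_sq\<close> below is therefore the
  square of a seminorm only.\<close>

definition sq_int :: "'a measure \<Rightarrow> ('a \<Rightarrow> complex) set" where
  "sq_int M = {f. f \<in> borel_measurable M \<and> integrable M (\<lambda>x. (cmod (f x))\<^sup>2)}"

definition l2_inner :: "'a measure \<Rightarrow> ('a \<Rightarrow> complex) \<Rightarrow> ('a \<Rightarrow> complex) \<Rightarrow> complex" where
  "l2_inner M f g = (\<integral>x. f x * cnj (g x) \<partial>M)"

definition l2_sq :: "'a measure \<Rightarrow> ('a \<Rightarrow> complex) \<Rightarrow> real" where
  "l2_sq M f = (\<integral>x. (cmod (f x))\<^sup>2 \<partial>M)"

lemma sq_intD: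
  assumes "f \<in> sq_int M"
  shows "f \<in> borel_measurable M" "integrable M (\<lambda>x. (cmod (f x))\<^sup>2)"
  using assms by (auto simp: sq_int_def)

lemma sq_int_boundI:
  assumes "f \<in> borel_measurable M" "integrable M g" "AE x in M. (cmod (f x))\<^sup>2 \<le> g x"
  shows "f \<in> sq_int M"
  using assms unfolding sq_int_def
  by (auto intro!: Bochner_Integration.integrable_bound[OF assms(2)] elim!: eventually_mono)

lemma norm_sq_parallelogram:
  "(cmod (a + b))\<^sup>2 + (cmod (a - b))\<^sup>2 = 2 * (cmod a)\<^sup>2 + 2 * (cmod b)\<^sup>2"
  unfolding cmod_power2 by (simp add: power2_eq_square algebra_simps)

lemma norm_sq_add_le: "(cmod (a + b))\<^sup>2 \<le> 2 * (cmod a)\<^sup>2 + 2 * (cmod b)\<^sup>2"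
  using norm_sq_parallelogram[of a b] zero_le_power2[of "cmod (a - b)"] by linarith

lemma norm_mult_le_sum_squares: "cmod (a * b) \<le> (cmod a)\<^sup>2 + (cmod b)\<^sup>2"
proof -
  have "2 * (cmod a * cmod b) \<le> (cmod a)\<^sup>2 + (cmod b)\<^sup>2"
    using sum_squares_bound[of "cmod a" "cmod b"] by (simp add: mult.assoc)
  moreover have "0 \<le> (cmod a)\<^sup>2 + (cmod b)\<^sup>2" by simp
  ultimately show ?thesis unfolding norm_mult by linarith
qed

lemma sq_int_zero [simp]: "(\<lambda>x. 0) \<in> sq_int M"
  by (simp add: sq_int_def)

lemma sq_int_add:
  assumes "f \<in> sq_int M" "g \<in> sq_int M"
  shows "(\<lambda>x. f x + g x) \<in> sq_int M"
  using assms
  by (intro sq_int_boundI[of _ _ "\<lambda>x. 2 * (cmod (f x))\<^sup>2 + 2 * (cmod (g x))\<^sup>2"])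
     (auto simp: sq_int_def intro: norm_sq_add_le)

lemma sq_int_cmult:
  assumes "f \<in> sq_int M"
  shows "(\<lambda>x. c * f x) \<in> sq_int M"
  using assms unfolding sq_int_def by (auto simp: norm_mult power_mult_distrib)

lemma sq_int_diff:
  assumes "f \<in> sq_int M" "g \<in> sq_int M"
  shows "(\<lambda>x. f x - g x) \<in> sq_int M"
  using sq_int_add[OF assms(1) sq_int_cmult[OF assms(2), of "-1"]] by simp

lemma sq_int_sum:
  assumes "\<And>i. i \<in> I \<Longrightarrow> f i \<in> sq_int M"
  shows "(\<lambda>x. \<Sum>i\<in>I. f i x) \<in> sq_int M"
  using assms by (induction I rule: infinite_finite_induct) (auto intro: sq_int_add)

lemma borel_measurable_cnj:
  "f \<in> borel_measurable M \<Longrightarrow> (\<lambda>x. cnj (f x)) \<in> borel_measurable M"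
  by (rule measurable_compose[OF _ borel_measurable_continuous_onI[OF continuous_on_cnj[OF continuous_on_id]]])

lemma sq_int_mult_integrable:
  assumes "f \<in> sq_int M" "g \<in> sq_int M"
  shows "integrable M (\<lambda>x. f x * cnj (g x))"
proof (rule Bochner_Integration.integrable_bound)
  show "integrable M (\<lambda>x. (cmod (f x))\<^sup>2 + (cmod (g x))\<^sup>2)"
    using assms by (auto simp: sq_int_def)
  show "(\<lambda>x. f x * cnj (g x)) \<in> borel_measurable M"
    using sq_intD(1)[OF assms(1)] borel_measurable_cnj[OF sq_intD(1)[OF assms(2)]] by simp
  show "AE x in M. cmod (f x * cnj (g x)) \<le> norm ((cmod (f x))\<^sup>2 + (cmod (g x))\<^sup>2)"
  proof (rule AE_I2)
    fix x show "cmod (f x * cnj (g x)) \<le> norm ((cmod (f x))\<^sup>2 + (cmod (g x))\<^sup>2)"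
      using norm_mult_le_sum_squares[of "f x" "cnj (g x)"] by simp
  qed
qed

lemma l2_inner_add_left:
  assumes "f \<in> sq_int M" "g \<in> sq_int M" "h \<in> sq_int M"
  shows "l2_inner M (\<lambda>x. f x + g x) h = l2_inner M f h + l2_inner M g h"
  unfolding l2_inner_def
  using Bochner_Integration.integral_add[OF sq_int_mult_integrable[OF assms(1,3)] sq_int_mult_integrable[OF assms(2,3)]]
  by (simp only: ring_distribs)

lemma l2_inner_cmult_left: "l2_inner M (\<lambda>x. c * f x) h = c * l2_inner M f h"
  unfolding l2_inner_def by (simp add: mult.assoc)

lemma l2_inner_diff_left:
  assumes "f \<in> sq_int M" "g \<in> sq_int M" "h \<in> sq_int M"
  shows "l2_inner M (\<lambda>x. f x - g x) h = l2_inner M f h - l2_inner M g h"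
  unfolding l2_inner_def
  using Bochner_Integration.integral_diff[OF sq_int_mult_integrable[OF assms(1,3)] sq_int_mult_integrable[OF assms(2,3)]]
  by (simp only: ring_distribs)

lemma l2_inner_cnj: "cnj (l2_inner M f g) = l2_inner M g f"
  unfolding l2_inner_def by (simp add: mult.commute flip: Bochner_Integration.integral_cnj)

lemma l2_inner_add_right:
  assumes "f \<in> sq_int M" "g \<in> sq_int M" "h \<in> sq_int M"
  shows "l2_inner M h (\<lambda>x. f x + g x) = l2_inner M h f + l2_inner M h g"
  using l2_inner_add_left[OF assms] by (metis complex_cnj_add l2_inner_cnj)

lemma l2_inner_cmult_right: "l2_inner M h (\<lambda>x. c * f x) = cnj c * l2_inner M h f"
  using l2_inner_cmult_left[of M c f h] by (metis complex_cnj_mult l2_inner_cnj)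

lemma l2_inner_diff_right:
  assumes "f \<in> sq_int M" "g \<in> sq_int M" "h \<in> sq_int M"
  shows "l2_inner M h (\<lambda>x. f x - g x) = l2_inner M h f - l2_inner M h g"
  using l2_inner_diff_left[OF assms] by (metis complex_cnj_diff l2_inner_cnj)

lemma l2_inner_zero [simp]: "l2_inner M (\<lambda>x. 0) f = 0" "l2_inner M f (\<lambda>x. 0) = 0"
  by (simp_all add: l2_inner_def)

lemma l2_inner_sum_left:
  assumes "\<And>i. i \<in> I \<Longrightarrow> f i \<in> sq_int M" "h \<in> sq_int M"
  shows "l2_inner M (\<lambda>x. \<Sum>i\<in>I. f i x) h = (\<Sum>i\<in>I. l2_inner M (f i) h)"
  using assms(1)
  by (induction I rule: infinite_finite_induct) (auto simp: l2_inner_add_left sq_int_sum assms(2))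

lemma l2_inner_sum_right:
  assumes "\<And>i. i \<in> I \<Longrightarrow> f i \<in> sq_int M" "h \<in> sq_int M"
  shows "l2_inner M h (\<lambda>x. \<Sum>i\<in>I. f i x) = (\<Sum>i\<in>I. l2_inner M h (f i))"
  using assms(1)
  by (induction I rule: infinite_finite_induct) (auto simp: l2_inner_add_right sq_int_sum assms(2))

lemma l2_inner_self: "l2_inner M f f = of_real (l2_sq M f)"
  unfolding l2_inner_def l2_sq_def by (simp flip: complex_norm_square integral_complex_of_real)

lemma l2_sq_nonneg [simp]: "0 \<le> l2_sq M f"
  by (simp add: l2_sq_def)

lemma l2_sq_cmult: "l2_sq M (\<lambda>x. c * f x) = (cmod c)\<^sup>2 * l2_sq M f"
  by (simp add: l2_sq_def norm_mult power_mult_distrib)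

lemma l2_sq_parallelogram:
  assumes "f \<in> sq_int M" "g \<in> sq_int M"
  shows "l2_sq M (\<lambda>x. f x + g x) + l2_sq M (\<lambda>x. f x - g x) = 2 * l2_sq M f + 2 * l2_sq M g"
proof -
  note [simp] = sq_intD(2)[OF sq_int_add[OF assms]] sq_intD(2)[OF sq_int_diff[OF assms]]
    sq_intD(2)[OF assms(1)] sq_intD(2)[OF assms(2)]
  have "l2_sq M (\<lambda>x. f x + g x) + l2_sq M (\<lambda>x. f x - g x)
      = (\<integral>x. (cmod (f x + g x))\<^sup>2 + (cmod (f x - g x))\<^sup>2 \<partial>M)"
    by (simp add: l2_sq_def)
  also have "\<dots> = (\<integral>x. 2 * (cmod (f x))\<^sup>2 + 2 * (cmod (g x))\<^sup>2 \<partial>M)"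
    by (simp only: norm_sq_parallelogram)
  also have "\<dots> = 2 * l2_sq M f + 2 * l2_sq M g"
    by (simp add: l2_sq_def)
  finally show ?thesis .
qed

lemma l2_sq_add_le:
  assumes "f \<in> sq_int M" "g \<in> sq_int M"
  shows "l2_sq M (\<lambda>x. f x + g x) \<le> 2 * l2_sq M f + 2 * l2_sq M g"
  using l2_sq_parallelogram[OF assms] l2_sq_nonneg[of M "\<lambda>x. f x - g x"] by linarith

lemma l2_sq_triangle_le:
  assumes "f \<in> sq_int M" "g \<in> sq_int M" "h \<in> sq_int M"
  shows "l2_sq M (\<lambda>x. f x - h x) \<le> 2 * l2_sq M (\<lambda>x. f x - g x) + 2 * l2_sq M (\<lambda>x. g x - h x)"
  using l2_sq_add_le[OF sq_int_diff[OF assms(1,2)] sq_int_diff[OF assms(2,3)]] by simp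

text \<open>The quadratic in \<open>t\<close> whose minimisation yields both the Cauchy-Schwarz
  inequality and the orthogonality of the projection residual.\<close>

lemma l2_sq_sub_cmult:
  assumes "f \<in> sq_int M" "g \<in> sq_int M"
  shows "l2_sq M (\<lambda>x. f x - t * g x) = l2_sq M f - 2 * Re (cnj t * l2_inner M f g) + (cmod t)\<^sup>2 * l2_sq M g"
proof -
  note gt = sq_int_cmult[OF assms(2), of t]
  have "complex_of_real (l2_sq M (\<lambda>x. f x - t * g x))
     = l2_inner M f f - t * l2_inner M g f - cnj t * l2_inner M f g + t * cnj t * l2_inner M g g"
    unfolding l2_inner_self[symmetric]
    by (simp add: l2_inner_diff_left l2_inner_diff_right l2_inner_cmult_left l2_inner_cmult_right
        assms gt sq_int_diff algebra_simps)
  also have "t * l2_inner M g f = cnj (cnj t * l2_inner M f g)" by (simp add: l2_inner_cnj)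
  finally have "Re (complex_of_real (l2_sq M (\<lambda>x. f x - t * g x)))
     = Re (l2_inner M f f - cnj (cnj t * l2_inner M f g) - cnj t * l2_inner M f g + t * cnj t * l2_inner M g g)" by simp
  then show ?thesis by (simp add: l2_inner_self flip: complex_norm_square)
qed

lemma l2_Cauchy_Schwarz:
  assumes f: "f \<in> sq_int M" and g: "g \<in> sq_int M"
  shows "(cmod (l2_inner M f g))\<^sup>2 \<le> l2_sq M f * l2_sq M g"
proof -
  define c where "c = l2_inner M f g"
  \<comment> \<open>Testing with \<open>t = s c\<close> for real \<open>s\<close> aligns the phases,
    so the cross term is \<open>s |c|^2\<close>.\<close>
  have *: "0 \<le> l2_sq M f - 2 * s * (cmod c)\<^sup>2 + s\<^sup>2 * (cmod c)\<^sup>2 * l2_sq M g" for s :: real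
  proof -
    have "Re (cnj (of_real s * c) * c) = s * (cmod c)\<^sup>2"
      unfolding cmod_power2 by (simp add: power2_eq_square algebra_simps)
    then show ?thesis
      using l2_sq_sub_cmult[OF f g, of "of_real s * c"] l2_sq_nonneg[of M "\<lambda>x. f x - of_real s * c * g x"]
      by (simp add: c_def norm_mult power_mult_distrib)
  qed
  show ?thesis
  proof (cases "l2_sq M g = 0")
    case True
    have "c = 0"
    proof (rule ccontr)
      assume "c \<noteq> 0"
      \<comment> \<open>With \<open>l2_sq M g = 0\<close> the expression is affine in
        \<open>s\<close>, and this \<open>s\<close> gives it the value \<open>-1\<close>.\<close>
      then show False using *[of "(l2_sq M f + 1) / (2 * (cmod c)\<^sup>2)"] True by simp
    qed
    then show ?thesis by (simp add: c_def)
  next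
    case False
    then have pos: "l2_sq M g > 0" using l2_sq_nonneg[of M g] by linarith
    have "0 \<le> l2_sq M f - (cmod c)\<^sup>2 / l2_sq M g"
      using *[of "1 / l2_sq M g"] False by (simp add: power2_eq_square)
    then show ?thesis using pos by (simp add: c_def field_simps)
  qed
qed

lemma l2_inner_eq_0:
  assumes "f \<in> sq_int M" "g \<in> sq_int M" "l2_sq M f = 0"
  shows "l2_inner M f g = 0"
  using l2_Cauchy_Schwarz[OF assms(1,2)] assms(3) by simp

lemma nn_integral_l2_sq:
  assumes "f \<in> sq_int M"
  shows "(\<integral>\<^sup>+x. ennreal ((cmod (f x))\<^sup>2) \<partial>M) = ennreal (l2_sq M f)"
  unfolding l2_sq_def using assms by (intro nn_integral_eq_integral) (auto simp: sq_int_def)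

text \<open>Fatou's lemma for the squared modulus. The limit in the completeness proof is built
  pointwise, and this is what places it in \<open>sq_int\<close> with a norm bound.\<close>

lemma l2_sq_Fatou:
  assumes F: "\<And>n. F n \<in> sq_int M" and lim: "\<And>x. x \<in> space M \<Longrightarrow> (\<lambda>n. F n x) \<longlonglongrightarrow> f x"
    and B: "\<forall>\<^sub>F n in sequentially. l2_sq M (F n) \<le> B"
  shows "f \<in> sq_int M" "l2_sq M f \<le> B"
proof -
  have [measurable]: "F n \<in> borel_measurable M" for n using sq_intD(1)[OF F] .
  have [measurable]: "f \<in> borel_measurable M"
    by (rule borel_measurable_LIMSEQ_metric[of F]) (use lim in auto)
  have "B \<ge> 0"
  proof -
    obtain n where "l2_sq M (F n) \<le> B" using B eventually_happens' sequentially_bot by blast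
    then show ?thesis using l2_sq_nonneg order_trans by blast
  qed
  have "(\<integral>\<^sup>+x. ennreal ((cmod (f x))\<^sup>2) \<partial>M) = (\<integral>\<^sup>+x. liminf (\<lambda>n. ennreal ((cmod (F n x))\<^sup>2)) \<partial>M)"
  proof (rule nn_integral_cong)
    fix x assume "x \<in> space M"
    then have "(\<lambda>n. ennreal ((cmod (F n x))\<^sup>2)) \<longlonglongrightarrow> ennreal ((cmod (f x))\<^sup>2)"
      by (intro tendsto_ennrealI tendsto_intros lim)
    then show "ennreal ((cmod (f x))\<^sup>2) = liminf (\<lambda>n. ennreal ((cmod (F n x))\<^sup>2))"
      by (simp only: lim_imp_Liminf trivial_limit_sequentially not_False_eq_True)
  qed
  also have "\<dots> \<le> liminf (\<lambda>n. \<integral>\<^sup>+x. ennreal ((cmod (F n x))\<^sup>2) \<partial>M)"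
    by (rule nn_integral_liminf) measurable
  also have "\<dots> \<le> limsup (\<lambda>n. \<integral>\<^sup>+x. ennreal ((cmod (F n x))\<^sup>2) \<partial>M)"
    by (rule Liminf_le_Limsup) simp
  also have "\<dots> \<le> ennreal B"
    using B by (intro Limsup_bounded) (auto simp: nn_integral_l2_sq[OF F] elim!: eventually_mono intro!: ennreal_leI)
  finally have le: "(\<integral>\<^sup>+x. ennreal ((cmod (f x))\<^sup>2) \<partial>M) \<le> ennreal B" .
  then have "integrable M (\<lambda>x. (cmod (f x))\<^sup>2)"
    by (intro integrableI_nonneg) (auto simp: top_unique less_top[symmetric] intro: le_less_trans)
  then show fs: "f \<in> sq_int M" by (simp add: sq_int_def)
  show "l2_sq M f \<le> B" using le \<open>B \<ge> 0\<close> by (simp add: nn_integral_l2_sq[OF fs])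
qed

section \<open>The Bergman space as a Hilbert space of functions\<close>

lemma bergman_inner_eq: "bergman_inner \<Omega> = l2_inner (lebesgue_on \<Omega>)"
  by (simp add: bergman_inner_def l2_inner_def fun_eq_iff)

lemma nn_integral_lebesgue_on_lborel:
  assumes "\<Omega> \<in> sets lebesgue"
  shows "(\<integral>\<^sup>+x. f x \<partial>lebesgue_on \<Omega>) = (\<integral>\<^sup>+x\<in>\<Omega>. f x \<partial>lborel)"
  using assms by (simp add: nn_integral_restrict_space nn_integral_completion)

lemma holomorphic_Cn_measurable:
  assumes "holomorphic_Cn f \<Omega>" "open \<Omega>"
  shows "f \<in> borel_measurable (lebesgue_on \<Omega>)"
  using assms holomorphic_Cn_continuous_on continuous_imp_measurable_on_sets_lebesgue
  by (metis lborelD borel_open sets_completionI_sets sets_lborel)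

locale bergman_domain =
  fixes \<Omega> :: "(complex^'n::finite) set"
  assumes open_dom: "open \<Omega>" and conn_dom: "connected \<Omega>" and nonempty_dom: "\<Omega> \<noteq> {}" and bounded_dom: "bounded \<Omega>"
begin

abbreviation "A2 \<equiv> bergman_space \<Omega>"
abbreviation "\<mu> \<equiv> lebesgue_on \<Omega>"
abbreviation "ip \<equiv> l2_inner \<mu>"
abbreviation "nsq \<equiv> l2_sq \<mu>"

lemma dom_sets [simp]: "\<Omega> \<in> sets lebesgue"
  using open_dom by (simp add: borel_open)

lemma dom_sets_borel [measurable]: "\<Omega> \<in> sets borel"
  using open_dom by (simp add: borel_open)

lemma A2_iff: "f \<in> A2 \<longleftrightarrow> holomorphic_Cn f \<Omega> \<and> f \<in> sq_int \<mu> \<and> (\<forall>z. z \<notin> \<Omega> \<longrightarrow> f z = 0)"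
  unfolding bergman_space_def sq_int_def using holomorphic_Cn_measurable open_dom by blast

lemma A2_sq_int: "f \<in> A2 \<Longrightarrow> f \<in> sq_int \<mu>" by (simp add: A2_iff)

lemma A2_zero [simp]: "(\<lambda>x. 0) \<in> A2" by (simp add: A2_iff)

lemma A2_add: "f \<in> A2 \<Longrightarrow> g \<in> A2 \<Longrightarrow> (\<lambda>x. f x + g x) \<in> A2"
  by (simp add: A2_iff holomorphic_Cn_add sq_int_add)

lemma A2_cmult: "f \<in> A2 \<Longrightarrow> (\<lambda>x. c * f x) \<in> A2"
  by (simp add: A2_iff holomorphic_Cn_cmult sq_int_cmult)

lemma A2_diff: "f \<in> A2 \<Longrightarrow> g \<in> A2 \<Longrightarrow> (\<lambda>x. f x - g x) \<in> A2"
  by (simp add: A2_iff holomorphic_Cn_diff sq_int_diff)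

lemma A2_sum: "(\<And>i. i \<in> I \<Longrightarrow> f i \<in> A2) \<Longrightarrow> (\<lambda>x. \<Sum>i\<in>I. f i x) \<in> A2"
  by (induction I rule: infinite_finite_induct) (auto intro: A2_add)

text \<open>The sub-mean value inequality divided by the volume, which is taken at centre 0 so that
  the constant depends on the radius alone.\<close>

lemma point_evaluation_bound_holomorphic:
  assumes f: "holomorphic_Cn f \<Omega>" "f \<in> sq_int \<mu>" and sub: "ball z r \<subseteq> \<Omega>" and "r > 0"
  shows "(cmod (f z))\<^sup>2 \<le> nsq f / measure lborel (ball (0::complex^'n) r)"
proof -
  have vol: "measure lborel (ball z r) = measure lborel (ball (0::complex^'n) r)"
    using \<open>r > 0\<close> by (simp add: content_ball)
  have pos: "measure lborel (ball (0::complex^'n) r) > 0" using \<open>r > 0\<close> by (rule content_ball_pos)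
  have "ennreal ((cmod (f z))\<^sup>2) * emeasure lborel (ball z r) \<le> (\<integral>\<^sup>+x\<in>ball z r. ennreal ((cmod (f x))\<^sup>2) \<partial>lborel)"
    by (rule holomorphic_Cn_sub_mean[OF f(1) sub])
  also have "\<dots> \<le> (\<integral>\<^sup>+x\<in>\<Omega>. ennreal ((cmod (f x))\<^sup>2) \<partial>lborel)"
    using sub by (intro nn_integral_mono) (auto simp: indicator_def)
  also have "\<dots> = ennreal (nsq f)"
    using nn_integral_l2_sq[OF f(2)] by (simp add: nn_integral_lebesgue_on_lborel)
  also have "emeasure lborel (ball z r) = ennreal (measure lborel (ball (0::complex^'n) r))"
    using emeasure_lborel_ball_finite[of z r] vol by (simp add: emeasure_eq_ennreal_measure)
  finally have "(cmod (f z))\<^sup>2 * measure lborel (ball (0::complex^'n) r) \<le> nsq f"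
    by (simp add: ennreal_mult[symmetric])
  then show ?thesis using pos by (simp add: pos_le_divide_eq)
qed

lemma point_evaluation_bound:
  assumes "f \<in> A2" "ball z r \<subseteq> \<Omega>" "r > 0"
  shows "(cmod (f z))\<^sup>2 \<le> nsq f / measure lborel (ball (0::complex^'n) r)"
  using point_evaluation_bound_holomorphic assms by (simp add: A2_iff)

text \<open>Point evaluation is bounded by the norm, so vanishing norm forces vanishing everywhere
  and not merely almost everywhere.\<close>

lemma A2_eq_0:
  assumes "f \<in> A2" "nsq f = 0" shows "f z = 0"
proof (cases "z \<in> \<Omega>")
  case True
  then obtain r where "r > 0" "ball z r \<subseteq> \<Omega>" using open_dom open_contains_ball by blast
  from point_evaluation_bound[OF assms(1) this(2,1)] assms(2) show ?thesis by simp
qed (use assms in \<open>auto simp: A2_iff\<close>)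

lemma ball_in_dom:
  assumes "z \<in> \<Omega>"
  obtains r where "r > 0" "ball z (2 * r) \<subseteq> \<Omega>" "\<And>w. w \<in> cball z r \<Longrightarrow> ball w r \<subseteq> \<Omega>" "cball z r \<subseteq> \<Omega>"
proof -
  obtain R where R: "R > 0" "ball z R \<subseteq> \<Omega>" using open_dom open_contains_ball assms by blast
  have 1: "ball w (R/2) \<subseteq> \<Omega>" if "w \<in> cball z (R/2)" for w
  proof
    fix x assume "x \<in> ball w (R/2)"
    then have "x \<in> ball z R" using that dist_triangle[of z x w] by simp
    then show "x \<in> \<Omega>" using R by blast
  qed
  moreover have "cball z (R/2) \<subseteq> \<Omega>" using R by (auto simp: subset_iff)
  ultimately show ?thesis using R by (intro that[of "R/2"]) auto
qed

text \<open>Point evaluation bounds make a Cauchy sequence locally uniformly Cauchy, so its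
  pointwise limit is holomorphic. Letting \<open>m\<close> tend to infinity in
  \<open>nsq (F m - F n)\<close> by Fatou gives convergence in norm.\<close>

lemma A2_complete:
  assumes F: "\<And>n. F n \<in> A2"
    and Cau: "\<And>e. e > 0 \<Longrightarrow> \<exists>N. \<forall>m\<ge>N. \<forall>n\<ge>N. nsq (\<lambda>x. F m x - F n x) < e"
  shows "\<exists>f\<in>A2. (\<lambda>n. nsq (\<lambda>x. f x - F n x)) \<longlonglongrightarrow> 0"
proof -
  define f where "f z = (if z \<in> \<Omega> then lim (\<lambda>n. F n z) else 0)" for z
  have unif: "\<exists>r>0. cball z r \<subseteq> \<Omega> \<and> uniform_limit (cball z r) F f sequentially" if z: "z \<in> \<Omega>" for z
  proof -
    obtain r where r: "r > 0" "\<And>w. w \<in> cball z r \<Longrightarrow> ball w r \<subseteq> \<Omega>" "cball z r \<subseteq> \<Omega>"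
      by (rule ball_in_dom[OF z]) (blast intro: that)
    define c where "c = measure lborel (ball (0::complex^'n) r)"
    have "c > 0" unfolding c_def using \<open>r > 0\<close> by (rule content_ball_pos)
    have uc: "uniformly_Cauchy_on (cball z r) F"
      unfolding uniformly_Cauchy_on_def
    proof (intro allI impI)
      fix e :: real assume "e > 0"
      then have "e\<^sup>2 * c > 0" using \<open>c > 0\<close> by simp
      from Cau[OF this] obtain N where N: "\<And>m n. m \<ge> N \<Longrightarrow> n \<ge> N \<Longrightarrow> nsq (\<lambda>x. F m x - F n x) < e\<^sup>2 * c" by blast
      have "dist (F m x) (F n x) < e" if "x \<in> cball z r" "m \<ge> N" "n \<ge> N" for x m n
      proof -
        have "(cmod (F m x - F n x))\<^sup>2 \<le> nsq (\<lambda>x. F m x - F n x) / c"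
          unfolding c_def by (rule point_evaluation_bound[OF A2_diff[OF F F] r(2)[OF that(1)] r(1)])
        also have "\<dots> < e\<^sup>2" using N[OF that(2,3)] \<open>c > 0\<close> by (simp add: pos_divide_less_eq)
        finally show ?thesis using \<open>e > 0\<close> by (simp add: dist_norm power_less_imp_less_base)
      qed
      then show "\<exists>M. \<forall>x\<in>cball z r. \<forall>m\<ge>M. \<forall>n\<ge>M. dist (F m x) (F n x) < e" by blast
    qed
    then have uconv: "uniformly_convergent_on (cball z r) F" by (rule Cauchy_uniformly_convergent)
    have "uniform_limit (cball z r) F f sequentially"
      using uconv unfolding uniformly_convergent_uniform_limit_iff
      by (rule uniform_limit_cong'[THEN iffD1, rotated 2]) (use r(3) in \<open>auto simp: f_def\<close>)
    then show ?thesis using r by blast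
  qed
  have lim: "(\<lambda>n. F n z) \<longlonglongrightarrow> f z" if z: "z \<in> \<Omega>" for z
  proof -
    obtain r where r: "r > 0" and u: "uniform_limit (cball z r) F f sequentially" using unif[OF z] by blast
    show ?thesis using r by (intro tendsto_uniform_limitI[OF u]) auto
  qed
  have holf: "holomorphic_Cn f \<Omega>"
  proof (rule holomorphic_Cn_uniform_limit[OF _ unif])
    show "holomorphic_Cn (F n) \<Omega>" for n using F[of n] by (simp add: A2_iff)
  qed
  have est: "(\<lambda>x. f x - F n x) \<in> sq_int \<mu> \<and> nsq (\<lambda>x. f x - F n x) \<le> e"
    if N: "\<And>m n. m \<ge> N \<Longrightarrow> n \<ge> N \<Longrightarrow> nsq (\<lambda>x. F m x - F n x) < e" and n: "n \<ge> N" for e N n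
  proof -
    have 1: "(\<lambda>x. F m x - F n x) \<in> sq_int \<mu>" for m by (intro sq_int_diff A2_sq_int F)
    have 2: "(\<lambda>m. F m x - F n x) \<longlonglongrightarrow> f x - F n x" if "x \<in> space \<mu>" for x
      using that by (intro tendsto_diff lim tendsto_const) simp
    have 3: "\<forall>\<^sub>F m in sequentially. nsq (\<lambda>x. F m x - F n x) \<le> e"
      using N n unfolding eventually_sequentially by (auto intro!: exI[of _ N] less_imp_le)
    show ?thesis using l2_sq_Fatou[of "\<lambda>m x. F m x - F n x", OF 1 2 3] by blast
  qed
  \<comment> \<open>Fatou controls only the differences \<open>f - F n\<close>; square integrability
    of \<open>f\<close> itself is recovered by adding back one fixed member of the sequence.\<close>
  obtain N1 where N1: "\<And>m n. m \<ge> N1 \<Longrightarrow> n \<ge> N1 \<Longrightarrow> nsq (\<lambda>x. F m x - F n x) < 1"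
    using Cau[of 1] by auto
  have "(\<lambda>x. (f x - F N1 x) + F N1 x) \<in> sq_int \<mu>"
  proof (rule sq_int_add)
    show "(\<lambda>x. f x - F N1 x) \<in> sq_int \<mu>" using est[of N1 1 N1] N1 by blast
    show "(\<lambda>x. F N1 x) \<in> sq_int \<mu>" using A2_sq_int[OF F] .
  qed
  moreover have "f z = 0" if "z \<notin> \<Omega>" for z using that by (simp add: f_def)
  ultimately have "f \<in> A2" using holf by (simp add: A2_iff)
  moreover have "(\<lambda>n. nsq (\<lambda>x. f x - F n x)) \<longlonglongrightarrow> 0"
  proof (rule LIMSEQ_I)
    fix e :: real assume "e > 0"
    then obtain N where N: "\<And>m n. m \<ge> N \<Longrightarrow> n \<ge> N \<Longrightarrow> nsq (\<lambda>x. F m x - F n x) < e / 2"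
      using Cau[of "e/2"] by auto
    have le: "nsq (\<lambda>x. f x - F n x) \<le> e / 2" if "n \<ge> N" for n using est[of N "e/2" n] N that by blast
    have "nsq (\<lambda>x. f x - F n x) < e" if n: "n \<ge> N" for n
      using le[OF n] \<open>e > 0\<close> by linarith
    then show "\<exists>no. \<forall>n\<ge>no. norm (nsq (\<lambda>x. f x - F n x) - 0) < e" by auto
  qed
  ultimately show ?thesis by blast
qed

text \<open>Since \<open>V\<close> is only a linear subspace, the projection \<open>g\<close> lies
  in its closure; hence the approximating sequence \<open>v\<close> is part of the
  conclusion.\<close>

lemma A2_projection:
  assumes V: "V \<subseteq> A2" "(\<lambda>x. 0) \<in> V" "\<And>u v. u \<in> V \<Longrightarrow> v \<in> V \<Longrightarrow> (\<lambda>x. u x + v x) \<in> V"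
      "\<And>c v. v \<in> V \<Longrightarrow> (\<lambda>x. c * v x) \<in> V"
    and f: "f \<in> A2"
  obtains g v where "g \<in> A2" "\<And>n. v n \<in> V" "(\<lambda>n. nsq (\<lambda>x. g x - v n x)) \<longlonglongrightarrow> 0"
    "\<And>u. u \<in> V \<Longrightarrow> ip (\<lambda>x. f x - g x) u = 0"
proof -
  define d where "d = (INF v\<in>V. nsq (\<lambda>x. f x - v x))"
  have bdd: "bdd_below ((\<lambda>v. nsq (\<lambda>x. f x - v x)) ` V)" by (rule bdd_belowI[of _ 0]) auto
  have dle: "d \<le> nsq (\<lambda>x. f x - v x)" if "v \<in> V" for v
    unfolding d_def by (rule cINF_lower[OF bdd that])
  have "\<exists>v\<in>V. nsq (\<lambda>x. f x - v x) < d + inverse (real (Suc n))" for n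
    using cInf_lessD[of "(\<lambda>v. nsq (\<lambda>x. f x - v x)) ` V" "d + inverse (real (Suc n))"] V(2)
    unfolding d_def by auto
  then obtain v where v: "\<And>n. v n \<in> V" "\<And>n. nsq (\<lambda>x. f x - v n x) < d + inverse (real (Suc n))" by metis
  have vA: "v n \<in> A2" for n using v V by blast
  have inv0: "(\<lambda>n. inverse (real (Suc n))) \<longlonglongrightarrow> 0" by (rule LIMSEQ_inverse_real_of_nat)
  have "\<exists>g\<in>A2. (\<lambda>n. nsq (\<lambda>x. g x - v n x)) \<longlonglongrightarrow> 0"
  proof (rule A2_complete[OF vA])
    fix e :: real assume "e > 0"
    then have "\<forall>\<^sub>F n in sequentially. inverse (real (Suc n)) < e / 4" by (intro order_tendstoD(2)[OF inv0]) simp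
    then obtain N where N: "\<And>n. n \<ge> N \<Longrightarrow> inverse (real (Suc n)) < e / 4" unfolding eventually_sequentially by blast
    have "nsq (\<lambda>x. v m x - v n x) < e" if "m \<ge> N" "n \<ge> N" for m n
    proof -
      let ?a = "\<lambda>x. f x - v n x" and ?b = "\<lambda>x. f x - v m x"
      have ab: "?a \<in> sq_int \<mu>" "?b \<in> sq_int \<mu>" by (intro A2_sq_int A2_diff f vA)+
      \<comment> \<open>The midpoint of two near-minimisers lies in \<open>V\<close>, so
        \<open>nsq (a + b) >= 4 d\<close>. The parallelogram law then leaves less than
        \<open>4 (e / 4)\<close> for their difference, whence the slack
        \<open>e / 4\<close>.\<close>
      have mid: "(\<lambda>x. (1/2) * (v n x + v m x)) \<in> V" by (intro V(3,4) v)
      have eq: "(\<lambda>x. ?a x + ?b x) = (\<lambda>x. 2 * (f x - (1/2) * (v n x + v m x)))" by (simp add: algebra_simps)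
      have "4 * d \<le> nsq (\<lambda>x. ?a x + ?b x)" unfolding eq l2_sq_cmult using dle[OF mid] by simp
      moreover have "nsq (\<lambda>x. ?a x - ?b x) = nsq (\<lambda>x. v m x - v n x)" by simp
      ultimately show ?thesis
        using l2_sq_parallelogram[OF ab] v(2)[of n] v(2)[of m] N[OF that(1)] N[OF that(2)] by linarith
    qed
    then show "\<exists>N. \<forall>m\<ge>N. \<forall>n\<ge>N. nsq (\<lambda>x. v m x - v n x) < e" by blast
  qed
  then obtain g where g: "g \<in> A2" "(\<lambda>n. nsq (\<lambda>x. g x - v n x)) \<longlonglongrightarrow> 0" by blast
  have "ip (\<lambda>x. f x - g x) u = 0" if u: "u \<in> V" for u
  proof -
    have uA: "u \<in> A2" using u V by blast
    have min: "(cmod (ip (\<lambda>x. f x - v n x) u))\<^sup>2 \<le> nsq u * inverse (real (Suc n))" for n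
    proof (cases "nsq u = 0")
      case True
      then have "ip u (\<lambda>x. f x - v n x) = 0"
        by (intro l2_inner_eq_0 A2_sq_int uA A2_diff f vA)
      then have "ip (\<lambda>x. f x - v n x) u = 0" using l2_inner_cnj[of \<mu> u "\<lambda>x. f x - v n x"] by simp
      then show ?thesis by simp
    next
      case False
      then have pos: "nsq u > 0" using l2_sq_nonneg[of \<mu> u] by linarith
      define c where "c = ip (\<lambda>x. f x - v n x) u"
      \<comment> \<open>The minimiser of the quadratic in \<open>t\<close>. Moving by it lowers the
        squared distance by \<open>|c|^2 / nsq u\<close>, which cannot exceed the slack left by
        \<open>v n\<close>.\<close>
      define t where "t = c / of_real (nsq u)"
      have "(\<lambda>x. v n x + t * u x) \<in> V" by (intro V v u)
      then have "d \<le> nsq (\<lambda>x. f x - (v n x + t * u x))" by (rule dle)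
      also have "\<dots> = nsq (\<lambda>x. (f x - v n x) - t * u x)" by (simp add: algebra_simps)
      also have "\<dots> = nsq (\<lambda>x. f x - v n x) - 2 * Re (cnj t * c) + (cmod t)\<^sup>2 * nsq u"
        unfolding c_def by (intro l2_sq_sub_cmult A2_sq_int A2_diff f vA uA)
      also have "cnj t * c = of_real ((cmod c)\<^sup>2 / nsq u)"
        using complex_norm_square[of c] by (simp add: t_def mult.commute)
      also have "(cmod t)\<^sup>2 * nsq u = (cmod c)\<^sup>2 / nsq u"
        using pos by (simp add: t_def norm_divide power2_eq_square)
      finally have "(cmod c)\<^sup>2 / nsq u \<le> inverse (real (Suc n))" using v(2)[of n] by simp
      then show ?thesis using pos by (simp add: c_def pos_divide_le_eq mult.commute)
    qed
    have CS: "(cmod (ip (\<lambda>x. g x - v n x) u))\<^sup>2 \<le> nsq (\<lambda>x. g x - v n x) * nsq u" for n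
      by (intro l2_Cauchy_Schwarz A2_sq_int A2_diff g vA uA)
    have "(cmod (ip (\<lambda>x. f x - g x) u))\<^sup>2 \<le> 2 * (nsq u * inverse (real (Suc n))) + 2 * (nsq (\<lambda>x. g x - v n x) * nsq u)" for n
    proof -
      have "ip (\<lambda>x. f x - g x) u = ip (\<lambda>x. f x - v n x) u + (- 1) * ip (\<lambda>x. g x - v n x) u"
        by (simp add: l2_inner_diff_left A2_sq_int f g vA uA)
      then show ?thesis
        using norm_sq_add_le[of "ip (\<lambda>x. f x - v n x) u" "(-1) * ip (\<lambda>x. g x - v n x) u"] min[of n] CS[of n]
        by simp
    qed
    moreover have "(\<lambda>n. 2 * (nsq u * inverse (real (Suc n))) + 2 * (nsq (\<lambda>x. g x - v n x) * nsq u)) \<longlonglongrightarrow> 2 * (nsq u * 0) + 2 * (0 * nsq u)"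
      by (intro tendsto_intros inv0 g(2))
    ultimately have "(cmod (ip (\<lambda>x. f x - g x) u))\<^sup>2 \<le> 2 * (nsq u * 0) + 2 * (0 * nsq u)"
      by (intro tendsto_lowerbound[of _ _ sequentially]) auto
    then show ?thesis by simp
  qed
  then show ?thesis using that g v(1) by blast
qed

text \<open>A maximal orthonormal set exists by Zorn. If its span missed some \<open>f\<close>, the
  normalised residual of the projection of \<open>f\<close> would enlarge it. This makes the
  \<open>SOME\<close> in the definition of the kernel denote a genuine basis.\<close>

lemma ex_orthonormal_basis: "\<exists>S. bergman_orthonormal_basis \<Omega> S"
proof -
  define ON where "ON = {S. S \<subseteq> A2 \<and> (\<forall>s\<in>S. \<forall>t\<in>S. ip s t = (if s = t then 1 else 0))}"
  have "\<exists>M\<in>ON. \<forall>X\<in>ON. M \<subseteq> X \<longrightarrow> X = M"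
  proof (rule subset_Zorn')
    fix C assume C: "subset.chain ON C"
    then have sub: "C \<subseteq> ON" by (simp add: subset_chain_def)
    show "\<Union>C \<in> ON"
      unfolding ON_def
    proof (intro CollectI conjI ballI)
      show "\<Union>C \<subseteq> A2" using sub unfolding ON_def by blast
      fix s t assume "s \<in> \<Union>C" "t \<in> \<Union>C"
      then obtain X Y where XY: "X \<in> C" "Y \<in> C" "s \<in> X" "t \<in> Y" by blast
      then have "X \<subseteq> Y \<or> Y \<subseteq> X" using C by (metis subset_chain_def subset.chain_total)
      then obtain Z where "Z \<in> C" "s \<in> Z" "t \<in> Z" using XY by blast
      then show "ip s t = (if s = t then 1 else 0)" using sub unfolding ON_def by blast
    qed
  qed
  then obtain M where M: "M \<in> ON" and maxi: "\<And>X. X \<in> ON \<Longrightarrow> M \<subseteq> X \<Longrightarrow> X = M" by blast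
  have MA: "M \<subseteq> A2" and Mon: "\<And>s t. s \<in> M \<Longrightarrow> t \<in> M \<Longrightarrow> ip s t = (if s = t then 1 else 0)"
    using M unfolding ON_def by blast+
  define V where "V = {v. \<exists>F c. finite F \<and> F \<subseteq> M \<and> v = (\<lambda>x. \<Sum>s\<in>F. c s * s x)}"
  have VA: "V \<subseteq> A2" unfolding V_def using MA by (auto intro!: A2_sum A2_cmult)
  have V0: "(\<lambda>x. 0) \<in> V" unfolding V_def by (auto intro!: exI[of _ "{}"])
  have Vadd: "(\<lambda>x. u x + v x) \<in> V" if uv: "u \<in> V" "v \<in> V" for u v
  proof -
    obtain F c where F: "finite F" "F \<subseteq> M" "u = (\<lambda>x. \<Sum>s\<in>F. c s * s x)" using uv(1) unfolding V_def by blast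
    obtain G d where G: "finite G" "G \<subseteq> M" "v = (\<lambda>x. \<Sum>s\<in>G. d s * s x)" using uv(2) unfolding V_def by blast
    have u': "u x = (\<Sum>s\<in>F \<union> G. (if s \<in> F then c s else 0) * s x)" for x
      unfolding F(3) using F(1) G(1) by (intro sum.mono_neutral_cong_left) auto
    have v': "v x = (\<Sum>s\<in>F \<union> G. (if s \<in> G then d s else 0) * s x)" for x
      unfolding G(3) using F(1) G(1) by (intro sum.mono_neutral_cong_left) auto
    have "(\<lambda>x. u x + v x) = (\<lambda>x. \<Sum>s\<in>F \<union> G. ((if s \<in> F then c s else 0) + (if s \<in> G then d s else 0)) * s x)"
      unfolding u' v' by (simp add: sum.distrib ring_distribs)
    then show ?thesis unfolding V_def using F G
      by (intro CollectI exI[of _ "F \<union> G"] exI[of _ "\<lambda>s. (if s \<in> F then c s else 0) + (if s \<in> G then d s else 0)"]) auto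
  qed
  have Vmult: "(\<lambda>x. a * v x) \<in> V" if v: "v \<in> V" for a v
  proof -
    obtain F c where F: "finite F" "F \<subseteq> M" "v = (\<lambda>x. \<Sum>s\<in>F. c s * s x)" using v unfolding V_def by blast
    then show ?thesis unfolding V_def
      by (intro CollectI exI[of _ F] exI[of _ "\<lambda>s. a * c s"]) (auto simp: sum_distrib_left mult.assoc)
  qed
  have MV: "s \<in> V" if "s \<in> M" for s
    unfolding V_def using that by (intro CollectI exI[of _ "{s}"] exI[of _ "\<lambda>_. 1"]) auto
  have dense: "\<exists>v\<in>V. nsq (\<lambda>x. f x - v x) < e" if f: "f \<in> A2" and e: "e > 0" for f e
  proof (rule ccontr)
    assume no: "\<not> ?thesis"
    have "\<exists>g v. g \<in> A2 \<and> (\<forall>n. v n \<in> V) \<and> (\<lambda>n. nsq (\<lambda>x. g x - v n x)) \<longlonglongrightarrow> 0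
        \<and> (\<forall>u\<in>V. ip (\<lambda>x. f x - g x) u = 0)"
      by (rule A2_projection[of V f]) (use VA V0 Vadd Vmult f in blast)+
    then obtain g v where g: "g \<in> A2" "\<And>n. v n \<in> V" "(\<lambda>n. nsq (\<lambda>x. g x - v n x)) \<longlonglongrightarrow> 0"
      and orth: "\<And>u. u \<in> V \<Longrightarrow> ip (\<lambda>x. f x - g x) u = 0"
      by blast
    define h where "h = (\<lambda>x. f x - g x)"
    have hA: "h \<in> A2" unfolding h_def by (intro A2_diff f g)
    \<comment> \<open>If the residual vanished, \<open>f\<close> would agree in norm with
      \<open>g\<close>, which is a limit of elements of the span, against the choice of
      \<open>e\<close>.\<close>
    have "nsq h \<noteq> 0"
    proof
      assume h0: "nsq h = 0"
      have "\<forall>\<^sub>F n in sequentially. nsq (\<lambda>x. g x - v n x) < e / 2" by (intro order_tendstoD(2)[OF g(3)]) (use e in simp)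
      then obtain n where n: "nsq (\<lambda>x. g x - v n x) < e / 2" using eventually_happens' sequentially_bot by blast
      have "v n \<in> A2" using g(2) VA by blast
      then have "nsq (\<lambda>x. f x - v n x) \<le> 2 * nsq h + 2 * nsq (\<lambda>x. g x - v n x)"
        unfolding h_def by (intro l2_sq_triangle_le A2_sq_int f g)
      with h0 n have "nsq (\<lambda>x. f x - v n x) < e" by simp
      with no g(2) show False by blast
    qed
    then have pos: "nsq h > 0" using l2_sq_nonneg[of \<mu> h] by linarith
    define u where "u = (\<lambda>x. of_real (1 / sqrt (nsq h)) * h x)"
    have uA: "u \<in> A2" unfolding u_def by (intro A2_cmult hA)
    have hs: "ip h s = 0" if "s \<in> M" for s unfolding h_def by (rule orth[OF MV[OF that]])
    have us: "ip u s = 0" "ip s u = 0" if "s \<in> M" for s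
    proof -
      show "ip u s = 0" unfolding u_def l2_inner_cmult_left using hs[OF that] by simp
      then show "ip s u = 0" using l2_inner_cnj[of \<mu> u s] by simp
    qed
    have "ip u u = of_real ((cmod (of_real (1 / sqrt (nsq h))))\<^sup>2 * nsq h)"
      unfolding l2_inner_self unfolding u_def l2_sq_cmult ..
    also have "(cmod (of_real (1 / sqrt (nsq h))))\<^sup>2 * nsq h = 1"
      using pos by (simp add: norm_divide power_divide)
    finally have uu: "ip u u = 1" by simp
    have "u \<notin> M" using us(1)[of u] uu by auto
    moreover have "insert u M \<in> ON"
      unfolding ON_def using MA uA Mon us uu \<open>u \<notin> M\<close> by auto
    ultimately show False using maxi[of "insert u M"] by blast
  qed
  have "bergman_orthonormal_basis \<Omega> M"
    unfolding bergman_orthonormal_basis_def bergman_inner_eq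
  proof (intro conjI ballI allI impI)
    fix f and e :: real assume "f \<in> A2" "e > 0"
    then obtain v where "v \<in> V" "nsq (\<lambda>x. f x - v x) < e" using dense by blast
    then show "\<exists>F c. finite F \<and> F \<subseteq> M \<and> (\<integral>z. (cmod (f z - (\<Sum>s\<in>F. c s * s z)))\<^sup>2 \<partial>\<mu>) < e"
      unfolding V_def l2_sq_def by blast
  qed (use MA Mon in auto)
  then show ?thesis by blast
qed

end

section \<open>Zero sets of holomorphic functions\<close>

text \<open>The doubled ball leaves room for a Cauchy estimate of radius \<open>r\<close> at every
  point of the inner ball.\<close>

lemma holomorphic_Cn_Lipschitz:
  fixes f :: "complex^'n::finite \<Rightarrow> complex"
  assumes f: "holomorphic_Cn f \<Omega>" and sub: "cball z (2 * r) \<subseteq> \<Omega>" and "r > 0"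
    and B: "\<And>w. w \<in> cball z (2 * r) \<Longrightarrow> cmod (f w) \<le> B" and w: "w \<in> cball z r"
  shows "cmod (f w - f z) \<le> B / r * norm (w - z)"
proof (rule differentiable_bound[where S = "cball z r" and f' = "\<lambda>x. frechet_derivative f (at x)"])
  fix x assume x: "x \<in> cball z r"
  have s: "cball x r \<subseteq> cball z (2 * r)"
  proof
    fix y assume "y \<in> cball x r"
    then show "y \<in> cball z (2 * r)" using x dist_triangle[of z y x] by simp
  qed
  have "x \<in> \<Omega>" using s sub \<open>r > 0\<close> by (meson centre_in_cball less_imp_le subsetD)
  then show "(f has_derivative frechet_derivative f (at x)) (at x within cball z r)"
    using holomorphic_Cn_frechet(1)[OF f] has_derivative_at_withinI by blast
  have "cmod (f z) \<le> B" using B[of z] \<open>r > 0\<close> by simp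
  then have "B \<ge> 0" using norm_ge_zero order_trans by blast
  show "onorm (frechet_derivative f (at x)) \<le> B / r"
  proof (rule onorm_le)
    fix v
    show "cmod (frechet_derivative f (at x) v) \<le> B / r * norm v"
      using s sub B \<open>r > 0\<close> by (intro holomorphic_Cn_Cauchy_estimate[OF f]) blast+
  qed
qed (use w \<open>r > 0\<close> in auto)

lemma countable_null_real: "countable T \<Longrightarrow> (\<integral>\<^sup>+t. indicator T (t::real) \<partial>lborel) = 0"
  using countable_imp_null_set_lborel[of T] null_setsD1[of T lborel] null_setsD2[of T lborel]
  by (subst nn_integral_indicator) auto

text \<open>Every ray from \<open>p\<close> meets the zero set in a countable set, so by Fubini the sets
  \<open>{x. f (p + t x) = 0}\<close> are null for almost every \<open>t\<close>; rescale by one such \<open>t\<close>.\<close>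

lemma holomorphic_Cn_zeros_locally_negligible:
  fixes f :: "complex^'n::finite \<Rightarrow> complex"
  assumes f: "holomorphic_Cn f \<Omega>" and sub: "ball p r \<subseteq> \<Omega>" and "r > 0" and fp: "f p \<noteq> 0"
  shows "negligible {z \<in> ball p (r/2). f z = 0}"
proof -
  define Z where "Z = {x \<in> ball 0 r. f (p + x) = 0}"
  have tr: "p + x \<in> ball p r \<longleftrightarrow> x \<in> ball 0 r" for x by (simp add: dist_norm)
  have cont: "continuous_on (ball 0 r) (\<lambda>x. f (p + x))"
    using sub tr
    by (intro continuous_on_compose2[OF holomorphic_Cn_continuous_on[OF f]] continuous_intros) auto
  have [measurable]: "Z \<in> sets borel"
  proof -
    have "closedin (top_of_set (ball 0 r)) (ball 0 r \<inter> (\<lambda>x. f (p + x)) -` {0})"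
      by (rule continuous_closedin_preimage[OF cont]) simp
    then obtain C where C: "closed C" "ball 0 r \<inter> (\<lambda>x. f (p + x)) -` {0} = ball 0 r \<inter> C"
      unfolding closedin_closed by blast
    moreover have "Z = ball 0 r \<inter> (\<lambda>x. f (p + x)) -` {0}" by (auto simp: Z_def)
    ultimately have "Z = ball 0 r \<inter> C" by simp
    then show ?thesis using C(1) by (simp add: borel_closed)
  qed
  have ray: "(\<integral>\<^sup>+t\<in>{1/2..1}. indicator Z (t *\<^sub>R x) \<partial>lborel) = 0" if x: "x \<in> ball 0 r" for x
  proof (cases "x = 0")
    case True
    then have "indicator Z (t *\<^sub>R x) = (0::ennreal)" for t using fp by (simp add: Z_def)
    then show ?thesis by simp
  next
    case False
    define S where "S = ball (0::complex) (r / norm x)"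
    define g where "g \<zeta> = f (p + \<zeta> *s x)" for \<zeta>
    have S: "\<zeta> \<in> S \<longleftrightarrow> \<zeta> *s x \<in> ball 0 r" for \<zeta>
      using False by (simp add: S_def norm_vector_smult pos_less_divide_eq)
    have g: "g holomorphic_on S"
      unfolding g_def using sub S tr by (intro holomorphic_Cn_line[OF f]) blast
    have KS: "cball 0 1 \<subseteq> S"
      using x False by (simp add: S_def cball_subset_ball_iff)
    \<comment> \<open>\<open>g 0 = f p\<close> is nonzero, so a constant \<open>g\<close> has no
      zeros; a nonconstant one has finitely many in a compact subset of its connected
      domain.\<close>
    have fin: "finite {\<zeta> \<in> cball 0 1. g \<zeta> = 0}"
    proof (cases "g constant_on S")
      case True
      moreover have "0 \<in> S" using KS by auto
      moreover have "g 0 \<noteq> 0" using fp by (simp add: g_def)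
      ultimately have "{\<zeta> \<in> cball 0 1. g \<zeta> = 0} = {}" using KS by (auto simp: constant_on_def)
      then show ?thesis by (metis finite.emptyI)
    next
      case False
      then show ?thesis using g KS by (intro holomorphic_compact_finite_zeros[of g S]) (auto simp: S_def)
    qed
    have "countable (complex_of_real -` {\<zeta> \<in> cball 0 1. g \<zeta> = 0})"
      by (intro countable_finite finite_vimageI fin) (simp add: inj_def)
    moreover have "{t \<in> {1/2..1}. t *\<^sub>R x \<in> Z} \<subseteq> complex_of_real -` {\<zeta> \<in> cball 0 1. g \<zeta> = 0}"
    proof
      fix t assume t: "t \<in> {t \<in> {1/2..1}. t *\<^sub>R x \<in> Z}"
      have "complex_of_real t *s x = t *\<^sub>R x" by (simp add: vec_eq_iff scaleR_conv_of_real[of _ "x $ i" for i])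
      then show "t \<in> complex_of_real -` {\<zeta> \<in> cball 0 1. g \<zeta> = 0}"
        using t by (simp add: Z_def g_def)
    qed
    ultimately have ct: "countable {t \<in> {1/2..1}. t *\<^sub>R x \<in> Z}" by (rule countable_subset[rotated])
    have "(\<integral>\<^sup>+t\<in>{1/2..1}. indicator Z (t *\<^sub>R x) \<partial>lborel) \<le> (\<integral>\<^sup>+t. indicator {t \<in> {1/2..1}. t *\<^sub>R x \<in> Z} t \<partial>lborel)"
      by (intro nn_integral_mono) (auto simp: indicator_def)
    also have "\<dots> = 0" by (rule countable_null_real[OF ct])
    finally show ?thesis by simp
  qed
  have sc: "(\<lambda>q::real \<times> (complex^'n). fst q *\<^sub>R snd q) \<in> borel_measurable (borel \<Otimes>\<^sub>M borel)"
    unfolding borel_prod by (intro borel_measurable_continuous_onI continuous_intros)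
  have sc': "(\<lambda>q::(complex^'n) \<times> real. snd q *\<^sub>R fst q) \<in> borel_measurable (borel \<Otimes>\<^sub>M borel)"
    unfolding borel_prod by (intro borel_measurable_continuous_onI continuous_intros)
  note [measurable (raw)] = sc sc'
  have mZ1: "(\<lambda>q::(complex^'n) \<times> real. indicator Z (snd q *\<^sub>R fst q) :: ennreal) \<in> borel_measurable (borel \<Otimes>\<^sub>M borel)"
    by (rule measurable_compose[OF sc']) simp
  have mZ2: "(\<lambda>q::real \<times> (complex^'n). indicator Z (fst q *\<^sub>R snd q) :: ennreal) \<in> borel_measurable (borel \<Otimes>\<^sub>M borel)"
    by (rule measurable_compose[OF sc]) simp
  have mt: "(\<lambda>x::complex^'n. indicator Z (t *\<^sub>R x) * indicator (ball 0 r) x :: ennreal) \<in> borel_measurable borel" for t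
    using measurable_compose[OF _ mZ2, of "Pair t" borel]
    by (intro borel_measurable_times_ennreal borel_measurable_indicator) simp_all
  define W where "W t = (\<integral>\<^sup>+x. indicator Z (t *\<^sub>R x) * indicator (ball (0::complex^'n) r) x \<partial>lborel)" for t :: real
  have "(\<integral>\<^sup>+t. W t * indicator {1/2..1} t \<partial>lborel)
      = (\<integral>\<^sup>+t. (\<integral>\<^sup>+x. indicator Z (t *\<^sub>R x) * indicator (ball (0::complex^'n) r) x * indicator {1/2..1::real} t \<partial>lborel) \<partial>lborel)"
    unfolding W_def by (rule nn_integral_cong, rule nn_integral_multc[symmetric]) (simp add: mt)
  also have "\<dots> = (\<integral>\<^sup>+x. (\<integral>\<^sup>+t. indicator Z (t *\<^sub>R x) * indicator (ball (0::complex^'n) r) x * indicator {1/2..1::real} t \<partial>lborel) \<partial>lborel)"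
  proof (rule lborel_pair.Fubini')
    have ms: "sets ((lborel :: (complex^'n) measure) \<Otimes>\<^sub>M (lborel :: real measure)) = sets (borel \<Otimes>\<^sub>M borel)"
      by (intro sets_pair_measure_cong) auto
    have "(\<lambda>q::(complex^'n) \<times> real. indicator Z (snd q *\<^sub>R fst q) * indicator (ball 0 r) (fst q)
        * indicator {1/2..1} (snd q) :: ennreal) \<in> borel_measurable (borel \<Otimes>\<^sub>M borel)"
      by (intro borel_measurable_times_ennreal mZ1
          measurable_compose[OF measurable_fst borel_measurable_indicator]
          measurable_compose[OF measurable_snd borel_measurable_indicator]) simp_all
    then show "(\<lambda>(x::complex^'n, t::real). indicator Z (t *\<^sub>R x) * indicator (ball 0 r) x * indicator {1/2..1} t :: ennreal)
        \<in> borel_measurable (lborel \<Otimes>\<^sub>M lborel)"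
      by (simp add: case_prod_unfold measurable_cong_sets[OF ms refl])
  qed
  also have "\<dots> = (\<integral>\<^sup>+x. 0 \<partial>(lborel :: (complex^'n) measure))"
  proof (rule nn_integral_cong)
    fix x :: "complex^'n"
    show "(\<integral>\<^sup>+t. indicator Z (t *\<^sub>R x) * indicator (ball (0::complex^'n) r) x * indicator {1/2..1::real} t \<partial>lborel) = 0"
      using ray[of x] by (cases "x \<in> ball 0 r") auto
  qed
  finally have W0: "(\<integral>\<^sup>+t. W t * indicator {1/2..1} t \<partial>lborel) = 0" by simp
  have [measurable]: "W \<in> borel_measurable borel"
  proof -
    have ms: "sets ((borel :: real measure) \<Otimes>\<^sub>M (lborel :: (complex^'n) measure)) = sets (borel \<Otimes>\<^sub>M borel)"
      by (intro sets_pair_measure_cong) auto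
    have "(\<lambda>q::real \<times> (complex^'n). indicator Z (fst q *\<^sub>R snd q) * indicator (ball 0 r) (snd q) :: ennreal)
        \<in> borel_measurable (borel \<Otimes>\<^sub>M borel)"
      by (intro borel_measurable_times_ennreal mZ2 measurable_compose[OF measurable_snd borel_measurable_indicator]) simp
    then show ?thesis
      unfolding W_def
      by (intro lborel.borel_measurable_nn_integral) (simp add: case_prod_unfold measurable_cong_sets[OF ms refl])
  qed
  have "AE t in lborel. W t * indicator {1/2..1} t = 0"
    using W0 by (subst (asm) nn_integral_0_iff_AE) auto
  then have "\<exists>t\<in>{1/2..1}. W t = 0"
  proof (rule contrapos_pp)
    assume "\<not> (\<exists>t\<in>{1/2..1}. W t = 0)"
    then have ne: "W t * indicator {1/2..1} t \<noteq> 0" if "t \<in> {1/2..1}" for t using that by simp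
    show "\<not> (AE t in lborel. W t * indicator {1/2..1} t = 0)"
    proof
      assume "AE t in lborel. W t * indicator {1/2..1} t = 0"
      then have "AE t in lborel. t \<notin> {1/2..1::real}" by (rule eventually_mono) (use ne in blast)
      then have "{1/2..1::real} \<in> null_sets lborel" using AE_iff_null_sets[of "{1/2..1::real}" lborel] by simp
      then have "emeasure lborel {1/2..1::real} = 0" by (rule null_setsD1)
      then show False by simp
    qed
  qed
  then obtain t where t: "1/2 \<le> t" "t \<le> 1" and Wt: "W t = 0" by auto
  define Y where "Y = {x \<in> ball 0 r. t *\<^sub>R x \<in> Z}"
  have Yb[measurable]: "Y \<in> sets borel"
  proof -
    have "(\<lambda>x::complex^'n. t *\<^sub>R x) \<in> borel_measurable borel" by simp
    from measurable_sets_borel[OF this \<open>Z \<in> sets borel\<close>] have "(\<lambda>x. t *\<^sub>R x) -` Z \<in> sets borel" .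
    moreover have "Y = ball 0 r \<inter> (\<lambda>x. t *\<^sub>R x) -` Z" by (auto simp: Y_def)
    ultimately show ?thesis by simp
  qed
  have "emeasure lborel Y = (\<integral>\<^sup>+x. indicator Y x \<partial>lborel)" by simp
  also have "\<dots> = W t" unfolding W_def by (rule nn_integral_cong) (auto simp: Y_def indicator_def)
  finally have "Y \<in> null_sets lborel" using Wt by (simp add: null_sets_def)
  then have "negligible Y" using null_sets_completionI negligible_iff_null_sets by blast
  then have "negligible ((\<lambda>x. t *\<^sub>R x) ` Y)"
    using t by (intro negligible_locally_Lipschitz_image)
       (auto intro!: exI[of _ UNIV] exI[of _ t] simp flip: scaleR_diff_right)
  then have "negligible ((+) p ` (\<lambda>x. t *\<^sub>R x) ` Y)" by (rule negligible_translation)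
  moreover have "{z \<in> ball p (r/2). f z = 0} \<subseteq> (+) p ` (\<lambda>x. t *\<^sub>R x) ` Y"
  proof
    fix z assume z: "z \<in> {z \<in> ball p (r/2). f z = 0}"
    have nz: "norm (z - p) < r / 2" using z by (simp add: dist_norm norm_minus_commute)
    \<comment> \<open>As \<open>t >= 1/2\<close>, dividing by \<open>t\<close> at most doubles the
      norm. This is why only the ball of radius \<open>r/2\<close> is covered.\<close>
    define x where "x = (1/t) *\<^sub>R (z - p)"
    have tx: "t *\<^sub>R x = z - p" using t by (simp add: x_def)
    have "norm x = norm (z - p) / t" using t by (simp add: x_def)
    also have "\<dots> \<le> norm (z - p) / (1/2)" using t by (intro divide_left_mono) auto
    also have "\<dots> < r" using nz by simp
    finally have "norm x < r" .
    moreover have "norm (t *\<^sub>R x) < r" unfolding tx using nz \<open>r > 0\<close> by linarith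
    ultimately have "x \<in> Y" using z by (simp add: Y_def Z_def tx del: norm_scaleR)
    then show "z \<in> (+) p ` (\<lambda>x. t *\<^sub>R x) ` Y" using tx by (force simp: image_iff intro: bexI[of _ x])
  qed
  ultimately show ?thesis by (rule negligible_subset)
qed

text \<open>A measure version of the identity theorem: the points near which the zero set is null
  form a set \<open>U\<close> that is open and relatively closed in the connected domain, and
  contains \<open>p\<close>.\<close>

lemma holomorphic_Cn_zeros_negligible:
  fixes f :: "complex^'n::finite \<Rightarrow> complex"
  assumes f: "holomorphic_Cn f \<Omega>" and "open \<Omega>" "connected \<Omega>" and p: "p \<in> \<Omega>" "f p \<noteq> 0"
  shows "negligible {z \<in> \<Omega>. f z = 0}"
proof -
  define U where "U = {q \<in> \<Omega>. \<exists>r>0. negligible {z \<in> ball q r. z \<in> \<Omega> \<and> f z = 0}}"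
  \<comment> \<open>Near \<open>u\<close> the zeros are null, so there is \<open>u'\<close> with
    \<open>f u' \<noteq> 0\<close> within \<open>r/4\<close> of \<open>q\<close>. The ball of radius
    \<open>r/2\<close> about \<open>u'\<close> lies in \<open>ball q r\<close>, so the local lemma
    makes the zeros null within \<open>r/4\<close> of \<open>u'\<close>, and
    \<open>d = r/4 - dist q u'\<close> is the room this leaves around \<open>q\<close>.\<close>
  have extend: "q \<in> U" if r: "r > 0" "ball q r \<subseteq> \<Omega>" and u: "u \<in> U" "dist u q < r / 8" for q r u
  proof -
    obtain s where s: "s > 0" "negligible {z \<in> ball u s. z \<in> \<Omega> \<and> f z = 0}" using u(1) unfolding U_def by blast
    define m where "m = min s (r / 8)"
    have m: "m > 0" using s r by (simp add: m_def)
    have subr: "ball u m \<subseteq> ball q (r/4)"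
    proof
      fix x assume "x \<in> ball u m"
      then show "x \<in> ball q (r/4)" using u(2) dist_triangle[of q x u] r by (simp add: m_def dist_commute)
    qed
    have "\<exists>u'\<in>ball u m. f u' \<noteq> 0"
    proof (rule ccontr)
      assume "\<not> ?thesis"
      then have "ball u m \<subseteq> {z \<in> ball u s. z \<in> \<Omega> \<and> f z = 0}"
        using subset_trans[OF subr subset_trans[OF subset_ball[of "r/4" r q] r(2)]] r(1) by (auto simp: m_def)
      then have "negligible (ball u m)" using s(2) negligible_subset by blast
      then show False using m open_not_negligible[of "ball u m"] by simp
    qed
    then obtain u' where u': "u' \<in> ball u m" "f u' \<noteq> 0" by blast
    have qu': "dist q u' < r / 4" using u' subr by auto
    have "ball u' (r/2) \<subseteq> \<Omega>"
    proof
      fix x assume "x \<in> ball u' (r/2)"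
      then have "x \<in> ball q r" using qu' dist_triangle[of q x u'] r by simp
      then show "x \<in> \<Omega>" using r by blast
    qed
    then have "negligible {z \<in> ball u' (r/2/2). f z = 0}"
      using r u' by (intro holomorphic_Cn_zeros_locally_negligible[OF f]) auto
    moreover define d where "d = r / 4 - dist q u'"
    have "{z \<in> ball q d. z \<in> \<Omega> \<and> f z = 0} \<subseteq> {z \<in> ball u' (r/2/2). f z = 0}"
    proof
      fix x assume x: "x \<in> {z \<in> ball q d. z \<in> \<Omega> \<and> f z = 0}"
      then have "dist u' x < r / 4" using dist_triangle[of u' x q] by (simp add: d_def dist_commute)
      then show "x \<in> {z \<in> ball u' (r/2/2). f z = 0}" using x by simp
    qed
    ultimately have "negligible {z \<in> ball q d. z \<in> \<Omega> \<and> f z = 0}" using negligible_subset by blast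
    moreover have "d > 0" using qu' by (simp add: d_def)
    moreover have "q \<in> \<Omega>" using r by auto
    ultimately show ?thesis unfolding U_def by blast
  qed
  have "open U"
    unfolding open_contains_ball
  proof
    fix q assume q: "q \<in> U"
    then obtain r where r: "r > 0" "ball q r \<subseteq> \<Omega>" using \<open>open \<Omega>\<close> open_contains_ball unfolding U_def by blast
    have "x \<in> U" if x: "x \<in> ball q (r/16)" for x
    proof (rule extend[OF _ _ q])
      show "r / 2 > 0" using r by simp
      show "ball x (r/2) \<subseteq> \<Omega>"
      proof
        fix y assume "y \<in> ball x (r/2)"
        then have "y \<in> ball q r" using x dist_triangle[of q y x] r by simp
        then show "y \<in> \<Omega>" using r by blast
      qed
      show "dist q x < r / 2 / 8" using x by simp
    qed
    then show "\<exists>e>0. ball q e \<subseteq> U" using r by (intro exI[of _ "r/16"]) auto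
  qed
  moreover have "open (\<Omega> - U)"
    unfolding open_contains_ball
  proof
    fix q assume q: "q \<in> \<Omega> - U"
    then obtain r where r: "r > 0" "ball q r \<subseteq> \<Omega>" using \<open>open \<Omega>\<close> open_contains_ball by blast
    have "ball q (r/8) \<subseteq> \<Omega> - U"
    proof
      fix x assume x: "x \<in> ball q (r/8)"
      have "x \<in> ball q r" using x r by simp
      \<comment> \<open>A point of \<open>U\<close> this close to \<open>q\<close> would pull
        \<open>q\<close> itself into \<open>U\<close>.\<close>
      moreover have "x \<notin> U" using extend[OF r, of x] x q by (auto simp: dist_commute)
      ultimately show "x \<in> \<Omega> - U" using r by blast
    qed
    then show "\<exists>e>0. ball q e \<subseteq> \<Omega> - U" using r by (intro exI[of _ "r/8"]) auto
  qed
  moreover have "p \<in> U"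
  proof -
    obtain r where r: "r > 0" "ball p r \<subseteq> \<Omega>" using \<open>open \<Omega>\<close> open_contains_ball p by blast
    have "negligible {z \<in> ball p (r/2). z \<in> \<Omega> \<and> f z = 0}"
      by (rule negligible_subset[OF holomorphic_Cn_zeros_locally_negligible[OF f r(2,1) p(2)]]) auto
    then show ?thesis unfolding U_def using p r by (auto intro!: exI[of _ "r/2"])
  qed
  moreover have "U \<subseteq> \<Omega>" unfolding U_def by blast
  ultimately have "U = \<Omega>"
    using connectedD[OF \<open>connected \<Omega>\<close>, of U "\<Omega> - U"] p by blast
  show ?thesis
    unfolding locally_negligible_alt[of "{z \<in> \<Omega>. f z = 0}"]
  proof
    fix x assume x: "x \<in> {z \<in> \<Omega>. f z = 0}"
    then have "x \<in> U" using \<open>U = \<Omega>\<close> by simp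
    then obtain r where r: "r > 0" "negligible {z \<in> ball x r. z \<in> \<Omega> \<and> f z = 0}" unfolding U_def by blast
    have "openin (top_of_set {z \<in> \<Omega>. f z = 0}) ({z \<in> \<Omega>. f z = 0} \<inter> ball x r)" by (rule openin_open_Int) simp
    moreover have "{z \<in> \<Omega>. f z = 0} \<inter> ball x r = {z \<in> ball x r. z \<in> \<Omega> \<and> f z = 0}" by blast
    ultimately show "\<exists>V. openin (top_of_set {z \<in> \<Omega>. f z = 0}) V \<and> x \<in> V \<and> negligible V"
      using r x by (intro exI[of _ "{z \<in> ball x r. z \<in> \<Omega> \<and> f z = 0}"]) auto
  qed
qed

section \<open>The Bergman kernel\<close>

context bergman_domain
begin

abbreviation "K \<equiv> bergman_kernel \<Omega>"

section \<open>Representers of point evaluation and the basis expansion\<close>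

lemma dom_lmeasurable: "\<Omega> \<in> lmeasurable"
  using bounded_dom dom_sets by (simp add: bounded_set_imp_lmeasurable)

lemma finite_measure_dom: "finite_measure \<mu>"
  using dom_lmeasurable by (rule finite_measure_lebesgue_on)

text \<open>Finite volume makes bounded functions square integrable. The constant and coordinate
  functions obtained this way yield positivity of the kernel on the diagonal and nondegeneracy of
  the metric.\<close>

lemma A2_boundedI:
  assumes g: "holomorphic_Cn g \<Omega>" and B: "\<And>z. z \<in> \<Omega> \<Longrightarrow> cmod (g z) \<le> B"
  shows "(\<lambda>z. if z \<in> \<Omega> then g z else 0) \<in> A2"
proof -
  have h: "holomorphic_Cn (\<lambda>z. if z \<in> \<Omega> then g z else 0) \<Omega>"
    using g holomorphic_Cn_cong_open[OF open_dom, of g "\<lambda>z. if z \<in> \<Omega> then g z else 0"] by simp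
  interpret finite_measure \<mu> by (rule finite_measure_dom)
  have "(\<lambda>z. if z \<in> \<Omega> then g z else 0) \<in> sq_int \<mu>"
  proof (rule sq_int_boundI)
    show "integrable \<mu> (\<lambda>z. B\<^sup>2)" by simp
    show "AE z in \<mu>. (cmod (if z \<in> \<Omega> then g z else 0))\<^sup>2 \<le> B\<^sup>2"
      by (rule AE_I2) (simp add: B power_mono)
  qed (rule holomorphic_Cn_measurable[OF h open_dom])
  with h show ?thesis by (simp add: A2_iff)
qed

lemma one_A2: "(\<lambda>z. if z \<in> \<Omega> then 1 else 0) \<in> A2"
  by (rule A2_boundedI[of _ 1]) auto

lemma coord_A2: "(\<lambda>z. if z \<in> \<Omega> then z $ i else 0) \<in> A2"
proof -
  obtain B where B: "\<And>z. z \<in> \<Omega> \<Longrightarrow> norm z \<le> B" using bounded_dom bounded_iff by blast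
  show ?thesis
    by (rule A2_boundedI[OF holomorphic_Cn_coord, of _ B]) (use B Finite_Cartesian_Product.norm_nth_le order_trans in blast)
qed

text \<open>Riesz by hand: project the constant 1 onto the kernel \<open>V\<close> of evaluation at
  \<open>z\<close>. The residual \<open>h\<close> is orthogonal to \<open>V\<close> and has
  \<open>h z = 1\<close>; since \<open>f - f z * h\<close> lies in \<open>V\<close>, pairing it with
  \<open>h\<close> gives \<open>f z\<close>.\<close>

lemma ex_evaluation_representer:
  assumes z: "z \<in> \<Omega>"
  shows "\<exists>k\<in>A2. \<forall>f\<in>A2. f z = ip f k"
proof -
  define V where "V = {f \<in> A2. f z = 0}"
  define f0 where "f0 = (\<lambda>z. if z \<in> \<Omega> then 1 else (0::complex))"
  have f0: "f0 \<in> A2" "f0 z = 1" using one_A2 z by (auto simp: f0_def)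
  have "\<exists>g v. g \<in> A2 \<and> (\<forall>n. v n \<in> V) \<and> (\<lambda>n. nsq (\<lambda>x. g x - v n x)) \<longlonglongrightarrow> 0
      \<and> (\<forall>u\<in>V. ip (\<lambda>x. f0 x - g x) u = 0)"
  proof (rule A2_projection[of V f0])
    show "V \<subseteq> A2" "(\<lambda>x. 0) \<in> V" "f0 \<in> A2" by (auto simp: V_def f0)
    show "(\<lambda>x. u x + v x) \<in> V" if "u \<in> V" "v \<in> V" for u v using that by (simp add: V_def A2_add)
    show "(\<lambda>x. c * v x) \<in> V" if "v \<in> V" for c v using that by (simp add: V_def A2_cmult)
  qed blast
  then obtain g v where g: "g \<in> A2" "\<And>n. v n \<in> V" "(\<lambda>n. nsq (\<lambda>x. g x - v n x)) \<longlonglongrightarrow> 0"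
      and orth: "\<And>u. u \<in> V \<Longrightarrow> ip (\<lambda>x. f0 x - g x) u = 0"
    by blast
  obtain r where r: "r > 0" "ball z r \<subseteq> \<Omega>" using open_dom open_contains_ball z by blast
  define c where "c = measure lborel (ball (0::complex^'n) r)"
  \<comment> \<open>\<open>g\<close> is only a limit of elements of \<open>V\<close>; continuity of
    point evaluation gives \<open>g z = 0\<close> nevertheless.\<close>
  have "(cmod (g z))\<^sup>2 \<le> nsq (\<lambda>x. g x - v n x) / c" for n
    using point_evaluation_bound[OF A2_diff[OF g(1), of "v n"] r(2,1)] g(2)[of n] by (simp add: V_def c_def)
  moreover have "(\<lambda>n. nsq (\<lambda>x. g x - v n x) / c) \<longlonglongrightarrow> 0"
    using tendsto_mult_left_zero[OF g(3), of "1 / c"] by simp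
  ultimately have "(cmod (g z))\<^sup>2 \<le> 0" by (intro tendsto_lowerbound[of _ _ sequentially]) auto
  then have gz: "g z = 0" by simp
  define h where "h = (\<lambda>x. f0 x - g x)"
  have h: "h \<in> A2" "h z = 1" unfolding h_def using A2_diff[OF f0(1) g(1)] f0(2) gz by auto
  have "nsq h \<noteq> 0" using A2_eq_0[OF h(1), of z] h(2) by auto
  define k where "k = (\<lambda>x. of_real (1 / nsq h) * h x)"
  have "f z = ip f k" if f: "f \<in> A2" for f
  proof -
    have "(\<lambda>x. f x - f z * h x) \<in> V" using f h by (simp add: V_def A2_diff A2_cmult)
    from orth[OF this] have "ip h (\<lambda>x. f x - f z * h x) = 0" by (simp add: h_def)
    then have "ip (\<lambda>x. f x - f z * h x) h = 0" using l2_inner_cnj[of \<mu> h "\<lambda>x. f x - f z * h x"] by simp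
    then have "ip f h = f z * of_real (nsq h)"
      by (simp add: l2_inner_diff_left l2_inner_cmult_left A2_sq_int f h A2_cmult l2_inner_self)
    then show ?thesis using \<open>nsq h \<noteq> 0\<close> by (simp add: k_def l2_inner_cmult_right del: of_real_divide)
       (simp add: field_simps)
  qed
  moreover have "k \<in> A2" unfolding k_def by (rule A2_cmult[OF h(1)])
  ultimately show ?thesis by blast
qed

text \<open>The Riesz representer of evaluation at \<open>z\<close>, that is, the conjugate of the
  kernel function of \<open>z\<close>. Kernel properties are proved for it, free of the basis hidden
  in \<open>bergman_kernel\<close>.\<close>

definition rep :: "complex^'n \<Rightarrow> complex^'n \<Rightarrow> complex" where
  "rep z = (SOME k. k \<in> A2 \<and> (\<forall>f\<in>A2. f z = ip f k))"

lemma rep_A2: "z \<in> \<Omega> \<Longrightarrow> rep z \<in> A2"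
  and rep_eval: "z \<in> \<Omega> \<Longrightarrow> f \<in> A2 \<Longrightarrow> f z = ip f (rep z)"
  using someI_ex[of "\<lambda>k. k \<in> A2 \<and> (\<forall>f\<in>A2. f z = ip f k)"] ex_evaluation_representer[of z]
  unfolding rep_def by blast+

text \<open>Pythagoras: the Fourier residual is orthogonal to the span of \<open>F\<close>. Allowing
  \<open>F'\<close> inside \<open>F\<close> lets all larger finite sets be compared with one fixed
  approximation.\<close>

lemma Bessel_best_approximation:
  assumes F: "finite F" "F \<subseteq> A2" "\<And>s t. s \<in> F \<Longrightarrow> t \<in> F \<Longrightarrow> ip s t = (if s = t then 1 else 0)"
    and f: "f \<in> A2" and F': "F' \<subseteq> F"
  shows "nsq (\<lambda>x. f x - (\<Sum>s\<in>F. ip f s * s x)) \<le> nsq (\<lambda>x. f x - (\<Sum>s\<in>F'. c s * s x))"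
proof -
  define d where "d s = (if s \<in> F' then c s else 0) - ip f s" for s
  define p where "p = (\<lambda>x. f x - (\<Sum>s\<in>F. ip f s * s x))"
  define w where "w = (\<lambda>x. \<Sum>s\<in>F. d s * s x)"
  have FA: "s \<in> sq_int \<mu>" if "s \<in> F" for s using F that A2_sq_int by blast
  have wA: "w \<in> sq_int \<mu>" unfolding w_def by (intro sq_int_sum sq_int_cmult FA)
  have sA: "(\<lambda>x. \<Sum>s\<in>F. ip f s * s x) \<in> sq_int \<mu>" by (intro sq_int_sum sq_int_cmult FA)
  have pA: "p \<in> sq_int \<mu>" unfolding p_def by (intro sq_int_diff sA A2_sq_int f)
  have ps: "ip p s = 0" if s: "s \<in> F" for s
  proof -
    have "ip p s = ip f s - (\<Sum>t\<in>F. ip f t * ip t s)"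
      unfolding p_def using FA s sA A2_sq_int[OF f]
      by (simp add: l2_inner_diff_left l2_inner_sum_left l2_inner_cmult_left sq_int_cmult)
    also have "(\<Sum>t\<in>F. ip f t * ip t s) = (\<Sum>t\<in>F. if t = s then ip f s else 0)"
      by (rule sum.cong) (auto simp: F(3) s)
    finally show ?thesis using s F(1) by simp
  qed
  have "ip p w = 0"
    unfolding w_def using FA pA by (simp add: l2_inner_sum_right l2_inner_cmult_right sq_int_cmult ps)
  moreover have "(\<lambda>x. f x - (\<Sum>s\<in>F'. c s * s x)) = (\<lambda>x. p x - 1 * w x)"
  proof
    fix x
    have "(\<Sum>s\<in>F'. c s * s x) = (\<Sum>s\<in>F. (if s \<in> F' then c s else 0) * s x)"
      using F' F(1) by (intro sum.mono_neutral_cong_left) auto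
    then show "f x - (\<Sum>s\<in>F'. c s * s x) = p x - 1 * w x"
      by (simp add: p_def w_def d_def ring_distribs sum_subtractf)
  qed
  ultimately have "nsq (\<lambda>x. f x - (\<Sum>s\<in>F'. c s * s x)) = nsq p + nsq w"
    using l2_sq_sub_cmult[OF pA wA, of 1] by simp
  then show ?thesis by (simp add: p_def)
qed

text \<open>Density gives one finite \<open>F0\<close> with small error, best approximation passes
  the error bound to every finite \<open>F\<close> containing \<open>F0\<close>, and Cauchy-Schwarz
  against \<open>g\<close> turns it into convergence along the net of finite sets.\<close>

lemma Parseval_has_sum:
  assumes S: "bergman_orthonormal_basis \<Omega> S" and f: "f \<in> A2" and g: "g \<in> A2"
  shows "((\<lambda>s. ip f s * ip s g) has_sum ip f g) S"
proof -
  have SA: "S \<subseteq> A2" and on: "\<And>s t. s \<in> S \<Longrightarrow> t \<in> S \<Longrightarrow> ip s t = (if s = t then 1 else 0)"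
    and dense: "\<And>e. e > 0 \<Longrightarrow> \<exists>F c. finite F \<and> F \<subseteq> S \<and> nsq (\<lambda>x. f x - (\<Sum>s\<in>F. c s * s x)) < e"
    using S f unfolding bergman_orthonormal_basis_def bergman_inner_eq l2_sq_def by blast+
  show ?thesis
    unfolding has_sum_def
  proof (rule tendstoI)
    fix e :: real assume "e > 0"
    define e' where "e' = e\<^sup>2 / (nsq g + 1)"
    have e': "e' > 0" using \<open>e > 0\<close> by (simp add: e'_def add_nonneg_pos)
    obtain F0 c where F0: "finite F0" "F0 \<subseteq> S" "nsq (\<lambda>x. f x - (\<Sum>s\<in>F0. c s * s x)) < e'"
      using dense[OF e'] by blast
    have "dist (\<Sum>s\<in>F. ip f s * ip s g) (ip f g) < e" if F: "finite F" "F0 \<subseteq> F" "F \<subseteq> S" for F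
    proof -
      define p where "p = (\<lambda>x. f x - (\<Sum>s\<in>F. ip f s * s x))"
      have FA: "s \<in> sq_int \<mu>" if "s \<in> F" for s using F SA that A2_sq_int by blast
      have sA: "(\<lambda>x. \<Sum>s\<in>F. ip f s * s x) \<in> sq_int \<mu>" by (intro sq_int_sum sq_int_cmult FA)
      have pA: "p \<in> sq_int \<mu>" unfolding p_def by (intro sq_int_diff sA A2_sq_int f)
      have "nsq p \<le> nsq (\<lambda>x. f x - (\<Sum>s\<in>F0. c s * s x))"
        unfolding p_def by (rule Bessel_best_approximation) (use F SA on f in blast)+
      then have pe: "nsq p \<le> e'" using F0(3) by simp
      have "ip p g = ip f g - (\<Sum>s\<in>F. ip f s * ip s g)"
        unfolding p_def using FA sA A2_sq_int[OF f] A2_sq_int[OF g]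
        by (simp add: l2_inner_diff_left l2_inner_sum_left l2_inner_cmult_left sq_int_cmult)
      then have "(dist (\<Sum>s\<in>F. ip f s * ip s g) (ip f g))\<^sup>2 = (cmod (ip p g))\<^sup>2"
        by (simp add: dist_norm norm_minus_commute)
      also have "\<dots> \<le> nsq p * nsq g" by (rule l2_Cauchy_Schwarz[OF pA A2_sq_int[OF g]])
      also have "\<dots> \<le> e' * nsq g" using pe by (intro mult_right_mono) auto
      also have "\<dots> < e' * (nsq g + 1)" using e' by simp
      also have "\<dots> = e\<^sup>2"
      proof -
        have "nsq g + 1 > 0" using l2_sq_nonneg[of \<mu> g] by linarith
        then show ?thesis by (simp add: e'_def)
      qed
      finally show ?thesis by (rule power_less_imp_less_base) (use \<open>e > 0\<close> in simp)
    qed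
    then show "\<forall>\<^sub>F F in finite_subsets_at_top S. dist (\<Sum>s\<in>F. ip f s * ip s g) (ip f g) < e"
      unfolding eventually_finite_subsets_at_top using F0(1,2) by blast
  qed
qed

text \<open>Parseval for the two representers: their Fourier coefficients are values of the basis
  functions, so the defining sum of the kernel is \<open>ip (rep \<xi>) (rep z)\<close> for any
  basis.\<close>

lemma K_eq_rep:
  assumes z: "z \<in> \<Omega>" and \<xi>: "\<xi> \<in> \<Omega>"
  shows "K z \<xi> = rep \<xi> z"
proof -
  define S where "S = (SOME S. bergman_orthonormal_basis \<Omega> S)"
  have S: "bergman_orthonormal_basis \<Omega> S"
    unfolding S_def by (rule someI_ex[OF ex_orthonormal_basis])
  then have SA: "S \<subseteq> A2" unfolding bergman_orthonormal_basis_def by blast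
  have "((\<lambda>s. ip (rep \<xi>) s * ip s (rep z)) has_sum ip (rep \<xi>) (rep z)) S"
    by (rule Parseval_has_sum[OF S rep_A2[OF \<xi>] rep_A2[OF z]])
  moreover have "ip (rep \<xi>) s * ip s (rep z) = s z * cnj (s \<xi>)" if "s \<in> S" for s
    using rep_eval[OF z, of s] rep_eval[OF \<xi>, of s] that SA l2_inner_cnj[of \<mu> s "rep \<xi>"] by auto
  ultimately have "((\<lambda>s. s z * cnj (s \<xi>)) has_sum ip (rep \<xi>) (rep z)) S"
    using has_sum_cong by (metis (no_types, lifting))
  then have "K z \<xi> = ip (rep \<xi>) (rep z)"
    unfolding bergman_kernel_def S_def[symmetric] by (rule infsumI)
  also have "\<dots> = rep \<xi> z" using rep_eval[OF z rep_A2[OF \<xi>]] by simp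
  finally show ?thesis .
qed

lemma K_sym:
  assumes "z \<in> \<Omega>" "\<xi> \<in> \<Omega>"
  shows "K z \<xi> = cnj (K \<xi> z)"
  using K_eq_rep[OF assms] K_eq_rep[OF assms(2,1)] rep_eval[OF assms(1) rep_A2[OF assms(2)]]
    rep_eval[OF assms(2) rep_A2[OF assms(1)]] l2_inner_cnj by metis

lemma K_eq_cnj_rep: "z \<in> \<Omega> \<Longrightarrow> \<xi> \<in> \<Omega> \<Longrightarrow> K z \<xi> = cnj (rep z \<xi>)"
  using K_sym K_eq_rep by metis

lemma K_holomorphic:
  assumes "\<xi> \<in> \<Omega>" shows "holomorphic_Cn (\<lambda>z. K z \<xi>) \<Omega>"
  using holomorphic_Cn_cong_open[OF open_dom, of "rep \<xi>" "\<lambda>z. K z \<xi>"] K_eq_rep rep_A2[OF assms] assms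
  by (simp add: A2_iff)

lemma K_sq_int:
  assumes "z \<in> \<Omega>" shows "K z \<in> sq_int \<mu>"
proof -
  have r: "rep z \<in> sq_int \<mu>" by (rule A2_sq_int[OF rep_A2[OF assms]])
  have "K z \<in> borel_measurable \<mu> \<longleftrightarrow> (\<lambda>\<xi>. cnj (rep z \<xi>)) \<in> borel_measurable \<mu>"
    by (rule measurable_cong) (simp add: K_eq_cnj_rep assms)
  then have m: "K z \<in> borel_measurable \<mu>"
    using borel_measurable_cnj[OF sq_intD(1)[OF r]] by blast
  have "integrable \<mu> (\<lambda>\<xi>. (cmod (K z \<xi>))\<^sup>2)"
    using sq_intD(2)[OF r] by (rule Bochner_Integration.integrable_cong[THEN iffD1, rotated 2]) (auto simp: K_eq_cnj_rep assms)
  with m show ?thesis by (simp add: sq_int_def)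
qed

lemma reproducing:
  assumes "z \<in> \<Omega>" "f \<in> A2"
  shows "f z = (\<integral>\<xi>. f \<xi> * K z \<xi> \<partial>\<mu>)"
proof -
  have "f z = (\<integral>\<xi>. f \<xi> * cnj (rep z \<xi>) \<partial>\<mu>)" using rep_eval[OF assms] by (simp add: l2_inner_def)
  also have "\<dots> = (\<integral>\<xi>. f \<xi> * K z \<xi> \<partial>\<mu>)"
    by (rule Bochner_Integration.integral_cong) (auto simp: K_eq_cnj_rep assms)
  finally show ?thesis .
qed

lemma K_diag: "z \<in> \<Omega> \<Longrightarrow> K z z = of_real (nsq (K z))"
proof -
  assume z: "z \<in> \<Omega>"
  have "K z z = ip (rep z) (rep z)" using K_eq_rep[OF z z] rep_eval[OF z rep_A2[OF z]] by simp
  also have "\<dots> = of_real (nsq (rep z))" by (rule l2_inner_self)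
  also have "nsq (rep z) = nsq (K z)"
    unfolding l2_sq_def by (rule Bochner_Integration.integral_cong) (auto simp: K_eq_cnj_rep z)
  finally show ?thesis .
qed

text \<open>The diagonal value is the squared norm of the representer, which cannot vanish since it
  reproduces the value 1 of the constant function.\<close>

lemma K_diag_pos:
  assumes z: "z \<in> \<Omega>" shows "Re (K z z) > 0"
proof -
  have "K z z = ip (rep z) (rep z)" using K_eq_rep[OF z z] rep_eval[OF z rep_A2[OF z]] by simp
  then have eq: "Re (K z z) = nsq (rep z)" by (simp add: l2_inner_self)
  moreover have "nsq (rep z) \<noteq> 0"
  proof
    assume "nsq (rep z) = 0"
    then have "ip (rep z) (\<lambda>z. if z \<in> \<Omega> then 1 else 0) = 0"
      by (intro l2_inner_eq_0 A2_sq_int rep_A2 z one_A2)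
    then have "ip (\<lambda>z. if z \<in> \<Omega> then 1 else 0) (rep z) = 0"
      using l2_inner_cnj[of \<mu> "rep z"] by (metis complex_cnj_zero)
    then show False using rep_eval[OF z one_A2] z by simp
  qed
  ultimately show ?thesis using l2_sq_nonneg[of \<mu> "rep z"] by linarith
qed

section \<open>Local bounds, continuity and zeros of the kernel\<close>

lemma K_bound:
  assumes "ball z r \<subseteq> \<Omega>" "r > 0" and \<xi>: "ball \<xi> s \<subseteq> \<Omega>" "s > 0"
  shows "(cmod (K z \<xi>))\<^sup>2 \<le> 1 / (measure lborel (ball (0::complex^'n) r) * measure lborel (ball (0::complex^'n) s))"
proof -
  have z: "z \<in> \<Omega>" and x: "\<xi> \<in> \<Omega>" using assms by auto
  have nk: "nsq (rep w) \<le> 1 / measure lborel (ball (0::complex^'n) t)"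
    if w: "ball w t \<subseteq> \<Omega>" "t > 0" for w t
  proof -
    have wO: "w \<in> \<Omega>" using w by auto
    define c where "c = measure lborel (ball (0::complex^'n) t)"
    have c: "c > 0" unfolding c_def using w(2) by (rule content_ball_pos)
    \<comment> \<open>The value of \<open>rep w\<close> at \<open>w\<close> is its own squared norm
      \<open>x\<close>, so the point evaluation bound reads \<open>x^2 <= x / c\<close>, that is,
      \<open>x <= 1 / c\<close>.\<close>
    have "rep w w = of_real (nsq (rep w))" using rep_eval[OF wO rep_A2[OF wO]] by (simp add: l2_inner_self)
    then have "(nsq (rep w))\<^sup>2 \<le> nsq (rep w) / c"
      using point_evaluation_bound[OF rep_A2[OF wO] w] by (simp add: c_def)
    then have "nsq (rep w) * nsq (rep w) * c \<le> nsq (rep w) * 1"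
      using c by (simp add: power2_eq_square pos_le_divide_eq)
    moreover have "nsq (rep w) > 0"
      using K_diag_pos[OF wO] K_eq_rep[OF wO wO] \<open>rep w w = _\<close> by simp
    ultimately have "nsq (rep w) * c \<le> 1" by (simp add: mult.assoc)
    then show ?thesis using c by (simp add: c_def pos_le_divide_eq)
  qed
  have "K z \<xi> = ip (rep \<xi>) (rep z)" using K_eq_rep[OF z x] rep_eval[OF z rep_A2[OF x]] by simp
  then have "(cmod (K z \<xi>))\<^sup>2 \<le> nsq (rep \<xi>) * nsq (rep z)"
    using l2_Cauchy_Schwarz[OF A2_sq_int[OF rep_A2[OF x]] A2_sq_int[OF rep_A2[OF z]]] by simp
  also have "\<dots> \<le> (1 / measure lborel (ball (0::complex^'n) s)) * (1 / measure lborel (ball (0::complex^'n) r))"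
    by (intro mult_mono nk assms) auto
  finally show ?thesis by (simp add: mult.commute)
qed

text \<open>Lipschitz in the first variable, uniformly for the second near \<open>\<xi>\<close>,
  plus continuity in the second variable at fixed \<open>z\<close>. Joint continuity supplies the
  measurability that Tonelli requires.\<close>

lemma K_jointly_continuous: "continuous_on (\<Omega> \<times> \<Omega>) (\<lambda>(z, \<xi>). K z \<xi>)"
  unfolding continuous_on_def
proof
  fix q assume "q \<in> \<Omega> \<times> \<Omega>"
  then obtain z \<xi> where q: "q = (z, \<xi>)" and z: "z \<in> \<Omega>" and \<xi>: "\<xi> \<in> \<Omega>" by auto
  obtain r where r: "r > 0" "cball z (2 * r) \<subseteq> \<Omega>" "\<And>w. w \<in> cball z (2 * r) \<Longrightarrow> ball w (2 * r) \<subseteq> \<Omega>"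
  proof -
    obtain R where "R > 0" "ball z (2 * R) \<subseteq> \<Omega>" "\<And>w. w \<in> cball z R \<Longrightarrow> ball w R \<subseteq> \<Omega>" "cball z R \<subseteq> \<Omega>"
      by (rule ball_in_dom[OF z]) (blast intro: that)
    then show ?thesis by (intro that[of "R/2"]) auto
  qed
  obtain s where s: "s > 0" "\<And>w. w \<in> cball \<xi> s \<Longrightarrow> ball w s \<subseteq> \<Omega>"
    by (rule ball_in_dom[OF \<xi>]) (blast intro: that)
  define B where "B = sqrt (1 / (measure lborel (ball (0::complex^'n) (2 * r)) * measure lborel (ball (0::complex^'n) s)))"
  have KB: "cmod (K w y) \<le> B" if "w \<in> cball z (2 * r)" "y \<in> cball \<xi> s" for w y
    unfolding B_def using K_bound[OF r(3)[OF that(1)] _ s(2)[OF that(2)] s(1)] r(1) by (intro real_le_rsqrt) auto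
  have lip: "cmod (K w y - K z y) \<le> B / r * norm (w - z)" if "w \<in> cball z r" "y \<in> cball \<xi> s" for w y
  proof -
    have "y \<in> \<Omega>" using s(2)[OF that(2)] s(1) by auto
    then show ?thesis
      using r KB that by (intro holomorphic_Cn_Lipschitz[OF K_holomorphic]) auto
  qed
  have cont: "((\<lambda>y. K z y) \<longlongrightarrow> K z \<xi>) (at \<xi>)"
  proof -
    have "isCont (rep z) \<xi>"
      using rep_A2[OF z] holomorphic_Cn_imp_differentiable[of "rep z" \<Omega> \<xi>] \<xi>
      by (auto simp: A2_iff intro: differentiable_imp_continuous_within)
    then have "((\<lambda>y. cnj (rep z y)) \<longlongrightarrow> cnj (rep z \<xi>)) (at \<xi>)" by (auto intro!: tendsto_cnj simp: isCont_def)
    then have "((\<lambda>y. K z y) \<longlongrightarrow> cnj (rep z \<xi>)) (at \<xi>)"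
      by (rule Lim_transform_within_open[OF _ open_dom \<xi>]) (simp add: K_eq_cnj_rep z)
    then show ?thesis by (simp add: K_eq_cnj_rep z \<xi>)
  qed
  have "((\<lambda>p. (K (fst p) (snd p) - K z (snd p)) + K z (snd p)) \<longlongrightarrow> 0 + K z \<xi>) (at (z, \<xi>))"
  proof (rule tendsto_add)
    show "((\<lambda>p. K z (snd p)) \<longlongrightarrow> K z \<xi>) (at (z, \<xi>))"
    proof (rule isCont_tendsto_compose[where g = "\<lambda>y. K z y"])
      show "isCont (\<lambda>y. K z y) \<xi>" using cont by (simp add: isCont_def)
      show "(snd \<longlongrightarrow> \<xi>) (at (z, \<xi>))" using tendsto_snd[OF tendsto_ident_at, of "(z, \<xi>)" UNIV] by simp
    qed
    show "((\<lambda>p. K (fst p) (snd p) - K z (snd p)) \<longlongrightarrow> 0) (at (z, \<xi>))"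
    proof (rule Lim_null_comparison)
      have "((\<lambda>p. B / r * norm (fst p - z)) \<longlongrightarrow> B / r * norm (z - z)) (at (z, \<xi>))"
        using tendsto_fst[OF tendsto_ident_at, of "(z, \<xi>)" UNIV] by (intro tendsto_intros) simp
      then show "((\<lambda>p. B / r * norm (fst p - z)) \<longlongrightarrow> 0) (at (z, \<xi>))" by simp
      have "open (ball z r \<times> ball \<xi> s)" by (intro open_Times) auto
      moreover have "(z, \<xi>) \<in> ball z r \<times> ball \<xi> s" using r s by auto
      ultimately have "\<forall>\<^sub>F p in at (z, \<xi>). p \<in> ball z r \<times> ball \<xi> s"
        by (metis eventually_at_topological)
      then show "\<forall>\<^sub>F p in at (z, \<xi>). cmod (K (fst p) (snd p) - K z (snd p)) \<le> B / r * norm (fst p - z)"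
        by (rule eventually_mono) (rule lip, auto)
    qed
  qed
  then have "((\<lambda>p. K (fst p) (snd p)) \<longlongrightarrow> K z \<xi>) (at (z, \<xi>))" by simp
  then show "((\<lambda>(z, \<xi>). K z \<xi>) \<longlongrightarrow> (case q of (z, \<xi>) \<Rightarrow> K z \<xi>)) (at q within \<Omega> \<times> \<Omega>)"
    unfolding q by (simp add: case_prod_unfold tendsto_within_subset[of _ _ _ UNIV])
qed

text \<open>As a function of \<open>\<xi>\<close> the kernel is the conjugate of the holomorphic
  \<open>rep z\<close>, whose value at \<open>z\<close> is positive; on a connected domain its zeros
  are therefore null.\<close>

lemma K_zero_null: "z \<in> \<Omega> \<Longrightarrow> AE \<xi> in \<mu>. K z \<xi> \<noteq> 0"
proof -
  assume z: "z \<in> \<Omega>"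
  have "negligible {\<xi> \<in> \<Omega>. rep z \<xi> = 0}"
  proof (rule holomorphic_Cn_zeros_negligible[OF _ open_dom conn_dom z])
    show "holomorphic_Cn (rep z) \<Omega>" using rep_A2[OF z] by (simp add: A2_iff)
    show "rep z z \<noteq> 0" using K_diag_pos[OF z] K_eq_rep[OF z z] by auto
  qed
  then have "{\<xi> \<in> \<Omega>. rep z \<xi> = 0} \<in> null_sets lebesgue" by (simp add: negligible_iff_null_sets)
  then have "AE \<xi> in lebesgue. \<xi> \<in> \<Omega> \<longrightarrow> rep z \<xi> \<noteq> 0"
    by (rule AE_I') auto
  then have "AE \<xi> in \<mu>. rep z \<xi> \<noteq> 0"
    by (simp add: AE_restrict_space_iff)
  then show ?thesis by (rule AE_mp) (auto simp: K_eq_cnj_rep z intro!: AE_I2)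
qed

text \<open>\<open>M \<xi>\<close> is the integral of \<open>|K u \<xi>|^2\<close> over
  \<open>u\<close> in \<open>ball z (2 r)\<close>, divided by the volume \<open>c\<close> of a ball
  of radius \<open>r\<close>. The sub-mean value inequality on \<open>ball w r\<close> makes it
  dominate, and Tonelli with the bound \<open>nsq (K u) <= 1 / c\<close> makes it
  integrable.\<close>

lemma K_locally_dominated:
  assumes z: "z \<in> \<Omega>"
  obtains r M where "r > 0" "cball z r \<subseteq> \<Omega>" "integrable \<mu> M"
    "\<And>w \<xi>. w \<in> cball z r \<Longrightarrow> \<xi> \<in> \<Omega> \<Longrightarrow> (cmod (K w \<xi>))\<^sup>2 \<le> M \<xi>"
proof -
  obtain R where R: "R > 0" "ball z R \<subseteq> \<Omega>" using open_dom open_contains_ball z by blast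
  \<comment> \<open>Three layers: \<open>w\<close> ranges over radius \<open>r\<close>, the
    averaging ball \<open>ball w r\<close> stays within radius \<open>2 r\<close>, and balls of
    radius \<open>r\<close> about its points stay within \<open>R\<close>.\<close>
  define r where "r = R / 3"
  have r: "r > 0" using R by (simp add: r_def)
  have b1: "ball u r \<subseteq> \<Omega>" if "u \<in> ball z (2 * r)" for u
  proof
    fix x assume "x \<in> ball u r"
    then have "x \<in> ball z R" using that dist_triangle[of z x u] by (simp add: r_def)
    then show "x \<in> \<Omega>" using R by blast
  qed
  have b2: "ball w r \<subseteq> ball z (2 * r)" if "w \<in> cball z r" for w
  proof
    fix x assume "x \<in> ball w r"
    then show "x \<in> ball z (2 * r)" using that dist_triangle[of z x w] by simp
  qed
  have b3: "ball z (2 * r) \<subseteq> \<Omega>" using R by (intro subset_trans[OF subset_ball R(2)]) (simp add: r_def)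
  define c where "c = measure lborel (ball (0::complex^'n) r)"
  have c: "c > 0" unfolding c_def using r by (rule content_ball_pos)
  define k where "k u \<xi> = ennreal ((cmod (K u \<xi>))\<^sup>2)" for u \<xi>
  define m where "m \<xi> = (\<integral>\<^sup>+u\<in>ball z (2 * r). k u \<xi> \<partial>lborel)" for \<xi>
  have "(\<lambda>q. indicator (\<Omega> \<times> \<Omega>) q *\<^sub>R ((cmod (K (fst q) (snd q)))\<^sup>2)) \<in> borel_measurable borel"
    using K_jointly_continuous open_dom
    by (intro borel_measurable_continuous_on_indicator continuous_intros)
       (auto simp: case_prod_unfold open_Times borel_open)
  then have "(\<lambda>q. ennreal (indicator (\<Omega> \<times> \<Omega>) q *\<^sub>R ((cmod (K (fst q) (snd q)))\<^sup>2))) \<in> borel_measurable borel"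
    by measurable
  also have "(\<lambda>q. ennreal (indicator (\<Omega> \<times> \<Omega>) q *\<^sub>R ((cmod (K (fst q) (snd q)))\<^sup>2)))
      = (\<lambda>q. k (fst q) (snd q) * indicator \<Omega> (fst q) * indicator \<Omega> (snd q))"
    by (auto simp: k_def indicator_def mem_Times_iff)
  finally have meas0: "(\<lambda>q. k (fst q) (snd q) * indicator \<Omega> (fst q) * indicator \<Omega> (snd q)) \<in> borel_measurable (borel \<Otimes>\<^sub>M borel)"
    unfolding borel_prod .
  have meas1: "(\<lambda>q. k (fst q) (snd q) * indicator (ball z (2 * r)) (fst q) * indicator \<Omega> (snd q)) \<in> borel_measurable (borel \<Otimes>\<^sub>M borel)"
  proof -
    have "(\<lambda>q. (k (fst q) (snd q) * indicator \<Omega> (fst q) * indicator \<Omega> (snd q)) * indicator (ball z (2 * r)) (fst q :: complex^'n))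
       \<in> borel_measurable (borel \<Otimes>\<^sub>M (borel :: (complex^'n) measure))"
      by (intro borel_measurable_times_ennreal meas0 measurable_compose[OF measurable_fst borel_measurable_indicator]) simp
    also have "(\<lambda>q. (k (fst q) (snd q) * indicator \<Omega> (fst q) * indicator \<Omega> (snd q)) * indicator (ball z (2 * r)) (fst q))
       = (\<lambda>q. k (fst q) (snd q) * indicator (ball z (2 * r)) (fst q) * indicator \<Omega> (snd q))"
      using b3 by (auto simp: indicator_def fun_eq_iff)
    finally show ?thesis .
  qed
  have meas2: "(\<lambda>q. k (snd q) (fst q) * indicator (ball z (2 * r)) (snd q) * indicator \<Omega> (fst q)) \<in> borel_measurable (borel \<Otimes>\<^sub>M borel)"
    using measurable_compose[OF measurable_pair_swap' meas1] by (simp add: case_prod_unfold)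
  have mm: "(\<lambda>\<xi>. m \<xi> * indicator \<Omega> \<xi>) \<in> borel_measurable borel"
  proof -
    have ms: "sets ((borel :: (complex^'n) measure) \<Otimes>\<^sub>M (lborel :: (complex^'n) measure)) = sets (borel \<Otimes>\<^sub>M borel)"
      by (intro sets_pair_measure_cong) auto
    have "(\<lambda>\<xi>. \<integral>\<^sup>+u. k u \<xi> * indicator (ball z (2 * r)) u * indicator \<Omega> \<xi> \<partial>lborel) \<in> borel_measurable borel"
      using meas2 by (intro lborel.borel_measurable_nn_integral) (simp add: case_prod_unfold measurable_cong_sets[OF ms refl])
    also have "(\<lambda>\<xi>. \<integral>\<^sup>+u. k u \<xi> * indicator (ball z (2 * r)) u * indicator \<Omega> \<xi> \<partial>lborel) = (\<lambda>\<xi>. m \<xi> * indicator \<Omega> \<xi>)"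
    proof
      fix \<xi> show "(\<integral>\<^sup>+u. k u \<xi> * indicator (ball z (2 * r)) u * indicator \<Omega> \<xi> \<partial>lborel) = m \<xi> * indicator \<Omega> \<xi>"
        by (cases "\<xi> \<in> \<Omega>") (auto simp: m_def)
    qed
    finally show ?thesis .
  qed
  have kint: "(\<integral>\<^sup>+\<xi>\<in>\<Omega>. k u \<xi> \<partial>lborel) \<le> ennreal (1 / c)" if u: "u \<in> ball z (2 * r)" for u
  proof -
    have uO: "u \<in> \<Omega>" using u b3 by blast
    have "(\<integral>\<^sup>+\<xi>\<in>\<Omega>. k u \<xi> \<partial>lborel) = ennreal (nsq (K u))"
      unfolding k_def nn_integral_l2_sq[OF K_sq_int[OF uO], symmetric] by (simp add: nn_integral_lebesgue_on_lborel)
    also have "nsq (K u) \<le> 1 / c"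
    proof -
      \<comment> \<open>\<open>nsq (K u)\<close> is the diagonal value \<open>K u u\<close>, so the
        pointwise bound on the kernel bounds the norm.\<close>
      have "(nsq (K u))\<^sup>2 \<le> 1 / (c * c)"
        using K_bound[OF b1[OF u] r b1[OF u] r] K_diag[OF uO] by (simp add: c_def)
      also have "1 / (c * c) = (1 / c)\<^sup>2" by (simp add: power2_eq_square)
      finally show ?thesis by (rule power2_le_imp_le) (use c in simp)
    qed
    finally show ?thesis by (simp add: ennreal_leI)
  qed
  have "(\<integral>\<^sup>+\<xi>\<in>\<Omega>. m \<xi> \<partial>lborel) = (\<integral>\<^sup>+\<xi>. (\<integral>\<^sup>+u. k u \<xi> * indicator (ball z (2 * r)) u * indicator \<Omega> \<xi> \<partial>lborel) \<partial>lborel)"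
  proof (rule nn_integral_cong)
    fix \<xi> show "m \<xi> * indicator \<Omega> \<xi> = (\<integral>\<^sup>+u. k u \<xi> * indicator (ball z (2 * r)) u * indicator \<Omega> \<xi> \<partial>lborel)"
      by (cases "\<xi> \<in> \<Omega>") (auto simp: m_def)
  qed
  also have "\<dots> = (\<integral>\<^sup>+u. (\<integral>\<^sup>+\<xi>. k u \<xi> * indicator (ball z (2 * r)) u * indicator \<Omega> \<xi> \<partial>lborel) \<partial>lborel)"
  proof (rule lborel_pair.Fubini')
    have ms: "sets ((lborel :: (complex^'n) measure) \<Otimes>\<^sub>M (lborel :: (complex^'n) measure)) = sets (borel \<Otimes>\<^sub>M borel)"
      by (intro sets_pair_measure_cong) auto
    show "(\<lambda>(u, \<xi>). k u \<xi> * indicator (ball z (2 * r)) u * indicator \<Omega> \<xi>) \<in> borel_measurable (lborel \<Otimes>\<^sub>M lborel)"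
      using meas1 by (simp add: case_prod_unfold measurable_cong_sets[OF ms refl])
  qed
  also have "\<dots> \<le> (\<integral>\<^sup>+u. ennreal (1 / c) * indicator (ball z (2 * r)) u \<partial>lborel)"
  proof (rule nn_integral_mono)
    fix u show "(\<integral>\<^sup>+\<xi>. k u \<xi> * indicator (ball z (2 * r)) u * indicator \<Omega> \<xi> \<partial>lborel) \<le> ennreal (1 / c) * indicator (ball z (2 * r)) u"
      using kint[of u] by (cases "u \<in> ball z (2 * r)") auto
  qed
  also have "\<dots> = ennreal (1 / c) * emeasure lborel (ball z (2 * r))"
    by (rule nn_integral_cmult_indicator) simp
  also have "\<dots> < \<infinity>" using emeasure_lborel_ball_finite[of z "2 * r"] by (simp add: ennreal_mult_less_top)
  finally have mfin: "(\<integral>\<^sup>+\<xi>\<in>\<Omega>. m \<xi> \<partial>lborel) < \<infinity>" .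
  have mO: "m \<in> borel_measurable \<mu>"
  proof -
    have "(\<lambda>\<xi>. m \<xi> * indicator \<Omega> \<xi>) \<in> borel_measurable \<mu>"
      using mm by (intro measurable_restrict_space1 measurable_completion) simp
    then show ?thesis by (rule measurable_cong[THEN iffD1, rotated]) simp
  qed
  \<comment> \<open>Finiteness is needed at every \<open>\<xi>\<close>, since domination is claimed
    everywhere; by symmetry the integral over \<open>u\<close> is at most the squared norm of
    \<open>rep \<xi>\<close>.\<close>
  have mreal: "m \<xi> < \<infinity>" if "\<xi> \<in> \<Omega>" for \<xi>
  proof -
    have "m \<xi> \<le> (\<integral>\<^sup>+u\<in>\<Omega>. ennreal ((cmod (rep \<xi> u))\<^sup>2) \<partial>lborel)"
      unfolding m_def k_def
    proof (rule nn_integral_mono)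
      fix u show "ennreal ((cmod (K u \<xi>))\<^sup>2) * indicator (ball z (2 * r)) u \<le> ennreal ((cmod (rep \<xi> u))\<^sup>2) * indicator \<Omega> u"
        using b3 that by (cases "u \<in> ball z (2 * r)") (auto simp: K_eq_rep)
    qed
    also have "\<dots> = ennreal (nsq (rep \<xi>))"
      unfolding nn_integral_l2_sq[OF A2_sq_int[OF rep_A2[OF that]], symmetric] by (simp add: nn_integral_lebesgue_on_lborel)
    finally show ?thesis by (simp add: le_less_trans)
  qed
  define M where "M \<xi> = enn2real (m \<xi>) / c" for \<xi>
  have Mint: "integrable \<mu> M"
  proof -
    have "integrable \<mu> (\<lambda>\<xi>. enn2real (m \<xi>))"
    proof (rule integrableI_nonneg)
      show "(\<lambda>\<xi>. enn2real (m \<xi>)) \<in> borel_measurable \<mu>" using mO by measurable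
      have "(\<integral>\<^sup>+\<xi>. ennreal (enn2real (m \<xi>)) \<partial>\<mu>) = (\<integral>\<^sup>+\<xi>. m \<xi> \<partial>\<mu>)"
        using mreal by (intro nn_integral_cong) simp
      also have "\<dots> < \<infinity>" using mfin by (simp add: nn_integral_lebesgue_on_lborel)
      finally show "(\<integral>\<^sup>+\<xi>. ennreal (enn2real (m \<xi>)) \<partial>\<mu>) < \<infinity>" .
    qed simp
    then show ?thesis by (simp add: M_def[abs_def])
  qed
  have dom: "(cmod (K w \<xi>))\<^sup>2 \<le> M \<xi>" if w: "w \<in> cball z r" and x: "\<xi> \<in> \<Omega>" for w \<xi>
  proof -
    have "ennreal ((cmod (K w \<xi>))\<^sup>2) * emeasure lborel (ball w r) \<le> (\<integral>\<^sup>+u\<in>ball w r. ennreal ((cmod (K u \<xi>))\<^sup>2) \<partial>lborel)"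
      by (rule holomorphic_Cn_sub_mean[OF K_holomorphic[OF x]]) (use b2[OF w] b3 in blast)
    also have "\<dots> \<le> m \<xi>"
      unfolding m_def k_def using b2[OF w] by (intro nn_integral_mono) (auto simp: indicator_def)
    also have "m \<xi> = ennreal (enn2real (m \<xi>))" using mreal[OF x] by simp
    also have "emeasure lborel (ball w r) = ennreal c"
      using emeasure_lborel_ball_finite[of w r] r by (simp add: emeasure_eq_ennreal_measure c_def content_ball)
    finally have "(cmod (K w \<xi>))\<^sup>2 * c \<le> enn2real (m \<xi>)"
      using c by (simp add: ennreal_mult[symmetric])
    then show ?thesis using c by (simp add: M_def pos_le_divide_eq)
  qed
  have "cball z r \<subseteq> \<Omega>" using b3 r by (auto simp: subset_iff)
  then show ?thesis using that r Mint dom by blast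
qed

end

section \<open>Wirtinger calculus and differentiation under the integral sign\<close>

text \<open>The Taylor remainder tends to 0 in the mean, not only after integration. This form
  serves both differentiation under the integral and Frechet differentiability in total
  variation.\<close>

lemma L1_derivative:
  fixes f :: "'a::euclidean_space \<Rightarrow> 'x \<Rightarrow> 'b::{banach, second_countable_topology}"
  assumes "r > 0"
    and der: "\<And>w \<xi>. w \<in> ball z r \<Longrightarrow> \<xi> \<in> space M \<Longrightarrow> ((\<lambda>w. f w \<xi>) has_derivative f' w \<xi>) (at w)"
    and bnd: "\<And>w \<xi> v. w \<in> ball z r \<Longrightarrow> \<xi> \<in> space M \<Longrightarrow> norm (f' w \<xi> v) \<le> C \<xi> * norm v"
    and C: "integrable M C"
    and mf: "\<And>w. w \<in> ball z r \<Longrightarrow> f w \<in> borel_measurable M"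
    and mf': "\<And>v. (\<lambda>\<xi>. f' z \<xi> v) \<in> borel_measurable M"
  shows "((\<lambda>h. (\<integral>\<xi>. norm (f (z + h) \<xi> - f z \<xi> - f' z \<xi> h) \<partial>M) / norm h) \<longlongrightarrow> 0) (at 0)"
  unfolding tendsto_at_iff_sequentially
proof (intro allI impI)
  fix X :: "nat \<Rightarrow> 'a" assume X: "\<forall>i. X i \<in> UNIV - {0}" "X \<longlonglongrightarrow> 0"
  obtain N where N: "\<And>i. i \<ge> N \<Longrightarrow> norm (X i) < r"
    using LIMSEQ_D[OF X(2) \<open>r > 0\<close>] by auto
  define h where "h i = X (i + N)" for i
  have h: "norm (h i) < r" "h i \<noteq> 0" for i using N[of "i + N"] X(1) by (auto simp: h_def)
  have h0: "h \<longlonglongrightarrow> 0" unfolding h_def using X(2) by (rule LIMSEQ_ignore_initial_segment)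
  have zh: "z + h i \<in> ball z r" for i using h(1)[of i] by (simp add: dist_norm)
  have zb: "z \<in> ball z r" using \<open>r > 0\<close> by simp
  let ?g = "\<lambda>i \<xi>. norm (f (z + h i) \<xi> - f z \<xi> - f' z \<xi> (h i)) / norm (h i)"
  have "(\<lambda>i. \<integral>\<xi>. ?g i \<xi> \<partial>M) \<longlonglongrightarrow> (\<integral>\<xi>. 0 \<partial>M)"
  \<comment> \<open>One \<open>C\<close> bounds the increment by the mean value inequality, the
    other the linear term.\<close>
  proof (rule integral_dominated_convergence[where w = "\<lambda>\<xi>. 2 * C \<xi>"])
    show "integrable M (\<lambda>\<xi>. 2 * C \<xi>)" using C by simp
    show "?g i \<in> borel_measurable M" for i
      using mf[OF zh[of i]] mf[OF zb] mf'[of "h i"] by measurable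
    show "AE \<xi> in M. (\<lambda>i. ?g i \<xi>) \<longlonglongrightarrow> 0"
    proof (rule AE_I2)
      fix \<xi> assume x: "\<xi> \<in> space M"
      have "((\<lambda>v. norm (f (z + v) \<xi> - f z \<xi> - f' z \<xi> v) / norm v) \<longlongrightarrow> 0) (at 0)"
        using der[OF zb x] unfolding has_derivative_at by simp
      then show "(\<lambda>i. ?g i \<xi>) \<longlonglongrightarrow> 0"
        unfolding tendsto_at_iff_sequentially using h(2) h0 by (auto simp: o_def)
    qed
    show "AE \<xi> in M. norm (?g i \<xi>) \<le> 2 * C \<xi>" for i
    proof (rule AE_I2)
      fix \<xi> assume x: "\<xi> \<in> space M"
      have "norm (f (z + h i) \<xi> - f z \<xi>) \<le> C \<xi> * norm ((z + h i) - z)"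
      proof (rule differentiable_bound[where S = "ball z r" and f' = "\<lambda>w. f' w \<xi>"])
        show "((\<lambda>w. f w \<xi>) has_derivative f' w \<xi>) (at w within ball z r)" if "w \<in> ball z r" for w
          using der[OF that x] has_derivative_at_withinI by blast
        show "onorm (f' w \<xi>) \<le> C \<xi>" if "w \<in> ball z r" for w
          by (rule onorm_le) (rule bnd[OF that x])
      qed (use zh zb in auto)
      moreover have "norm (f' z \<xi> (h i)) \<le> C \<xi> * norm (h i)" by (rule bnd[OF zb x])
      moreover have "norm (f (z + h i) \<xi> - f z \<xi> - f' z \<xi> (h i))
          \<le> norm (f (z + h i) \<xi> - f z \<xi>) + norm (f' z \<xi> (h i))" by (rule norm_triangle_ineq4)
      ultimately have "norm (f (z + h i) \<xi> - f z \<xi> - f' z \<xi> (h i)) \<le> 2 * C \<xi> * norm (h i)" by simp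
      then show "norm (?g i \<xi>) \<le> 2 * C \<xi>" using h(2)[of i] by (simp add: pos_divide_le_eq)
    qed
  qed simp
  then have "(\<lambda>i. (\<integral>\<xi>. norm (f (z + h i) \<xi> - f z \<xi> - f' z \<xi> (h i)) \<partial>M) / norm (h i)) \<longlonglongrightarrow> 0"
    by simp
  then show "((\<lambda>h. (\<integral>\<xi>. norm (f (z + h) \<xi> - f z \<xi> - f' z \<xi> h) \<partial>M) / norm h) \<circ> X) \<longlonglongrightarrow> 0"
    unfolding h_def o_def by (rule LIMSEQ_offset)
qed

lemma dominated_increment_integrable:
  fixes f :: "'a::euclidean_space \<Rightarrow> 'x \<Rightarrow> 'b::{banach, second_countable_topology}"
  assumes der: "\<And>w \<xi>. w \<in> ball z r \<Longrightarrow> \<xi> \<in> space M \<Longrightarrow> ((\<lambda>w. f w \<xi>) has_derivative f' w \<xi>) (at w)"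
    and bnd: "\<And>w \<xi> v. w \<in> ball z r \<Longrightarrow> \<xi> \<in> space M \<Longrightarrow> norm (f' w \<xi> v) \<le> C \<xi> * norm v"
    and C: "integrable M C"
    and mf: "\<And>w. w \<in> ball z r \<Longrightarrow> f w \<in> borel_measurable M"
    and fz: "integrable M (f z)" and w: "w \<in> ball z r"
  shows "integrable M (f w)"
proof (rule Bochner_Integration.integrable_bound)
  have zb: "z \<in> ball z r" using w by (metis centre_in_ball mem_ball dist_not_less_zero less_le_trans not_le)
  show "integrable M (\<lambda>\<xi>. norm (f z \<xi>) + C \<xi> * norm (w - z))" using fz C by simp
  show "AE \<xi> in M. norm (f w \<xi>) \<le> norm (norm (f z \<xi>) + C \<xi> * norm (w - z))"
  proof (rule AE_I2)
    fix \<xi> assume x: "\<xi> \<in> space M"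
    have "norm (f w \<xi> - f z \<xi>) \<le> C \<xi> * norm (w - z)"
    proof (rule differentiable_bound[where S = "ball z r" and f' = "\<lambda>w. f' w \<xi>"])
      show "((\<lambda>w. f w \<xi>) has_derivative f' w \<xi>) (at w within ball z r)" if "w \<in> ball z r" for w
        using der[OF that x] has_derivative_at_withinI by blast
      show "onorm (f' w \<xi>) \<le> C \<xi>" if "w \<in> ball z r" for w
        by (rule onorm_le) (rule bnd[OF that x])
    qed (use w zb in auto)
    then show "norm (f w \<xi>) \<le> norm (norm (f z \<xi>) + C \<xi> * norm (w - z))"
      using norm_triangle_ineq2[of "f w \<xi>" "f z \<xi>"] by simp
  qed
qed (rule mf[OF w])

lemma has_derivative_integral:
  fixes f :: "'a::euclidean_space \<Rightarrow> 'x \<Rightarrow> 'b::{banach, second_countable_topology}"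
  assumes "r > 0"
    and der: "\<And>w \<xi>. w \<in> ball z r \<Longrightarrow> \<xi> \<in> space M \<Longrightarrow> ((\<lambda>w. f w \<xi>) has_derivative f' w \<xi>) (at w)"
    and bnd: "\<And>w \<xi> v. w \<in> ball z r \<Longrightarrow> \<xi> \<in> space M \<Longrightarrow> norm (f' w \<xi> v) \<le> C \<xi> * norm v"
    and C: "integrable M C"
    and mf: "\<And>w. w \<in> ball z r \<Longrightarrow> f w \<in> borel_measurable M"
    and mf': "\<And>v. (\<lambda>\<xi>. f' z \<xi> v) \<in> borel_measurable M"
    and fz: "integrable M (f z)"
  shows "((\<lambda>w. \<integral>\<xi>. f w \<xi> \<partial>M) has_derivative (\<lambda>v. \<integral>\<xi>. f' z \<xi> v \<partial>M)) (at z)"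
proof -
  have zb: "z \<in> ball z r" using \<open>r > 0\<close> by simp
  have fw: "integrable M (f w)" if "w \<in> ball z r" for w
    using dominated_increment_integrable[OF der bnd C mf fz that] .
  have f'i: "integrable M (\<lambda>\<xi>. f' z \<xi> v)" for v
  proof (rule Bochner_Integration.integrable_bound)
    show "integrable M (\<lambda>\<xi>. C \<xi> * norm v)" using C by simp
    show "AE \<xi> in M. norm (f' z \<xi> v) \<le> norm (C \<xi> * norm v)"
      using bnd[OF zb] by (intro AE_I2) (metis abs_ge_self order_trans real_norm_def)
  qed (rule mf')
  have blin: "bounded_linear (f' z \<xi>)" if "\<xi> \<in> space M" for \<xi>
    using der[OF zb that] has_derivative_bounded_linear by blast
  have bl: "bounded_linear (\<lambda>v. \<integral>\<xi>. f' z \<xi> v \<partial>M)"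
  proof (rule bounded_linear_intro[where K = "\<integral>\<xi>. C \<xi> \<partial>M"])
    fix v w :: 'a and c :: real
    have "(\<integral>\<xi>. f' z \<xi> (v + w) \<partial>M) = (\<integral>\<xi>. f' z \<xi> v + f' z \<xi> w \<partial>M)"
      using blin by (intro Bochner_Integration.integral_cong) (auto simp: linear_simps)
    then show "(\<integral>\<xi>. f' z \<xi> (v + w) \<partial>M) = (\<integral>\<xi>. f' z \<xi> v \<partial>M) + (\<integral>\<xi>. f' z \<xi> w \<partial>M)"
      by (simp add: f'i)
    have "(\<integral>\<xi>. f' z \<xi> (c *\<^sub>R v) \<partial>M) = (\<integral>\<xi>. c *\<^sub>R f' z \<xi> v \<partial>M)"
      using blin by (intro Bochner_Integration.integral_cong) (auto simp: linear_simps)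
    then show "(\<integral>\<xi>. f' z \<xi> (c *\<^sub>R v) \<partial>M) = c *\<^sub>R (\<integral>\<xi>. f' z \<xi> v \<partial>M)" by simp
    have "norm (\<integral>\<xi>. f' z \<xi> v \<partial>M) \<le> (\<integral>\<xi>. C \<xi> * norm v \<partial>M)"
    proof (rule order_trans[OF integral_norm_bound integral_mono])
      show "integrable M (\<lambda>\<xi>. norm (f' z \<xi> v))" "integrable M (\<lambda>\<xi>. C \<xi> * norm v)" using f'i[of v] C by auto
    qed (rule bnd[OF zb])
    then show "norm (\<integral>\<xi>. f' z \<xi> v \<partial>M) \<le> norm v * (\<integral>\<xi>. C \<xi> \<partial>M)" by (simp add: mult.commute)
  qed
  have lim: "((\<lambda>h. (\<integral>\<xi>. norm (f (z + h) \<xi> - f z \<xi> - f' z \<xi> h) \<partial>M) / norm h) \<longlongrightarrow> 0) (at 0)"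
    by (rule L1_derivative[OF \<open>r > 0\<close> der bnd C mf mf'])
  have "((\<lambda>h. norm ((\<integral>\<xi>. f (z + h) \<xi> \<partial>M) - (\<integral>\<xi>. f z \<xi> \<partial>M) - (\<integral>\<xi>. f' z \<xi> h \<partial>M)) / norm h) \<longlongrightarrow> 0) (at 0)"
  proof (rule Lim_null_comparison[OF _ lim])
    have "\<forall>\<^sub>F h in at 0. h \<in> ball (0::'a) r"
      using \<open>r > 0\<close> by (intro eventually_at_in_open') auto
    then show "\<forall>\<^sub>F h in at 0. norm (norm ((\<integral>\<xi>. f (z + h) \<xi> \<partial>M) - (\<integral>\<xi>. f z \<xi> \<partial>M) - (\<integral>\<xi>. f' z \<xi> h \<partial>M)) / norm h)
        \<le> (\<integral>\<xi>. norm (f (z + h) \<xi> - f z \<xi> - f' z \<xi> h) \<partial>M) / norm h"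
    proof (rule eventually_mono)
      fix h :: 'a assume "h \<in> ball 0 r"
      then have "z + h \<in> ball z r" by (simp add: dist_norm)
      then have "(\<integral>\<xi>. f (z + h) \<xi> \<partial>M) - (\<integral>\<xi>. f z \<xi> \<partial>M) - (\<integral>\<xi>. f' z \<xi> h \<partial>M)
          = (\<integral>\<xi>. f (z + h) \<xi> - f z \<xi> - f' z \<xi> h \<partial>M)"
        using fw fz f'i by simp
      then show "norm (norm ((\<integral>\<xi>. f (z + h) \<xi> \<partial>M) - (\<integral>\<xi>. f z \<xi> \<partial>M) - (\<integral>\<xi>. f' z \<xi> h \<partial>M)) / norm h)
        \<le> (\<integral>\<xi>. norm (f (z + h) \<xi> - f z \<xi> - f' z \<xi> h) \<partial>M) / norm h"
        by (simp add: divide_right_mono)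
    qed
  qed
  with bl show ?thesis unfolding has_derivative_at by simp
qed

section \<open>Rules for the Wirtinger operators\<close>

lemma wirt_eq: "(f has_derivative D) (at z) \<Longrightarrow> wirt \<alpha> f z = (D (axis \<alpha> 1) - \<i> * D (axis \<alpha> \<i>)) / 2"
  and wirt_bar_eq: "(f has_derivative D) (at z) \<Longrightarrow> wirt_bar \<alpha> f z = (D (axis \<alpha> 1) + \<i> * D (axis \<alpha> \<i>)) / 2"
  unfolding wirt_def wirt_bar_def using frechet_derivative_at by metis+

text \<open>\<open>frechet_derivative\<close> is a choice from the set of derivatives, and locally
  equal functions have the same such set.\<close>

lemma frechet_derivative_cong_open:
  assumes "open S" "z \<in> S" "\<And>w. w \<in> S \<Longrightarrow> f w = g w"
  shows "frechet_derivative f (at z) = frechet_derivative g (at z)"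
proof -
  have "(f has_derivative D) (at z) \<longleftrightarrow> (g has_derivative D) (at z)" for D
    using has_derivative_transform_within_open[of f D z UNIV S g] has_derivative_transform_within_open[of g D z UNIV S f] assms
    by auto
  then show ?thesis by (simp add: frechet_derivative_def)
qed

lemma wirt_cong_open:
  assumes "open S" "z \<in> S" "\<And>w. w \<in> S \<Longrightarrow> f w = g w"
  shows "wirt \<alpha> f z = wirt \<alpha> g z" "wirt_bar \<alpha> f z = wirt_bar \<alpha> g z"
  unfolding wirt_def wirt_bar_def using frechet_derivative_cong_open[OF assms] by auto

lemma wirt_add:
  assumes "f differentiable (at z)" "g differentiable (at z)"
  shows "wirt \<alpha> (\<lambda>w. f w + g w) z = wirt \<alpha> f z + wirt \<alpha> g z"
    "wirt_bar \<alpha> (\<lambda>w. f w + g w) z = wirt_bar \<alpha> f z + wirt_bar \<alpha> g z"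
  by (subst wirt_eq[OF has_derivative_add[OF assms[unfolded frechet_derivative_works]]], simp add: wirt_def wirt_bar_def field_simps)
     (subst wirt_bar_eq[OF has_derivative_add[OF assms[unfolded frechet_derivative_works]]], simp add: wirt_def wirt_bar_def field_simps)

lemma wirt_diff:
  assumes "f differentiable (at z)" "g differentiable (at z)"
  shows "wirt \<alpha> (\<lambda>w. f w - g w) z = wirt \<alpha> f z - wirt \<alpha> g z"
    "wirt_bar \<alpha> (\<lambda>w. f w - g w) z = wirt_bar \<alpha> f z - wirt_bar \<alpha> g z"
  by (subst wirt_eq[OF has_derivative_diff[OF assms[unfolded frechet_derivative_works]]], simp add: wirt_def wirt_bar_def field_simps)
     (subst wirt_bar_eq[OF has_derivative_diff[OF assms[unfolded frechet_derivative_works]]], simp add: wirt_def wirt_bar_def field_simps)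

lemma wirt_mult:
  assumes "f differentiable (at z)" "g differentiable (at z)"
  shows "wirt \<alpha> (\<lambda>w. f w * g w) z = wirt \<alpha> f z * g z + f z * wirt \<alpha> g z"
    "wirt_bar \<alpha> (\<lambda>w. f w * g w) z = wirt_bar \<alpha> f z * g z + f z * wirt_bar \<alpha> g z"
  by (subst wirt_eq[OF has_derivative_mult[OF assms[unfolded frechet_derivative_works]]], simp add: wirt_def wirt_bar_def field_simps)
     (subst wirt_bar_eq[OF has_derivative_mult[OF assms[unfolded frechet_derivative_works]]], simp add: wirt_def wirt_bar_def field_simps)

lemma wirt_divide:
  assumes "f differentiable (at z)" "g differentiable (at z)" "g z \<noteq> 0"
  shows "wirt \<alpha> (\<lambda>w. f w / g w) z = wirt \<alpha> f z / g z - f z / g z * (wirt \<alpha> g z / g z)"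
    "wirt_bar \<alpha> (\<lambda>w. f w / g w) z = wirt_bar \<alpha> f z / g z - f z / g z * (wirt_bar \<alpha> g z / g z)"
  by (subst wirt_eq[OF has_derivative_divide'[OF assms(1,2)[unfolded frechet_derivative_works] assms(3)]], simp add: wirt_def wirt_bar_def field_simps assms(3))
     (subst wirt_bar_eq[OF has_derivative_divide'[OF assms(1,2)[unfolded frechet_derivative_works] assms(3)]], simp add: wirt_def wirt_bar_def field_simps assms(3))

lemma axis_smult_ii: "axis \<alpha> \<i> = \<i> *s axis \<alpha> (1::complex)"
  by (simp add: vec_eq_iff axis_def)

lemma wirt_holomorphic:
  assumes "holomorphic_Cn f \<Omega>" "z \<in> \<Omega>"
  shows "wirt \<alpha> f z = frechet_derivative f (at z) (axis \<alpha> 1)" "wirt_bar \<alpha> f z = 0"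
  unfolding wirt_def wirt_bar_def axis_smult_ii holomorphic_Cn_frechet(2)[OF assms] by simp_all

text \<open>Off its zeros, \<open>log |f|\<^sup>2 = log f + log (cnj f)\<close> locally.\<close>

lemma has_derivative_ln_norm_sq:
  fixes f :: "'a::real_normed_vector \<Rightarrow> complex"
  assumes "(f has_derivative D) (at z)" "f z \<noteq> 0"
  shows "((\<lambda>w. complex_of_real (ln ((cmod (f w))\<^sup>2))) has_derivative (\<lambda>v. D v / f z + cnj (D v / f z))) (at z)"
proof -
  have "((\<lambda>w. f w \<bullet> f w) has_derivative (\<lambda>v. f z \<bullet> D v + D v \<bullet> f z)) (at z)"
    by (rule has_derivative_inner[OF assms(1) assms(1)])
  then have "((\<lambda>w. (cmod (f w))\<^sup>2) has_derivative (\<lambda>v. f z \<bullet> D v + D v \<bullet> f z)) (at z)"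
    by (simp add: power2_norm_eq_inner)
  from has_derivative_ln[OF _ this]
  have "((\<lambda>w. ln ((cmod (f w))\<^sup>2)) has_derivative (\<lambda>v. (f z \<bullet> D v + D v \<bullet> f z) * inverse ((cmod (f z))\<^sup>2))) (at z)"
    using assms(2) by simp
  then have "((\<lambda>w. complex_of_real (ln ((cmod (f w))\<^sup>2))) has_derivative
      (\<lambda>v. complex_of_real ((f z \<bullet> D v + D v \<bullet> f z) * inverse ((cmod (f z))\<^sup>2)))) (at z)"
    by (rule has_derivative_of_real)
  moreover have "complex_of_real ((f z \<bullet> D v + D v \<bullet> f z) * inverse ((cmod (f z))\<^sup>2)) = D v / f z + cnj (D v / f z)" for v
  proof -
    have "complex_of_real (f z \<bullet> D v + D v \<bullet> f z) = D v * cnj (f z) + cnj (D v) * f z"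
      by (simp add: complex_eq_iff inner_complex_def)
    moreover have "complex_of_real ((cmod (f z))\<^sup>2) = f z * cnj (f z)" by (rule complex_norm_square)
    ultimately show ?thesis using assms(2) by (simp only: of_real_mult of_real_inverse) (simp add: field_simps)
  qed
  ultimately show ?thesis by simp
qed

lemma has_derivative_ln_Re:
  fixes f :: "'a::real_normed_vector \<Rightarrow> complex"
  assumes f: "(f has_derivative D) (at z)" and S: "open S" "z \<in> S" "\<And>w. w \<in> S \<Longrightarrow> Im (f w) = 0"
    and pos: "Re (f z) > 0"
  shows "((\<lambda>w. complex_of_real (ln (Re (f w)))) has_derivative (\<lambda>v. D v / f z)) (at z)"
proof -
  have "((\<lambda>w. Re (f w)) has_derivative (\<lambda>v. Re (D v))) (at z)" by (rule has_derivative_Re[OF f])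
  from has_derivative_ln[OF pos this]
  have "((\<lambda>w. ln (Re (f w))) has_derivative (\<lambda>v. Re (D v) * inverse (Re (f z)))) (at z)" .
  then have "((\<lambda>w. complex_of_real (ln (Re (f w)))) has_derivative (\<lambda>v. complex_of_real (Re (D v) * inverse (Re (f z))))) (at z)"
    by (rule has_derivative_of_real)
  moreover have "complex_of_real (Re (D v) * inverse (Re (f z))) = D v / f z" for v
  proof -
    have "((\<lambda>w. Im (f w)) has_derivative (\<lambda>v. Im (D v))) (at z)" by (rule has_derivative_Im[OF f])
    moreover have "((\<lambda>w. Im (f w)) has_derivative (\<lambda>v. 0)) (at z)"
      by (rule has_derivative_transform_within_open[OF has_derivative_const[of 0] S(1,2)]) (simp add: S(3))
    ultimately have "(\<lambda>v. Im (D v)) = (\<lambda>v. 0)" by (rule has_derivative_unique)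
    then have "Im (D v) = 0" by metis
    then have "D v = of_real (Re (D v))" "f z = of_real (Re (f z))" using S by (auto simp: complex_eq_iff)
    then show ?thesis by (metis divide_inverse of_real_inverse of_real_mult)
  qed
  ultimately show ?thesis by simp
qed

section \<open>Dominated kernels and their Gram functions\<close>

context bergman_domain
begin

text \<open>Kernels whose pairings may be differentiated under the integral any number of times: the
  class contains \<open>K\<close> and is stable under derivatives in \<open>z\<close>. The bound is
  on squares because integrands are products of two such kernels.\<close>

definition dominated_kernel :: "(complex^'n \<Rightarrow> complex^'n \<Rightarrow> complex) \<Rightarrow> bool" where
  "dominated_kernel H \<longleftrightarrow> (\<forall>\<xi>\<in>\<Omega>. holomorphic_Cn (\<lambda>z. H z \<xi>) \<Omega>) \<and> (\<forall>z\<in>\<Omega>. H z \<in> borel_measurable \<mu>)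
     \<and> (\<forall>z\<in>\<Omega>. \<exists>r>0. \<exists>M. cball z r \<subseteq> \<Omega> \<and> integrable \<mu> M
          \<and> (\<forall>w\<in>cball z r. \<forall>\<xi>\<in>\<Omega>. (cmod (H w \<xi>))\<^sup>2 \<le> M \<xi>))"

lemma dominated_kernelD:
  assumes "dominated_kernel H"
  shows "\<xi> \<in> \<Omega> \<Longrightarrow> holomorphic_Cn (\<lambda>z. H z \<xi>) \<Omega>" "z \<in> \<Omega> \<Longrightarrow> H z \<in> borel_measurable \<mu>"
  using assms unfolding dominated_kernel_def by blast+

lemma dominated_kernel_bound:
  assumes H: "dominated_kernel H" and z: "z \<in> \<Omega>"
  obtains r M where "r > 0" "cball z r \<subseteq> \<Omega>" "integrable \<mu> M"
    "\<And>w \<xi>. w \<in> cball z r \<Longrightarrow> \<xi> \<in> \<Omega> \<Longrightarrow> (cmod (H w \<xi>))\<^sup>2 \<le> M \<xi>"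
  using assms unfolding dominated_kernel_def by blast

lemma dominated_kernel_K: "dominated_kernel K"
  unfolding dominated_kernel_def
proof (intro conjI ballI)
  fix z assume z: "z \<in> \<Omega>"
  show "holomorphic_Cn (\<lambda>w. K w z) \<Omega>" by (rule K_holomorphic[OF z])
  show "K z \<in> borel_measurable \<mu>" by (rule sq_intD(1)[OF K_sq_int[OF z]])
  obtain r M where "r > 0" "cball z r \<subseteq> \<Omega>" "integrable \<mu> M"
    "\<And>w \<xi>. w \<in> cball z r \<Longrightarrow> \<xi> \<in> \<Omega> \<Longrightarrow> (cmod (K w \<xi>))\<^sup>2 \<le> M \<xi>"
    by (rule K_locally_dominated[OF z]) (blast intro: that)
  then show "\<exists>r>0. \<exists>M. cball z r \<subseteq> \<Omega> \<and> integrable \<mu> M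
          \<and> (\<forall>w\<in>cball z r. \<forall>\<xi>\<in>\<Omega>. (cmod (K w \<xi>))\<^sup>2 \<le> M \<xi>)" by blast
qed

text \<open>One function serves the kernel and its derivatives: in the factor
  \<open>1 + 1 / r^2\<close> the first term covers \<open>H\<close> and the second is the Cauchy
  estimate on balls of radius \<open>r\<close>, half the original radius.\<close>

lemma dominated_kernel_deriv_bound:
  assumes H: "dominated_kernel H" and z: "z \<in> \<Omega>"
  obtains r M where "r > 0" "cball z r \<subseteq> \<Omega>" "integrable \<mu> M"
    "\<And>w \<xi>. w \<in> cball z r \<Longrightarrow> \<xi> \<in> \<Omega> \<Longrightarrow> (cmod (H w \<xi>))\<^sup>2 \<le> M \<xi>"
    "\<And>w \<xi> v. w \<in> cball z r \<Longrightarrow> \<xi> \<in> \<Omega> \<Longrightarrow> (cmod (frechet_derivative (\<lambda>w. H w \<xi>) (at w) v))\<^sup>2 \<le> M \<xi> * (norm v)\<^sup>2"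
proof -
  obtain R M where R: "R > 0" "cball z R \<subseteq> \<Omega>" "integrable \<mu> M"
    and M: "\<And>w \<xi>. w \<in> cball z R \<Longrightarrow> \<xi> \<in> \<Omega> \<Longrightarrow> (cmod (H w \<xi>))\<^sup>2 \<le> M \<xi>"
    by (rule dominated_kernel_bound[OF assms]) (blast intro: that)
  define r where "r = R / 2"
  have r: "r > 0" using R by (simp add: r_def)
  define M' where "M' = (\<lambda>\<xi>. M \<xi> * (1 + 1 / r\<^sup>2))"
  have M0: "M \<xi> \<ge> 0" if "\<xi> \<in> \<Omega>" for \<xi>
    by (rule order_trans[OF zero_le_power2 M[of z]]) (use R(1) that in auto)
  show ?thesis
  proof (rule that[OF r])
    show "cball z r \<subseteq> \<Omega>" using subset_cball[of r R z] R by (auto simp: r_def)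
    show "integrable \<mu> M'" unfolding M'_def using R by simp
    show "(cmod (H w \<xi>))\<^sup>2 \<le> M' \<xi>" if w: "w \<in> cball z r" and x: "\<xi> \<in> \<Omega>" for w \<xi>
    proof -
      have "(cmod (H w \<xi>))\<^sup>2 \<le> M \<xi>" using w R(1) x by (intro M) (auto simp: r_def)
      also have "\<dots> \<le> M' \<xi>" using M0[OF x] by (simp add: M'_def distrib_left)
      finally show ?thesis .
    qed
    show "(cmod (frechet_derivative (\<lambda>w. H w \<xi>) (at w) v))\<^sup>2 \<le> M' \<xi> * (norm v)\<^sup>2"
      if w: "w \<in> cball z r" and x: "\<xi> \<in> \<Omega>" for w \<xi> v
    proof -
      have sub: "cball w r \<subseteq> cball z R"
      proof
        fix y assume "y \<in> cball w r"
        then show "y \<in> cball z R" using w dist_triangle[of z y w] by (simp add: r_def)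
      qed
      have "cmod (frechet_derivative (\<lambda>w. H w \<xi>) (at w) v) \<le> sqrt (M \<xi>) / r * norm v"
      proof (rule holomorphic_Cn_Cauchy_estimate[OF dominated_kernelD(1)[OF H x] _ r])
        show "cball w r \<subseteq> \<Omega>" using sub R by blast
        show "cmod (H y \<xi>) \<le> sqrt (M \<xi>)" if "y \<in> cball w r" for y
          using M[of y \<xi>] that sub x by (intro real_le_rsqrt) blast
      qed
      then have "(cmod (frechet_derivative (\<lambda>w. H w \<xi>) (at w) v))\<^sup>2 \<le> (sqrt (M \<xi>) / r * norm v)\<^sup>2"
        by (intro power_mono) auto
      also have "\<dots> = M \<xi> * (1 / r\<^sup>2) * (norm v)\<^sup>2"
        using M0[OF x] by (simp add: power_mult_distrib power_divide)
      also have "\<dots> \<le> M' \<xi> * (norm v)\<^sup>2"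
        using M0[OF x] by (intro mult_right_mono) (auto simp: M'_def distrib_left)
      finally show ?thesis .
    qed
  qed
qed

definition dir_deriv :: "complex^'n \<Rightarrow> (complex^'n \<Rightarrow> complex^'n \<Rightarrow> complex) \<Rightarrow> complex^'n \<Rightarrow> complex^'n \<Rightarrow> complex" where
  "dir_deriv v H z \<xi> = frechet_derivative (\<lambda>w. H w \<xi>) (at z) v"

lemma dominated_kernel_dir_deriv:
  assumes H: "dominated_kernel H" shows "dominated_kernel (dir_deriv v H)"
  unfolding dominated_kernel_def
proof (intro conjI ballI)
  fix z assume z: "z \<in> \<Omega>"
  show "holomorphic_Cn (\<lambda>w. dir_deriv v H w z) \<Omega>"
    unfolding dir_deriv_def by (rule holomorphic_Cn_directional_derivative[OF dominated_kernelD(1)[OF H z] open_dom])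
  obtain r M where r: "r > 0" "cball z r \<subseteq> \<Omega>" "integrable \<mu> M"
    and "\<And>w \<xi>. w \<in> cball z r \<Longrightarrow> \<xi> \<in> \<Omega> \<Longrightarrow> (cmod (H w \<xi>))\<^sup>2 \<le> M \<xi>"
    and M: "\<And>w \<xi> v. w \<in> cball z r \<Longrightarrow> \<xi> \<in> \<Omega> \<Longrightarrow> (cmod (frechet_derivative (\<lambda>w. H w \<xi>) (at w) v))\<^sup>2 \<le> M \<xi> * (norm v)\<^sup>2"
    by (rule dominated_kernel_deriv_bound[OF H z]) (blast intro: that)
  show "\<exists>r>0. \<exists>M. cball z r \<subseteq> \<Omega> \<and> integrable \<mu> M \<and> (\<forall>w\<in>cball z r. \<forall>\<xi>\<in>\<Omega>. (cmod (dir_deriv v H w \<xi>))\<^sup>2 \<le> M \<xi>)"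
    using r M unfolding dir_deriv_def by (intro exI[of _ r] conjI exI[of _ "\<lambda>\<xi>. M \<xi> * (norm v)\<^sup>2"]) auto
  \<comment> \<open>Keeps all points \<open>z + t n *s v\<close> with \<open>t n <= d\<close> inside
    \<open>cball z r\<close>.\<close>
  define d where "d = r / (norm v + 1)"
  have d: "d > 0" "d * norm v < r" using r by (auto simp: d_def divide_simps add_nonneg_pos)
  define t where "t n = d * inverse (real (Suc n))" for n
  have t: "t n > 0" "t n \<le> d" for n
    using d by (auto simp: t_def field_simps)
  have tlim: "t \<longlonglongrightarrow> 0" unfolding t_def by (rule tendsto_mult_right_zero[OF LIMSEQ_inverse_real_of_nat])
  have inO: "z + of_real (t n) *s v \<in> \<Omega>" for n
  proof -
    have "t n * norm v \<le> d * norm v" using t[of n] by (intro mult_right_mono) auto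
    then have "z + of_real (t n) *s v \<in> cball z r" using d t[of n] by (simp add: dist_norm norm_vector_smult)
    then show ?thesis using r by blast
  qed
  \<comment> \<open>Measurability in \<open>\<xi>\<close> is inherited by the derivative as a
    pointwise limit of difference quotients along the sequence \<open>t\<close>.\<close>
  show "dir_deriv v H z \<in> borel_measurable \<mu>"
  proof (rule borel_measurable_LIMSEQ_metric)
    show "(\<lambda>\<xi>. (H (z + of_real (t n) *s v) \<xi> - H z \<xi>) / of_real (t n)) \<in> borel_measurable \<mu>" for n
      using dominated_kernelD(2)[OF H inO[of n]] dominated_kernelD(2)[OF H z] by measurable
    fix \<xi> assume "\<xi> \<in> space \<mu>"
    then have x: "\<xi> \<in> \<Omega>" by simp
    have "((\<lambda>\<zeta>. H (z + \<zeta> *s v) \<xi>) has_field_derivative dir_deriv v H z \<xi>) (at 0)"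
      using holomorphic_Cn_line_deriv[OF dominated_kernelD(1)[OF H x], of z 0 v] z by (simp add: dir_deriv_def)
    then have "((\<lambda>h. (H (z + h *s v) \<xi> - H z \<xi>) / h) \<longlongrightarrow> dir_deriv v H z \<xi>) (at 0)"
      by (simp add: DERIV_def)
    moreover have "filterlim (\<lambda>n. complex_of_real (t n)) (at 0) sequentially"
      unfolding filterlim_at using tendsto_of_real[OF tlim, where 'a = complex] t(1)
      by (auto intro!: always_eventually simp: less_imp_neq[symmetric])
    ultimately show "(\<lambda>n. (H (z + of_real (t n) *s v) \<xi> - H z \<xi>) / of_real (t n)) \<longlonglongrightarrow> dir_deriv v H z \<xi>"
      by (rule filterlim_compose)
  qed
qed

lemma dominated_kernel_sq_int:
  assumes "dominated_kernel H" "z \<in> \<Omega>" shows "H z \<in> sq_int \<mu>"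
proof -
  obtain r M where r: "r > 0" "integrable \<mu> M"
    and M: "\<And>w \<xi>. w \<in> cball z r \<Longrightarrow> \<xi> \<in> \<Omega> \<Longrightarrow> (cmod (H w \<xi>))\<^sup>2 \<le> M \<xi>"
    by (rule dominated_kernel_bound[OF assms]) (blast intro: that)
  show ?thesis
    by (rule sq_int_boundI[OF dominated_kernelD(2)[OF assms] r(2)], rule AE_I2) (use M r in simp)
qed

lemma has_derivative_gram:
  assumes H: "dominated_kernel H" "dominated_kernel G" and z: "z \<in> \<Omega>"
  shows "((\<lambda>w. ip (H w) (G w)) has_derivative (\<lambda>v. ip (dir_deriv v H z) (G z) + ip (H z) (dir_deriv v G z))) (at z)"
proof -
  obtain r1 M1 where 1: "r1 > 0" "cball z r1 \<subseteq> \<Omega>" "integrable \<mu> M1"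
    "\<And>w \<xi>. w \<in> cball z r1 \<Longrightarrow> \<xi> \<in> \<Omega> \<Longrightarrow> (cmod (H w \<xi>))\<^sup>2 \<le> M1 \<xi>"
    "\<And>w \<xi> v. w \<in> cball z r1 \<Longrightarrow> \<xi> \<in> \<Omega> \<Longrightarrow> (cmod (dir_deriv v H w \<xi>))\<^sup>2 \<le> M1 \<xi> * (norm v)\<^sup>2"
    unfolding dir_deriv_def by (rule dominated_kernel_deriv_bound[OF H(1) z]) (blast intro: that)
  obtain r2 M2 where 2: "r2 > 0" "cball z r2 \<subseteq> \<Omega>" "integrable \<mu> M2"
    "\<And>w \<xi>. w \<in> cball z r2 \<Longrightarrow> \<xi> \<in> \<Omega> \<Longrightarrow> (cmod (G w \<xi>))\<^sup>2 \<le> M2 \<xi>"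
    "\<And>w \<xi> v. w \<in> cball z r2 \<Longrightarrow> \<xi> \<in> \<Omega> \<Longrightarrow> (cmod (dir_deriv v G w \<xi>))\<^sup>2 \<le> M2 \<xi> * (norm v)\<^sup>2"
    unfolding dir_deriv_def by (rule dominated_kernel_deriv_bound[OF H(2) z]) (blast intro: that)
  define r where "r = min r1 r2"
  have r: "r > 0" using 1 2 by (simp add: r_def)
  have rb: "w \<in> cball z r1" "w \<in> cball z r2" "w \<in> \<Omega>" if "w \<in> ball z r" for w
    using that 1(2) by (auto simp: r_def)
  define C where "C = (\<lambda>\<xi>. 2 * (M1 \<xi> + M2 \<xi>))"
  \<comment> \<open>The product is at most \<open>sqrt (A B) t\<close>, and
    \<open>A B <= (A + B)^2\<close> replaces the geometric mean by a sum, which is integrable when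
    \<open>A\<close> and \<open>B\<close> are.\<close>
  have prod_le: "cmod a * cmod b \<le> (A + B) * t"
    if "(cmod a)\<^sup>2 \<le> A * t\<^sup>2" "(cmod b)\<^sup>2 \<le> B" "t \<ge> 0" "A \<ge> 0" for a b A B t
  proof -
    have "B \<ge> 0" using that(2) zero_le_power2[of "cmod b"] by linarith
    have "(cmod a * cmod b)\<^sup>2 \<le> (A * t\<^sup>2) * B"
      unfolding power_mult_distrib using that \<open>B \<ge> 0\<close> by (intro mult_mono) auto
    also have "\<dots> = (A * B) * t\<^sup>2" by simp
    also have "\<dots> \<le> (A + B)\<^sup>2 * t\<^sup>2"
    proof (rule mult_right_mono)
      show "A * B \<le> (A + B)\<^sup>2" using \<open>A \<ge> 0\<close> \<open>B \<ge> 0\<close> by (simp add: power2_eq_square algebra_simps)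
    qed simp
    also have "\<dots> = ((A + B) * t)\<^sup>2" by (simp add: power_mult_distrib)
    finally show ?thesis
      by (rule power2_le_imp_le) (use that \<open>B \<ge> 0\<close> in simp)
  qed
  have M0: "M1 \<xi> \<ge> 0" "M2 \<xi> \<ge> 0" if "\<xi> \<in> \<Omega>" for \<xi>
    by (rule order_trans[OF zero_le_power2 1(4)[of z]], use 1(1) that in auto)
       (rule order_trans[OF zero_le_power2 2(4)[of z]], use 2(1) that in auto)
  have "((\<lambda>w. \<integral>\<xi>. H w \<xi> * cnj (G w \<xi>) \<partial>\<mu>) has_derivative
      (\<lambda>v. \<integral>\<xi>. H z \<xi> * cnj (dir_deriv v G z \<xi>) + dir_deriv v H z \<xi> * cnj (G z \<xi>) \<partial>\<mu>)) (at z)"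
  proof (rule has_derivative_integral[OF r, where C = C and f' = "\<lambda>w \<xi> v. H w \<xi> * cnj (dir_deriv v G w \<xi>) + dir_deriv v H w \<xi> * cnj (G w \<xi>)"])
    fix w assume w: "w \<in> ball z r"
    show "((\<lambda>w. H w \<xi> * cnj (G w \<xi>)) has_derivative (\<lambda>v. H w \<xi> * cnj (dir_deriv v G w \<xi>) + dir_deriv v H w \<xi> * cnj (G w \<xi>))) (at w)"
      if "\<xi> \<in> space \<mu>" for \<xi>
    proof -
      have x: "\<xi> \<in> \<Omega>" using that by simp
      show ?thesis unfolding dir_deriv_def
        by (intro has_derivative_mult has_derivative_cnj holomorphic_Cn_frechet(1)[of _ \<Omega>] dominated_kernelD(1) H x rb(3)[OF w])
    qed
    show "cmod (H w \<xi> * cnj (dir_deriv v G w \<xi>) + dir_deriv v H w \<xi> * cnj (G w \<xi>)) \<le> C \<xi> * norm v"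
      if "\<xi> \<in> space \<mu>" for \<xi> v
    proof -
      have x: "\<xi> \<in> \<Omega>" using that by simp
      have "cmod (dir_deriv v G w \<xi>) * cmod (H w \<xi>) \<le> (M2 \<xi> + M1 \<xi>) * norm v"
        by (rule prod_le[OF 2(5)[OF rb(2)[OF w] x] 1(4)[OF rb(1)[OF w] x] _ M0(2)[OF x]]) simp
      moreover have "cmod (dir_deriv v H w \<xi>) * cmod (G w \<xi>) \<le> (M1 \<xi> + M2 \<xi>) * norm v"
        by (rule prod_le[OF 1(5)[OF rb(1)[OF w] x] 2(4)[OF rb(2)[OF w] x] _ M0(1)[OF x]]) simp
      moreover have "cmod (H w \<xi> * cnj (dir_deriv v G w \<xi>) + dir_deriv v H w \<xi> * cnj (G w \<xi>))
         \<le> cmod (dir_deriv v G w \<xi>) * cmod (H w \<xi>) + cmod (dir_deriv v H w \<xi>) * cmod (G w \<xi>)"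
        by (rule order_trans[OF norm_triangle_ineq]) (simp add: norm_mult)
      ultimately show ?thesis by (simp add: C_def algebra_simps)
    qed
    show "(\<lambda>\<xi>. H w \<xi> * cnj (G w \<xi>)) \<in> borel_measurable \<mu>"
      using sq_int_mult_integrable[OF dominated_kernel_sq_int[OF H(1) rb(3)[OF w]] dominated_kernel_sq_int[OF H(2) rb(3)[OF w]]] by auto
  next
    show "integrable \<mu> C" unfolding C_def using 1(3) 2(3) by simp
    show "(\<lambda>\<xi>. H z \<xi> * cnj (dir_deriv v G z \<xi>) + dir_deriv v H z \<xi> * cnj (G z \<xi>)) \<in> borel_measurable \<mu>" for v
      using sq_int_mult_integrable[OF dominated_kernel_sq_int[OF H(1) z] dominated_kernel_sq_int[OF dominated_kernel_dir_deriv[OF H(2)] z, of v]]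
        sq_int_mult_integrable[OF dominated_kernel_sq_int[OF dominated_kernel_dir_deriv[OF H(1)] z, of v] dominated_kernel_sq_int[OF H(2) z]]
      by auto
    show "integrable \<mu> (\<lambda>\<xi>. H z \<xi> * cnj (G z \<xi>))"
      by (rule sq_int_mult_integrable[OF dominated_kernel_sq_int[OF H(1) z] dominated_kernel_sq_int[OF H(2) z]])
  qed
  moreover have "(\<integral>\<xi>. H z \<xi> * cnj (dir_deriv v G z \<xi>) + dir_deriv v H z \<xi> * cnj (G z \<xi>) \<partial>\<mu>)
      = ip (dir_deriv v H z) (G z) + ip (H z) (dir_deriv v G z)" for v
    unfolding l2_inner_def
    using sq_int_mult_integrable[OF dominated_kernel_sq_int[OF H(1) z] dominated_kernel_sq_int[OF dominated_kernel_dir_deriv[OF H(2)] z, of v]]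
        sq_int_mult_integrable[OF dominated_kernel_sq_int[OF dominated_kernel_dir_deriv[OF H(1)] z, of v] dominated_kernel_sq_int[OF H(2) z]]
    by (simp add: Bochner_Integration.integral_add)
  ultimately show ?thesis by (simp add: l2_inner_def)
qed

text \<open>The head of the list is the derivative taken last. Lists mirror the nesting of
  \<open>wirt\<close>, so derivatives are never commuted.\<close>

fun kderiv :: "'n list \<Rightarrow> complex^'n \<Rightarrow> complex^'n \<Rightarrow> complex" where
  "kderiv [] = K"
| "kderiv (\<alpha> # I) = (\<lambda>z \<xi>. wirt \<alpha> (\<lambda>w. kderiv I w \<xi>) z)"

end

section \<open>Metric, scores and curvature\<close>

lemma matrix_inv_right':
  fixes A :: "'a::field^'n^'n"
  assumes "\<And>x. A *v x = 0 \<Longrightarrow> x = 0"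
  shows "A ** matrix_inv A = mat 1"
proof -
  have "invertible A"
    using assms matrix_left_invertible_ker[of A] invertible_left_inverse[of A] by blast
  then show ?thesis
    unfolding invertible_def matrix_inv_def by (rule someI2_ex) blast
qed

text \<open>The bridge from the set functions of the statistical model to ordinary densities,
  through which all integrals over \<open>P z\<close> are computed.\<close>

lemma as_measure_signed_density:
  assumes "integrable M \<phi>" "\<And>x. 0 \<le> \<phi> x"
  shows "as_measure M (signed_density M \<phi>) = density M (\<lambda>x. ennreal (\<phi> x))"
  unfolding as_measure_def density_def
proof (rule measure_of_eq)
  show "sets M \<subseteq> Pow (space M)" by (rule sets.space_closed)
  fix A assume "A \<in> sigma_sets (space M) (sets M)"
  then have A: "A \<in> sets M" by (simp add: sets.sigma_sets_eq)
  have i: "integrable M (\<lambda>x. indicator A x * \<phi> x)"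
    using integrable_mult_indicator[OF A assms(1)] by simp
  have "(\<integral>\<^sup>+x. ennreal (\<phi> x) * indicator A x \<partial>M) = (\<integral>\<^sup>+x. ennreal (indicator A x * \<phi> x) \<partial>M)"
    by (intro nn_integral_cong) (auto simp: indicator_def)
  also have "\<dots> = ennreal (\<integral>x. indicator A x * \<phi> x \<partial>M)"
    by (rule nn_integral_eq_integral[OF i]) (auto simp: assms(2))
  finally show "ennreal (signed_density M \<phi> A) = (\<integral>\<^sup>+x. ennreal (\<phi> x) * indicator A x \<partial>M)"
    using A by (simp add: signed_density_def set_lebesgue_integral_def)
qed

text \<open>Completeness of Lebesgue measure. Scores take uncontrolled values where the kernel
  vanishes, and this makes them measurable all the same.\<close>

lemma borel_measurable_AE_eq_lebesgue_on:
  assumes S: "S \<in> sets lebesgue" and g: "g \<in> borel_measurable (lebesgue_on S)"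
    and eq: "AE x in lebesgue_on S. f x = g x"
  shows "f \<in> borel_measurable (lebesgue_on S)"
proof (rule measurableI)
  show "f x \<in> space borel" for x by simp
  fix A :: "'b set" assume A: "A \<in> sets borel"
  obtain N where N: "{x \<in> space (lebesgue_on S). f x \<noteq> g x} \<subseteq> N" "N \<in> null_sets (lebesgue_on S)"
    using eq by (auto elim!: AE_E simp: null_sets_def)
  have "N \<in> null_sets lebesgue" using N(2) S by (simp add: null_sets_restrict_space)
  then have sub: "T \<in> sets lebesgue" if "T \<subseteq> N" for T
    using that by (meson negligible_iff_null_sets negligible_imp_sets negligible_subset)
  have gA: "g -` A \<inter> S \<in> sets lebesgue"
    using measurable_sets[OF g A] S by (simp add: sets_restrict_space_iff)
  have "f -` A \<inter> S = (g -` A \<inter> S - N) \<union> (f -` A \<inter> S \<inter> N)"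
    using N(1) by auto
  moreover have "(g -` A \<inter> S - N) \<union> (f -` A \<inter> S \<inter> N) \<in> sets lebesgue"
    using gA sub[of N] sub[of "f -` A \<inter> S \<inter> N"] by auto
  ultimately show "f -` A \<inter> space (lebesgue_on S) \<in> sets (lebesgue_on S)"
    using S by (simp add: sets_restrict_space_iff)
qed

context bergman_domain
begin

section \<open>Normalised derivatives of the kernel on the diagonal\<close>

lemma l2_inner_cong:
  assumes "\<And>\<xi>. \<xi> \<in> \<Omega> \<Longrightarrow> f \<xi> = f' \<xi>" "\<And>\<xi>. \<xi> \<in> \<Omega> \<Longrightarrow> g \<xi> = g' \<xi>"
  shows "ip f g = ip f' g'"
  unfolding l2_inner_def by (rule Bochner_Integration.integral_cong) (auto simp: assms)

lemma dominated_kernel_cong: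
  assumes "\<And>z \<xi>. z \<in> \<Omega> \<Longrightarrow> \<xi> \<in> \<Omega> \<Longrightarrow> H z \<xi> = G z \<xi>" and H: "dominated_kernel H"
  shows "dominated_kernel G"
  unfolding dominated_kernel_def
proof (intro conjI ballI)
  fix z assume z: "z \<in> \<Omega>"
  show "holomorphic_Cn (\<lambda>w. G w z) \<Omega>"
    using holomorphic_Cn_cong_open[OF open_dom, of "\<lambda>w. H w z" "\<lambda>w. G w z"] dominated_kernelD(1)[OF H z] assms(1) z by blast
  have "H z \<in> borel_measurable \<mu> \<longleftrightarrow> G z \<in> borel_measurable \<mu>"
    by (rule measurable_cong) (simp add: assms(1) z)
  then show "G z \<in> borel_measurable \<mu>" using dominated_kernelD(2)[OF H z] by blast
  obtain r M where r: "r > 0" "cball z r \<subseteq> \<Omega>" "integrable \<mu> M"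
    and M: "\<And>w \<xi>. w \<in> cball z r \<Longrightarrow> \<xi> \<in> \<Omega> \<Longrightarrow> (cmod (H w \<xi>))\<^sup>2 \<le> M \<xi>"
    by (rule dominated_kernel_bound[OF H z]) (blast intro: that)
  have "(cmod (G w \<xi>))\<^sup>2 \<le> M \<xi>" if "w \<in> cball z r" "\<xi> \<in> \<Omega>" for w \<xi>
    using M[OF that] assms(1)[of w \<xi>] that r(2) by auto
  with r show "\<exists>r>0. \<exists>M. cball z r \<subseteq> \<Omega> \<and> integrable \<mu> M \<and> (\<forall>w\<in>cball z r. \<forall>\<xi>\<in>\<Omega>. (cmod (G w \<xi>))\<^sup>2 \<le> M \<xi>)"
    by blast
qed

lemma wirt_dominated_kernel:
  assumes "dominated_kernel H" "z \<in> \<Omega>" "\<xi> \<in> \<Omega>"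
  shows "wirt \<alpha> (\<lambda>w. H w \<xi>) z = dir_deriv (axis \<alpha> 1) H z \<xi>"
  using wirt_holomorphic(1)[OF dominated_kernelD(1)[OF assms(1,3)] assms(2)] by (simp add: dir_deriv_def)

lemma dominated_kernel_kderiv: "dominated_kernel (kderiv I)"
proof (induction I)
  case (Cons a I)
  show ?case
    by (rule dominated_kernel_cong[OF _ dominated_kernel_dir_deriv[OF Cons, of "axis a 1"]]) (simp add: wirt_dominated_kernel[OF Cons])
qed (simp add: dominated_kernel_K)

lemma kderiv_dir_deriv: "z \<in> \<Omega> \<Longrightarrow> \<xi> \<in> \<Omega> \<Longrightarrow> kderiv (\<alpha> # I) z \<xi> = dir_deriv (axis \<alpha> 1) (kderiv I) z \<xi>"
  by (simp add: wirt_dominated_kernel[OF dominated_kernel_kderiv])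

text \<open>The pairing is holomorphic in \<open>z\<close> through \<open>H\<close> and
  antiholomorphic through \<open>G\<close>; the factors \<open>\<i>\<close> and \<open>-\<i>\<close>
  from the two slots let each operator see only one of them.\<close>

lemma wirt_gram:
  assumes H: "dominated_kernel H" "dominated_kernel G" and z: "z \<in> \<Omega>"
  shows "wirt \<alpha> (\<lambda>w. ip (H w) (G w)) z = ip (dir_deriv (axis \<alpha> 1) H z) (G z)"
    and "wirt_bar \<alpha> (\<lambda>w. ip (H w) (G w)) z = ip (H z) (dir_deriv (axis \<alpha> 1) G z)"
proof -
  note D = has_derivative_gram[OF assms]
  have ii: "dir_deriv (axis \<alpha> \<i>) F z \<xi> = \<i> * dir_deriv (axis \<alpha> 1) F z \<xi>" if "dominated_kernel F" "\<xi> \<in> \<Omega>" for F \<xi>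
    unfolding dir_deriv_def axis_smult_ii by (rule holomorphic_Cn_frechet(2)[OF dominated_kernelD(1)[OF that] z])
  have 1: "ip (dir_deriv (axis \<alpha> \<i>) H z) (G z) = \<i> * ip (dir_deriv (axis \<alpha> 1) H z) (G z)"
    unfolding l2_inner_cmult_left[symmetric] by (rule l2_inner_cong) (simp_all add: ii H)
  have "ip (H z) (dir_deriv (axis \<alpha> \<i>) G z) = ip (H z) (\<lambda>\<xi>. \<i> * dir_deriv (axis \<alpha> 1) G z \<xi>)"
    by (rule l2_inner_cong) (simp_all add: ii H)
  then have 2: "ip (H z) (dir_deriv (axis \<alpha> \<i>) G z) = - \<i> * ip (H z) (dir_deriv (axis \<alpha> 1) G z)"
    by (simp add: l2_inner_cmult_right)
  show "wirt \<alpha> (\<lambda>w. ip (H w) (G w)) z = ip (dir_deriv (axis \<alpha> 1) H z) (G z)"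
    unfolding wirt_eq[OF D] 1 2 by (simp add: algebra_simps)
  show "wirt_bar \<alpha> (\<lambda>w. ip (H w) (G w)) z = ip (H z) (dir_deriv (axis \<alpha> 1) G z)"
    unfolding wirt_bar_eq[OF D] 1 2 by (simp add: algebra_simps)
qed

text \<open>The mixed derivative of \<open>K z z\<close>, holomorphic along \<open>I\<close> and
  antiholomorphic along \<open>J\<close>, by \<open>wirt_gram_kderiv\<close> and
  \<open>gram_Nil\<close>.\<close>

definition gram :: "'n list \<Rightarrow> 'n list \<Rightarrow> complex^'n \<Rightarrow> complex" where
  "gram I J z = ip (kderiv I z) (kderiv J z)"

lemma gram_differentiable: "z \<in> \<Omega> \<Longrightarrow> gram I J differentiable (at z)"
  unfolding gram_def differentiable_def using has_derivative_gram[OF dominated_kernel_kderiv dominated_kernel_kderiv] by blast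

lemma wirt_gram_kderiv:
  assumes z: "z \<in> \<Omega>"
  shows "wirt a (gram I J) z = gram (a # I) J z" "wirt_bar b (gram I J) z = gram I (b # J) z"
proof -
  have "gram (a # I) J z = ip (dir_deriv (axis a 1) (kderiv I) z) (kderiv J z)"
    unfolding gram_def by (rule l2_inner_cong) (simp_all only: kderiv_dir_deriv z)
  then show "wirt a (gram I J) z = gram (a # I) J z"
    using wirt_gram(1)[OF dominated_kernel_kderiv dominated_kernel_kderiv z, of a I J] by (simp add: gram_def[abs_def])
  have "gram I (b # J) z = ip (kderiv I z) (dir_deriv (axis b 1) (kderiv J) z)"
    unfolding gram_def by (rule l2_inner_cong) (simp_all only: kderiv_dir_deriv z)
  then show "wirt_bar b (gram I J) z = gram I (b # J) z"
    using wirt_gram(2)[OF dominated_kernel_kderiv dominated_kernel_kderiv z, of b I J] by (simp add: gram_def[abs_def])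
qed

lemma gram_Nil: "z \<in> \<Omega> \<Longrightarrow> gram [] [] z = K z z"
  by (simp add: gram_def l2_inner_self flip: K_diag)

lemma K_diag_real: "z \<in> \<Omega> \<Longrightarrow> K z z = of_real (Re (K z z))"
  by (metis K_diag Re_complex_of_real)

lemma K_diag_nonzero: "z \<in> \<Omega> \<Longrightarrow> K z z \<noteq> 0"
  using K_diag_pos by force

text \<open>The variables of the polynomial identities: by \<open>wirt_jet\<close> a derivative of
  such a quotient is again a polynomial in such quotients, so denominators never appear.\<close>

definition jet :: "'n list \<Rightarrow> 'n list \<Rightarrow> complex^'n \<Rightarrow> complex" where
  "jet I J z = gram I J z / gram [] [] z"

lemma jet_Nil: "z \<in> \<Omega> \<Longrightarrow> jet [] [] z = 1"
  by (simp add: jet_def gram_Nil K_diag_nonzero)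

lemma cnj_jet: "z \<in> \<Omega> \<Longrightarrow> cnj (jet I J z) = jet J I z"
  unfolding jet_def gram_def by (simp add: l2_inner_cnj)

lemma jet_differentiable: "z \<in> \<Omega> \<Longrightarrow> jet I J differentiable (at z)"
  unfolding jet_def[abs_def]
  by (intro derivative_intros gram_differentiable) (simp_all add: gram_Nil K_diag_nonzero)

lemma wirt_jet:
  assumes z: "z \<in> \<Omega>"
  shows "wirt a (jet I J) z = jet (a # I) J z - jet I J z * jet [a] [] z"
    "wirt_bar b (jet I J) z = jet I (b # J) z - jet I J z * jet [] [b] z"
  unfolding jet_def[abs_def]
  by (simp_all add: wirt_divide gram_differentiable z gram_Nil K_diag_nonzero wirt_gram_kderiv)

lemma log_K_diag:
  assumes z: "z \<in> \<Omega>"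
  shows "(\<lambda>z. complex_of_real (ln (Re (K z z)))) differentiable (at z)"
    "wirt a (\<lambda>z. complex_of_real (ln (Re (K z z)))) z = jet [a] [] z"
    "wirt_bar b (\<lambda>z. complex_of_real (ln (Re (K z z)))) z = jet [] [b] z"
proof -
  let ?D = "frechet_derivative (gram [] []) (at z)"
  have "(gram [] [] has_derivative ?D) (at z)"
    using gram_differentiable[OF z] frechet_derivative_works by blast
  moreover have "Im (gram [] [] w) = 0" if "w \<in> \<Omega>" for w
    using K_diag[OF that] gram_Nil[OF that] by simp
  moreover have "Re (gram [] [] z) > 0" using gram_Nil[OF z] K_diag_pos[OF z] by simp
  ultimately have "((\<lambda>w. complex_of_real (ln (Re (gram [] [] w)))) has_derivative (\<lambda>v. ?D v / gram [] [] z)) (at z)"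
    using open_dom z by (intro has_derivative_ln_Re)
  then have D: "((\<lambda>w. complex_of_real (ln (Re (K w w)))) has_derivative (\<lambda>v. ?D v / gram [] [] z)) (at z)"
    by (rule has_derivative_transform_within_open[OF _ open_dom z]) (simp add: gram_Nil)
  then show "(\<lambda>z. complex_of_real (ln (Re (K z z)))) differentiable (at z)"
    unfolding differentiable_def by blast
  have "wirt a (\<lambda>z. complex_of_real (ln (Re (K z z)))) z = wirt a (gram [] []) z / gram [] [] z"
    unfolding wirt_eq[OF D] by (simp add: wirt_def diff_divide_distrib mult.commute)
  then show "wirt a (\<lambda>z. complex_of_real (ln (Re (K z z)))) z = jet [a] [] z"
    by (simp add: wirt_gram_kderiv z jet_def)
  have "wirt_bar b (\<lambda>z. complex_of_real (ln (Re (K z z)))) z = wirt_bar b (gram [] []) z / gram [] [] z"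
    unfolding wirt_bar_eq[OF D] by (simp add: wirt_bar_def add_divide_distrib mult.commute)
  then show "wirt_bar b (\<lambda>z. complex_of_real (ln (Re (K z z)))) z = jet [] [b] z"
    by (simp add: wirt_gram_kderiv z jet_def)
qed

lemma wirt_const: "wirt a (\<lambda>z. c) z = 0" "wirt_bar a (\<lambda>z. c) z = 0"
  using wirt_eq[OF has_derivative_const] wirt_bar_eq[OF has_derivative_const] by auto

lemmas wirt_rules = wirt_const wirt_add wirt_diff wirt_mult wirt_jet jet_differentiable

lemma metric_eq:
  assumes z: "z \<in> \<Omega>"
  shows "bergman_metric \<Omega> \<alpha> \<beta> z = jet [\<alpha>] [\<beta>] z - jet [\<alpha>] [] z * jet [] [\<beta>] z"
proof -
  have "bergman_metric \<Omega> \<alpha> \<beta> z = wirt \<alpha> (jet [] [\<beta>]) z"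
    unfolding bergman_metric_def by (rule wirt_cong_open(1)[OF open_dom z]) (rule log_K_diag(3))
  then show ?thesis by (simp add: wirt_jet z mult.commute)
qed

lemma metric_deriv:
  assumes z: "z \<in> \<Omega>"
  shows "wirt \<alpha> (bergman_metric \<Omega> \<gamma> \<epsilon>) z = jet [\<alpha>, \<gamma>] [\<epsilon>] z - jet [\<alpha>] [] z * jet [\<gamma>] [\<epsilon>] z
      - jet [\<gamma>] [] z * jet [\<alpha>] [\<epsilon>] z + (2 * jet [\<alpha>] [] z * jet [\<gamma>] [] z - jet [\<alpha>, \<gamma>] [] z) * jet [] [\<epsilon>] z"
    and "wirt_bar \<beta> (bergman_metric \<Omega> \<gamma> \<delta>) z = jet [\<gamma>] [\<beta>, \<delta>] z - jet [\<gamma>] [\<delta>] z * jet [] [\<beta>] z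
      - jet [\<gamma>] [\<beta>] z * jet [] [\<delta>] z + jet [\<gamma>] [] z * (2 * jet [] [\<beta>] z * jet [] [\<delta>] z - jet [] [\<beta>, \<delta>] z)"
proof -
  show "wirt \<alpha> (bergman_metric \<Omega> \<gamma> \<epsilon>) z = jet [\<alpha>, \<gamma>] [\<epsilon>] z - jet [\<alpha>] [] z * jet [\<gamma>] [\<epsilon>] z
      - jet [\<gamma>] [] z * jet [\<alpha>] [\<epsilon>] z + (2 * jet [\<alpha>] [] z * jet [\<gamma>] [] z - jet [\<alpha>, \<gamma>] [] z) * jet [] [\<epsilon>] z"
  proof -
    have "wirt \<alpha> (bergman_metric \<Omega> \<gamma> \<epsilon>) z = wirt \<alpha> (\<lambda>w. jet [\<gamma>] [\<epsilon>] w - jet [\<gamma>] [] w * jet [] [\<epsilon>] w) z"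
      by (rule wirt_cong_open(1)[OF open_dom z]) (rule metric_eq)
    then show ?thesis by (simp add: wirt_rules z) (simp add: algebra_simps)
  qed
  show "wirt_bar \<beta> (bergman_metric \<Omega> \<gamma> \<delta>) z = jet [\<gamma>] [\<beta>, \<delta>] z - jet [\<gamma>] [\<delta>] z * jet [] [\<beta>] z
      - jet [\<gamma>] [\<beta>] z * jet [] [\<delta>] z + jet [\<gamma>] [] z * (2 * jet [] [\<beta>] z * jet [] [\<delta>] z - jet [] [\<beta>, \<delta>] z)"
  proof -
    have "wirt_bar \<beta> (bergman_metric \<Omega> \<gamma> \<delta>) z = wirt_bar \<beta> (\<lambda>w. jet [\<gamma>] [\<delta>] w - jet [\<gamma>] [] w * jet [] [\<delta>] w) z"
      by (rule wirt_cong_open(2)[OF open_dom z]) (rule metric_eq)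
    then show ?thesis by (simp add: wirt_rules z) (simp add: algebra_simps)
  qed
qed

text \<open>The outer derivative is left standing; \<open>wirt_rules\<close> evaluates it inside
  \<open>hessian_rep_hessian_rep\<close>, where the result is compared with the expanded inner
  product.\<close>

lemma metric_deriv2:
  assumes z: "z \<in> \<Omega>"
  shows "wirt \<alpha> (wirt_bar \<beta> (bergman_metric \<Omega> \<gamma> \<delta>)) z =
     wirt \<alpha> (\<lambda>z. jet [\<gamma>] [\<beta>, \<delta>] z - jet [\<gamma>] [\<delta>] z * jet [] [\<beta>] z
      - jet [\<gamma>] [\<beta>] z * jet [] [\<delta>] z + jet [\<gamma>] [] z * (2 * (jet [] [\<beta>] z * jet [] [\<delta>] z) - jet [] [\<beta>, \<delta>] z)) z"
  by (rule wirt_cong_open(1)[OF open_dom z]) (simp only: metric_deriv(2) mult.assoc)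

section \<open>Square-integrable kernel quotients under the model\<close>

abbreviation "P z \<equiv> bergman_prob \<Omega> z"

lemma density_nonneg: "z \<in> \<Omega> \<Longrightarrow> bergman_density \<Omega> z \<xi> \<ge> 0"
  using K_diag_pos[of z] by (simp add: bergman_density_def)

lemma density_integrable: "z \<in> \<Omega> \<Longrightarrow> integrable \<mu> (bergman_density \<Omega> z)"
  unfolding bergman_density_def[abs_def] using sq_intD(2)[OF K_sq_int] by simp

lemma density_integral: "z \<in> \<Omega> \<Longrightarrow> (\<integral>\<xi>. bergman_density \<Omega> z \<xi> \<partial>\<mu>) = 1"
  unfolding bergman_density_def using K_diag[of z] K_diag_pos[of z] by (simp add: l2_sq_def)

lemma prob_eq: "z \<in> \<Omega> \<Longrightarrow> P z = density \<mu> (\<lambda>\<xi>. ennreal (bergman_density \<Omega> z \<xi>))"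
  unfolding bergman_model_def
  by (rule as_measure_signed_density[OF density_integrable density_nonneg])

lemma prob_sets [simp]: "z \<in> \<Omega> \<Longrightarrow> sets (P z) = sets \<mu>"
  by (simp add: prob_eq)

lemma prob_measurable: "z \<in> \<Omega> \<Longrightarrow> borel_measurable (P z) = borel_measurable \<mu>"
  by (rule measurable_cong_sets) simp_all

lemma integrable_prob:
  fixes f :: "complex^'n \<Rightarrow> 'b::{banach, second_countable_topology}"
  assumes "z \<in> \<Omega>" "f \<in> borel_measurable \<mu>"
  shows "integrable (P z) f \<longleftrightarrow> integrable \<mu> (\<lambda>\<xi>. bergman_density \<Omega> z \<xi> *\<^sub>R f \<xi>)"
  unfolding prob_eq[OF assms(1)]
  by (rule integrable_density[OF assms(2)]) (use assms density_integrable density_nonneg in auto)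

lemma integral_prob:
  fixes f :: "complex^'n \<Rightarrow> 'b::{banach, second_countable_topology}"
  assumes "z \<in> \<Omega>" "f \<in> borel_measurable \<mu>"
  shows "integral\<^sup>L (P z) f = (\<integral>\<xi>. bergman_density \<Omega> z \<xi> *\<^sub>R f \<xi> \<partial>\<mu>)"
  unfolding prob_eq[OF assms(1)]
  by (rule integral_density[OF assms(2)]) (use assms density_integrable density_nonneg in auto)

lemma AE_prob:
  assumes "z \<in> \<Omega>" "AE \<xi> in \<mu>. R \<xi>" shows "AE \<xi> in P z. R \<xi>"
  unfolding prob_eq[OF assms(1)]
  using assms density_integrable[OF assms(1)] by (subst AE_density) (auto elim!: eventually_mono)

lemma expect_eq:
  assumes "z \<in> \<Omega>" "f \<in> borel_measurable \<mu>"
  shows "expect \<Omega> z f = integral\<^sup>L (P z) f"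
  unfolding expect_def integral_prob[OF assms] by (simp add: scaleR_conv_of_real mult.commute)

definition kratio :: "complex^'n \<Rightarrow> 'n list \<Rightarrow> complex^'n \<Rightarrow> complex" where
  "kratio z I \<xi> = kderiv I z \<xi> / K z \<xi>"

lemma kratio_measurable: "z \<in> \<Omega> \<Longrightarrow> kratio z I \<in> borel_measurable \<mu>"
  unfolding kratio_def[abs_def]
  by (intro borel_measurable_divide dominated_kernelD(2)[OF dominated_kernel_kderiv] dominated_kernelD(2)[OF dominated_kernel_K])

text \<open>The factor \<open>|K z \<xi>|^2\<close> of the density cancels the denominators of one
  quotient and one conjugate quotient. The poles at zeros of the kernel thus do no harm to second
  moments.\<close>

lemma kratio_products:
  assumes z: "z \<in> \<Omega>"
  shows "AE \<xi> in \<mu>. bergman_density \<Omega> z \<xi> *\<^sub>R (kratio z I \<xi> * cnj (kratio z J \<xi>)) = kderiv I z \<xi> * cnj (kderiv J z \<xi>) / K z z"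
proof (rule AE_mp[OF K_zero_null[OF z]], rule AE_I2, rule impI)
  fix \<xi> assume k: "K z \<xi> \<noteq> 0"
  have "complex_of_real (bergman_density \<Omega> z \<xi>) = K z \<xi> * cnj (K z \<xi>) / K z z"
    unfolding bergman_density_def using K_diag_real[OF z] complex_norm_square[of "K z \<xi>"] by simp
  then show "bergman_density \<Omega> z \<xi> *\<^sub>R (kratio z I \<xi> * cnj (kratio z J \<xi>)) = kderiv I z \<xi> * cnj (kderiv J z \<xi>) / K z z"
    using k unfolding scaleR_conv_of_real kratio_def by (simp add: field_simps)
qed

lemma kratio_sq_int: "z \<in> \<Omega> \<Longrightarrow> kratio z I \<in> sq_int (P z)"
proof -
  assume z: "z \<in> \<Omega>"
  have m: "(\<lambda>\<xi>. (cmod (kratio z I \<xi>))\<^sup>2) \<in> borel_measurable \<mu>" using kratio_measurable[OF z] by measurable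
  have "integrable \<mu> (\<lambda>\<xi>. (cmod (kderiv I z \<xi>))\<^sup>2 / Re (K z z))"
    using sq_intD(2)[OF dominated_kernel_sq_int[OF dominated_kernel_kderiv z]] by simp
  moreover have "AE \<xi> in \<mu>. (cmod (kderiv I z \<xi>))\<^sup>2 / Re (K z z) = bergman_density \<Omega> z \<xi> *\<^sub>R (cmod (kratio z I \<xi>))\<^sup>2"
    by (rule AE_mp[OF K_zero_null[OF z]], rule AE_I2, rule impI)
       (simp add: bergman_density_def kratio_def norm_divide power_divide)
  ultimately have "integrable \<mu> (\<lambda>\<xi>. bergman_density \<Omega> z \<xi> *\<^sub>R (cmod (kratio z I \<xi>))\<^sup>2)"
    using m density_integrable[OF z] by (subst integrable_cong_AE) (auto elim!: eventually_mono dest: sym)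
  then show ?thesis
    unfolding sq_int_def prob_measurable[OF z] using kratio_measurable[OF z] integrable_prob[OF z m] by simp
qed

lemma kratio_inner:
  assumes z: "z \<in> \<Omega>" shows "l2_inner (P z) (kratio z I) (kratio z J) = jet I J z"
proof -
  have m: "(\<lambda>\<xi>. kratio z I \<xi> * cnj (kratio z J \<xi>)) \<in> borel_measurable \<mu>"
    using kratio_measurable[OF z] by (intro borel_measurable_times borel_measurable_cnj)
  have "l2_inner (P z) (kratio z I) (kratio z J) = (\<integral>\<xi>. kderiv I z \<xi> * cnj (kderiv J z \<xi>) / K z z \<partial>\<mu>)"
    unfolding l2_inner_def integral_prob[OF z m]
    using kratio_products[OF z] m density_integrable[OF z]
      sq_int_mult_integrable[OF dominated_kernel_sq_int[OF dominated_kernel_kderiv z] dominated_kernel_sq_int[OF dominated_kernel_kderiv z], of I J]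
    by (intro integral_cong_AE) auto
  also have "\<dots> = jet I J z" by (simp add: jet_def gram_def[of I J] l2_inner_def gram_Nil z)
  finally show ?thesis .
qed

text \<open>Almost everywhere equal to the score, to \<open>\<partial>\<^sub>\<alpha>\<partial>\<^sub>\<gamma> l + \<partial>\<^sub>\<alpha> l \<partial>\<^sub>\<gamma> l\<close> and to the normal field. The constant
  function 1 is written \<open>kratio z []\<close>, which equals 1 off the zeros of the kernel.\<close>

definition score_rep :: "complex^'n \<Rightarrow> 'n \<Rightarrow> complex^'n \<Rightarrow> complex" where
  "score_rep z i = (\<lambda>\<xi>. kratio z [i] \<xi> - jet [i] [] z * kratio z [] \<xi>)"

definition hessian_rep :: "complex^'n \<Rightarrow> 'n \<Rightarrow> 'n \<Rightarrow> complex^'n \<Rightarrow> complex" where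
  "hessian_rep z \<alpha> \<gamma> = (\<lambda>\<xi>. kratio z [\<alpha>, \<gamma>] \<xi> - jet [\<alpha>] [] z * kratio z [\<gamma>] \<xi> - jet [\<gamma>] [] z * kratio z [\<alpha>] \<xi>
      + (2 * jet [\<alpha>] [] z * jet [\<gamma>] [] z - jet [\<alpha>, \<gamma>] [] z) * kratio z [] \<xi>)"

definition normal_rep :: "complex^'n \<Rightarrow> 'n \<Rightarrow> 'n \<Rightarrow> complex^'n \<Rightarrow> complex" where
  "normal_rep z \<alpha> \<gamma> = (\<lambda>\<xi>. hessian_rep z \<alpha> \<gamma> \<xi> - (\<Sum>i\<in>UNIV. bergman_christoffel \<Omega> i \<alpha> \<gamma> z * score_rep z i \<xi>))"

lemma score_rep_sq_int: "z \<in> \<Omega> \<Longrightarrow> score_rep z i \<in> sq_int (P z)"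
  unfolding score_rep_def by (intro sq_int_diff sq_int_cmult kratio_sq_int)

lemma hessian_rep_sq_int: "z \<in> \<Omega> \<Longrightarrow> hessian_rep z \<alpha> \<gamma> \<in> sq_int (P z)"
  unfolding hessian_rep_def by (intro sq_int_add sq_int_diff sq_int_cmult kratio_sq_int)

lemma score_rep_sum_sq_int: "z \<in> \<Omega> \<Longrightarrow> (\<lambda>\<xi>. \<Sum>i\<in>UNIV. c i * score_rep z i \<xi>) \<in> sq_int (P z)"
  by (intro sq_int_sum sq_int_cmult score_rep_sq_int)

lemma normal_rep_sq_int: "z \<in> \<Omega> \<Longrightarrow> normal_rep z \<alpha> \<gamma> \<in> sq_int (P z)"
  unfolding normal_rep_def by (intro sq_int_diff hessian_rep_sq_int score_rep_sum_sq_int)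

lemmas sq_int_rules = sq_int_add sq_int_diff sq_int_cmult sq_int_sum

lemmas inner_rules = l2_inner_add_left l2_inner_add_right l2_inner_diff_left l2_inner_diff_right
  l2_inner_cmult_left l2_inner_cmult_right

lemma score_rep_score_rep:
  assumes z: "z \<in> \<Omega>" shows "l2_inner (P z) (score_rep z i) (score_rep z j) = bergman_metric \<Omega> i j z"
  unfolding score_rep_def metric_eq[OF z]
  by (simp add: inner_rules sq_int_rules kratio_sq_int kratio_inner z jet_Nil cnj_jet)

lemma score_rep_mean:
  assumes z: "z \<in> \<Omega>" shows "l2_inner (P z) (score_rep z i) (kratio z []) = 0"
  unfolding score_rep_def by (simp add: inner_rules sq_int_rules kratio_sq_int kratio_inner z jet_Nil)

lemma hessian_rep_mean:
  assumes z: "z \<in> \<Omega>" shows "l2_inner (P z) (hessian_rep z \<alpha> \<gamma>) (kratio z []) = 0"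
  unfolding hessian_rep_def
  by (simp add: inner_rules sq_int_rules kratio_sq_int kratio_inner z jet_Nil)

text \<open>The Hessian representative has mean zero, so the constant part of the score drops out
  and the pairing with \<open>kratio z [j]\<close> alone remains. This is how first derivatives of
  the metric, and so the Christoffel symbols, enter.\<close>

lemma hessian_rep_score_rep:
  assumes z: "z \<in> \<Omega>"
  shows "l2_inner (P z) (hessian_rep z \<alpha> \<gamma>) (score_rep z j) = wirt \<alpha> (bergman_metric \<Omega> \<gamma> j) z"
proof -
  have "l2_inner (P z) (hessian_rep z \<alpha> \<gamma>) (score_rep z j) = l2_inner (P z) (hessian_rep z \<alpha> \<gamma>) (kratio z [j])"
    unfolding score_rep_def using hessian_rep_mean[OF z] by (simp add: inner_rules sq_int_rules kratio_sq_int hessian_rep_sq_int z)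
  also have "\<dots> = wirt \<alpha> (bergman_metric \<Omega> \<gamma> j) z"
    unfolding hessian_rep_def metric_deriv[OF z]
    by (simp add: inner_rules sq_int_rules kratio_sq_int kratio_inner z)
  finally show ?thesis .
qed

lemma score_rep_hessian_rep:
  assumes z: "z \<in> \<Omega>"
  shows "l2_inner (P z) (score_rep z i) (hessian_rep z \<beta> \<delta>) = wirt_bar \<beta> (bergman_metric \<Omega> i \<delta>) z"
proof -
  have "l2_inner (P z) (score_rep z i) (hessian_rep z \<beta> \<delta>) = cnj (l2_inner (P z) (hessian_rep z \<beta> \<delta>) (score_rep z i))"
    by (simp add: l2_inner_cnj)
  also have "\<dots> = wirt_bar \<beta> (bergman_metric \<Omega> i \<delta>) z"
    unfolding hessian_rep_score_rep[OF z] metric_deriv[OF z] by (simp add: cnj_jet z algebra_simps)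
  finally show ?thesis .
qed

text \<open>The polynomial identity behind the curvature formula: both sides expand to the same
  polynomial in jets. The two products of metric coefficients appear here.\<close>

lemma hessian_rep_hessian_rep:
  assumes z: "z \<in> \<Omega>"
  shows "l2_inner (P z) (hessian_rep z \<alpha> \<gamma>) (hessian_rep z \<beta> \<delta>) = wirt \<alpha> (wirt_bar \<beta> (bergman_metric \<Omega> \<gamma> \<delta>)) z
     + bergman_metric \<Omega> \<alpha> \<beta> z * bergman_metric \<Omega> \<gamma> \<delta> z + bergman_metric \<Omega> \<alpha> \<delta> z * bergman_metric \<Omega> \<gamma> \<beta> z"
  unfolding hessian_rep_def metric_deriv2[OF z] metric_eq[OF z]
  by (simp add: inner_rules sq_int_rules kratio_sq_int kratio_inner z jet_Nil cnj_jet wirt_rules) (simp add: algebra_simps)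

section \<open>Derivatives of the log-likelihood\<close>

lemma kderiv_differentiable:
  "z \<in> \<Omega> \<Longrightarrow> \<xi> \<in> \<Omega> \<Longrightarrow> (\<lambda>w. kderiv I w \<xi>) differentiable (at z)"
  by (rule holomorphic_Cn_imp_differentiable[OF dominated_kernelD(1)[OF dominated_kernel_kderiv]])

lemma nonzero_open:
  assumes "\<xi> \<in> \<Omega>" shows "open {w \<in> \<Omega>. K w \<xi> \<noteq> 0}"
proof -
  have "open (\<Omega> \<inter> (\<lambda>w. K w \<xi>) -` (- {0}))"
    using holomorphic_Cn_continuous_on[OF K_holomorphic[OF assms]] open_dom
    by (intro continuous_open_preimage) auto
  also have "\<Omega> \<inter> (\<lambda>w. K w \<xi>) -` (- {0}) = {w \<in> \<Omega>. K w \<xi> \<noteq> 0}" by auto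
  finally show ?thesis .
qed

text \<open>Where the kernel is nonzero, \<open>l\<close> is \<open>log |K|^2 - log K z z\<close>.
  As this region is open in \<open>z\<close>, the formula holds on a neighbourhood and can be
  differentiated once more.\<close>

lemma wirt_loglik:
  assumes x: "\<xi> \<in> \<Omega>" and z: "z \<in> {w \<in> \<Omega>. K w \<xi> \<noteq> 0}"
  shows "wirt \<alpha> (loglik \<Omega> \<xi>) z = kderiv [\<alpha>] z \<xi> / K z \<xi> - jet [\<alpha>] [] z"
proof -
  have zO: "z \<in> \<Omega>" and k: "K z \<xi> \<noteq> 0" using z by auto
  have hol: "holomorphic_Cn (\<lambda>w. K w \<xi>) \<Omega>" by (rule K_holomorphic[OF x])
  let ?D = "frechet_derivative (\<lambda>w. K w \<xi>) (at z)"
  have eq: "loglik \<Omega> \<xi> w = complex_of_real (ln ((cmod (K w \<xi>))\<^sup>2)) - complex_of_real (ln (Re (K w w)))"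
    if "w \<in> {w \<in> \<Omega>. K w \<xi> \<noteq> 0}" for w
    using that K_diag_pos[of w] by (simp add: loglik_def bergman_density_def ln_div)
  have D: "((\<lambda>w. complex_of_real (ln ((cmod (K w \<xi>))\<^sup>2))) has_derivative (\<lambda>v. ?D v / K z \<xi> + cnj (?D v / K z \<xi>))) (at z)"
    by (rule has_derivative_ln_norm_sq[OF holomorphic_Cn_frechet(1)[OF hol zO] k])
  \<comment> \<open>The conjugate half of the derivative is antiholomorphic and is annihilated by
    \<open>wirt\<close>.\<close>
  have "wirt \<alpha> (\<lambda>w. complex_of_real (ln ((cmod (K w \<xi>))\<^sup>2))) z = ?D (axis \<alpha> 1) / K z \<xi>"
    unfolding wirt_eq[OF D] axis_smult_ii holomorphic_Cn_frechet(2)[OF hol zO] by (simp add: algebra_simps)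
  also have "\<dots> = kderiv [\<alpha>] z \<xi> / K z \<xi>" by (simp add: wirt_holomorphic(1)[OF hol zO])
  finally have w1: "wirt \<alpha> (\<lambda>w. complex_of_real (ln ((cmod (K w \<xi>))\<^sup>2))) z = kderiv [\<alpha>] z \<xi> / K z \<xi>" .
  have d1: "(\<lambda>w. complex_of_real (ln ((cmod (K w \<xi>))\<^sup>2))) differentiable (at z)"
    using D differentiable_def by blast
  have "wirt \<alpha> (loglik \<Omega> \<xi>) z
      = wirt \<alpha> (\<lambda>w. complex_of_real (ln ((cmod (K w \<xi>))\<^sup>2)) - complex_of_real (ln (Re (K w w)))) z"
    by (rule wirt_cong_open(1)[OF nonzero_open[OF x] z]) (rule eq)
  then show ?thesis
    unfolding wirt_diff(1)[OF d1 log_K_diag(1)[OF zO]] w1 log_K_diag(2)[OF zO] .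
qed

lemma wirt_wirt_loglik:
  assumes x: "\<xi> \<in> \<Omega>" and z: "z \<in> {w \<in> \<Omega>. K w \<xi> \<noteq> 0}"
  shows "wirt \<alpha> (wirt \<gamma> (loglik \<Omega> \<xi>)) z = kratio z [\<alpha>, \<gamma>] \<xi> - kratio z [\<gamma>] \<xi> * kratio z [\<alpha>] \<xi>
     - (jet [\<alpha>, \<gamma>] [] z - jet [\<gamma>] [] z * jet [\<alpha>] [] z)"
proof -
  have zO: "z \<in> \<Omega>" and k: "K z \<xi> \<noteq> 0" using z by auto
  have d: "(\<lambda>w. kderiv [\<gamma>] w \<xi> / K w \<xi>) differentiable (at z)"
    using kderiv_differentiable[OF zO x, of "[\<gamma>]"] kderiv_differentiable[OF zO x, of "[]"] k
    by (intro derivative_intros) auto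
  have "wirt \<alpha> (\<lambda>w. kderiv [\<gamma>] w \<xi> / K w \<xi>) z = kratio z [\<alpha>, \<gamma>] \<xi> - kratio z [\<gamma>] \<xi> * kratio z [\<alpha>] \<xi>"
    using wirt_divide(1)[OF kderiv_differentiable[OF zO x, of "[\<gamma>]"] kderiv_differentiable[OF zO x, of "[]"], of \<alpha>] k
    by (simp add: kratio_def)
  moreover have "wirt \<alpha> (wirt \<gamma> (loglik \<Omega> \<xi>)) z = wirt \<alpha> (\<lambda>w. kderiv [\<gamma>] w \<xi> / K w \<xi> - jet [\<gamma>] [] w) z"
    by (rule wirt_cong_open(1)[OF nonzero_open[OF x] z]) (rule wirt_loglik[OF x])
  ultimately show ?thesis
    unfolding wirt_diff(1)[OF d jet_differentiable[OF zO]] wirt_jet[OF zO] by simp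
qed

lemma score_AE: "z \<in> \<Omega> \<Longrightarrow> AE \<xi> in \<mu>. score \<Omega> z \<alpha> \<xi> = score_rep z \<alpha> \<xi>"
proof (rule AE_mp[OF K_zero_null], assumption, rule AE_I2, rule impI)
  fix \<xi> assume z: "z \<in> \<Omega>" and "\<xi> \<in> space \<mu>" "K z \<xi> \<noteq> 0"
  then show "score \<Omega> z \<alpha> \<xi> = score_rep z \<alpha> \<xi>"
    using wirt_loglik[of \<xi> z \<alpha>] by (simp add: score_def score_rep_def kratio_def)
qed

lemma normal_field_AE: "z \<in> \<Omega> \<Longrightarrow> AE \<xi> in \<mu>. normal_field \<Omega> z \<alpha> \<gamma> \<xi> = normal_rep z \<alpha> \<gamma> \<xi>"
proof (rule AE_mp[OF K_zero_null], assumption, rule AE_I2, rule impI)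
  fix \<xi> assume z: "z \<in> \<Omega>" and x: "\<xi> \<in> space \<mu>" and k: "K z \<xi> \<noteq> 0"
  have r1: "kratio z [] \<xi> = 1" using k by (simp add: kratio_def)
  have sc: "score \<Omega> z i \<xi> = kratio z [i] \<xi> - jet [i] [] z" for i
    using wirt_loglik[of \<xi> z i] z x k by (simp add: score_def kratio_def)
  have "wirt \<alpha> (wirt \<gamma> (loglik \<Omega> \<xi>)) z + score \<Omega> z \<alpha> \<xi> * score \<Omega> z \<gamma> \<xi> = hessian_rep z \<alpha> \<gamma> \<xi>"
    unfolding sc hessian_rep_def using wirt_wirt_loglik[of \<xi> z \<alpha> \<gamma>] z x k r1 by (simp add: algebra_simps)
  then show "normal_field \<Omega> z \<alpha> \<gamma> \<xi> = normal_rep z \<alpha> \<gamma> \<xi>"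
    by (simp add: normal_field_def normal_rep_def sc score_rep_def r1)
qed

text \<open>Transfers all moments from square-integrable representatives to the actual fields. The
  mean occurs twice because covariances use \<open>expect\<close> while \<open>tangent_prob\<close>
  integrates against \<open>P z\<close>; the mean is a pairing with \<open>kratio z []\<close>,
  which is 1 almost everywhere.\<close>

lemma AE_representative:
  assumes z: "z \<in> \<Omega>" and f: "AE \<xi> in \<mu>. f \<xi> = f' \<xi>" "f' \<in> sq_int (P z)"
    and g: "AE \<xi> in \<mu>. g \<xi> = g' \<xi>" "g' \<in> sq_int (P z)"
  shows "integrable (P z) f" "integrable (P z) (\<lambda>\<xi>. f \<xi> * cnj (g \<xi>))"
    "expect \<Omega> z f = l2_inner (P z) f' (kratio z [])" "integral\<^sup>L (P z) f = l2_inner (P z) f' (kratio z [])"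
    "expect \<Omega> z (\<lambda>\<xi>. f \<xi> * cnj (g \<xi>)) = l2_inner (P z) f' g'"
proof -
  have m': "f' \<in> borel_measurable \<mu>" "g' \<in> borel_measurable \<mu>"
    using sq_intD(1)[OF f(2)] sq_intD(1)[OF g(2)] prob_measurable[OF z] by auto
  have m: "f \<in> borel_measurable \<mu>" "g \<in> borel_measurable \<mu>"
    using borel_measurable_AE_eq_lebesgue_on[OF dom_sets m'(1) f(1)]
      borel_measurable_AE_eq_lebesgue_on[OF dom_sets m'(2) g(1)] by auto
  note mr = kratio_measurable[OF z, of "[]"]
  have mp: "(\<lambda>\<xi>. f \<xi> * cnj (g \<xi>)) \<in> borel_measurable \<mu>" "(\<lambda>\<xi>. f' \<xi> * cnj (g' \<xi>)) \<in> borel_measurable \<mu>"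
    "(\<lambda>\<xi>. f' \<xi> * cnj (kratio z [] \<xi>)) \<in> borel_measurable \<mu>"
    using m m' mr by (auto intro!: borel_measurable_times borel_measurable_cnj)
  note M = prob_measurable[OF z]
  have one: "AE \<xi> in \<mu>. kratio z [] \<xi> = 1"
    by (rule AE_mp[OF K_zero_null[OF z]]) (simp add: kratio_def)
  have e1: "AE \<xi> in P z. f \<xi> = f' \<xi> * cnj (kratio z [] \<xi>)"
    by (rule AE_prob[OF z]) (use f(1) one in eventually_elim, simp)
  have e2: "AE \<xi> in P z. f \<xi> * cnj (g \<xi>) = f' \<xi> * cnj (g' \<xi>)"
    by (rule AE_prob[OF z]) (use f(1) g(1) in eventually_elim, simp)
  have i1: "integrable (P z) (\<lambda>\<xi>. f' \<xi> * cnj (kratio z [] \<xi>))"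
    by (rule sq_int_mult_integrable[OF f(2) kratio_sq_int[OF z]])
  have i2: "integrable (P z) (\<lambda>\<xi>. f' \<xi> * cnj (g' \<xi>))"
    by (rule sq_int_mult_integrable[OF f(2) g(2)])
  show "integrable (P z) f"
    using i1 e1 m(1) mp(3) by (subst integrable_cong_AE[where g = "\<lambda>\<xi>. f' \<xi> * cnj (kratio z [] \<xi>)"]) (auto simp: M)
  show "integrable (P z) (\<lambda>\<xi>. f \<xi> * cnj (g \<xi>))"
    using i2 e2 mp by (subst integrable_cong_AE[where g = "\<lambda>\<xi>. f' \<xi> * cnj (g' \<xi>)"]) (auto simp: M)
  show I: "integral\<^sup>L (P z) f = l2_inner (P z) f' (kratio z [])"
    unfolding l2_inner_def using e1 m(1) mp(3) by (intro integral_cong_AE) (auto simp: M)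
  then show "expect \<Omega> z f = l2_inner (P z) f' (kratio z [])" by (simp add: expect_eq z m)
  show "expect \<Omega> z (\<lambda>\<xi>. f \<xi> * cnj (g \<xi>)) = l2_inner (P z) f' g'"
    unfolding expect_eq[OF z mp(1)] l2_inner_def using e2 mp by (intro integral_cong_AE) (auto simp: M)
qed

lemma score_Cov:
  assumes z: "z \<in> \<Omega>"
  shows "Cov_exists \<Omega> z (score \<Omega> z \<alpha>) (score \<Omega> z \<beta>)"
    "bergman_metric \<Omega> \<alpha> \<beta> z = Cov \<Omega> z (score \<Omega> z \<alpha>) (score \<Omega> z \<beta>)"
proof -
  note A = AE_representative[OF z score_AE[OF z] score_rep_sq_int[OF z] score_AE[OF z] score_rep_sq_int[OF z]]
  show "Cov_exists \<Omega> z (score \<Omega> z \<alpha>) (score \<Omega> z \<beta>)"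
    unfolding Cov_exists_def using A(1,2) by blast
  show "bergman_metric \<Omega> \<alpha> \<beta> z = Cov \<Omega> z (score \<Omega> z \<alpha>) (score \<Omega> z \<beta>)"
    unfolding Cov_def A(3,5) by (simp add: score_rep_score_rep score_rep_mean z)
qed

section \<open>Nondegeneracy and inverse of the metric\<close>

lemma derivative_reproducing:
  assumes z: "z \<in> \<Omega>" and f: "f \<in> A2"
  shows "f z = ip (K z) (\<lambda>\<xi>. cnj (f \<xi>))" "wirt \<alpha> f z = ip (kderiv [\<alpha>] z) (\<lambda>\<xi>. cnj (f \<xi>))"
    "(\<lambda>\<xi>. cnj (f \<xi>)) \<in> sq_int \<mu>"
proof -
  have rep: "f w = ip (K w) (\<lambda>\<xi>. cnj (f \<xi>))" if "w \<in> \<Omega>" for w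
    using reproducing[OF that f] by (simp add: l2_inner_def mult.commute)
  show "f z = ip (K z) (\<lambda>\<xi>. cnj (f \<xi>))" by (rule rep[OF z])
  show s: "(\<lambda>\<xi>. cnj (f \<xi>)) \<in> sq_int \<mu>"
    using sq_intD[OF A2_sq_int[OF f]] by (simp add: sq_int_def borel_measurable_cnj)
  \<comment> \<open>The conjugate of \<open>f\<close>, viewed as a kernel constant in its first
    variable, is dominated; so \<open>wirt_gram\<close> differentiates the reproducing
    formula.\<close>
  have "dominated_kernel (\<lambda>w \<xi>. cnj (f \<xi>))"
    unfolding dominated_kernel_def
  proof (intro conjI ballI)
    fix w assume w: "w \<in> \<Omega>"
    show "(\<lambda>\<xi>. cnj (f \<xi>)) \<in> borel_measurable \<mu>" using s by (simp add: sq_int_def)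
    obtain r where r: "r > 0" "cball w r \<subseteq> \<Omega>" using open_dom w open_contains_cball by blast
    then show "\<exists>r>0. \<exists>M. cball w r \<subseteq> \<Omega> \<and> integrable \<mu> M \<and> (\<forall>w\<in>cball w r. \<forall>\<xi>\<in>\<Omega>. (cmod (cnj (f \<xi>)))\<^sup>2 \<le> M \<xi>)"
      using sq_intD(2)[OF s] by (intro exI[of _ r] conjI exI[of _ "\<lambda>\<xi>. (cmod (cnj (f \<xi>)))\<^sup>2"]) auto
  qed simp
  from wirt_gram(1)[OF dominated_kernel_kderiv[of "[]"] this z, of \<alpha>]
  have "wirt \<alpha> (\<lambda>w. ip (K w) (\<lambda>\<xi>. cnj (f \<xi>))) z = ip (dir_deriv (axis \<alpha> 1) (kderiv []) z) (\<lambda>\<xi>. cnj (f \<xi>))"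
    by simp
  also have "\<dots> = ip (kderiv [\<alpha>] z) (\<lambda>\<xi>. cnj (f \<xi>))"
    by (rule l2_inner_cong) (simp_all only: kderiv_dir_deriv z)
  also have "wirt \<alpha> (\<lambda>w. ip (K w) (\<lambda>\<xi>. cnj (f \<xi>))) z = wirt \<alpha> f z"
    by (rule wirt_cong_open(1)[OF open_dom z]) (rule rep[symmetric])
  finally show "wirt \<alpha> f z = ip (kderiv [\<alpha>] z) (\<lambda>\<xi>. cnj (f \<xi>))" .
qed

text \<open>Degeneracy of the metric in direction \<open>x\<close> would mean that \<open>\<partial>\<^sub>x f - c f\<close> vanishes at \<open>z\<close> for
  all \<open>f\<close> in the Bergman space; test it on constants and on coordinate functions.\<close>

lemma metric_nondegenerate:
  assumes z: "z \<in> \<Omega>" and x: "\<And>j. (\<Sum>i\<in>UNIV. x $ i * bergman_metric \<Omega> i j z) = 0"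
  shows "x = 0"
proof -
  define c where "c = (\<Sum>i\<in>UNIV. x $ i * jet [i] [] z)"
  let ?S = "\<lambda>\<xi>. \<Sum>i\<in>UNIV. x $ i * score_rep z i \<xi>"
  have "l2_inner (P z) ?S ?S = (\<Sum>j\<in>UNIV. cnj (x $ j) * (\<Sum>i\<in>UNIV. x $ i * bergman_metric \<Omega> i j z))"
    by (simp add: l2_inner_sum_left l2_inner_sum_right l2_inner_cmult_left l2_inner_cmult_right
        score_rep_sq_int sq_int_cmult score_rep_sum_sq_int z score_rep_score_rep)
       (unfold sum_distrib_left, subst sum.swap, simp add: mult.left_commute)
  then have "l2_sq (P z) ?S = 0" by (simp add: x l2_inner_self)
  then have "AE \<xi> in P z. (cmod (?S \<xi>))\<^sup>2 = 0"
    unfolding l2_sq_def using sq_intD(2)[OF score_rep_sum_sq_int[OF z]]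
    by (subst (asm) integral_nonneg_eq_0_iff_AE) auto
  \<comment> \<open>The density vanishes only at zeros of the kernel, so a statement almost
    everywhere under \<open>P z\<close> returns to Lebesgue measure.\<close>
  then have "AE \<xi> in \<mu>. 0 < ennreal (bergman_density \<Omega> z \<xi>) \<longrightarrow> (cmod (?S \<xi>))\<^sup>2 = 0"
    unfolding prob_eq[OF z] using density_integrable[OF z] by (subst (asm) AE_density) auto
  then have AE0: "AE \<xi> in \<mu>. (\<Sum>i\<in>UNIV. x $ i * kderiv [i] z \<xi>) - c * K z \<xi> = 0"
    using K_zero_null[OF z]
  proof eventually_elim
    fix \<xi> assume h: "0 < ennreal (bergman_density \<Omega> z \<xi>) \<longrightarrow> (cmod (?S \<xi>))\<^sup>2 = 0" and k: "K z \<xi> \<noteq> 0"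
    have "bergman_density \<Omega> z \<xi> > 0" using k K_diag_pos[OF z] by (simp add: bergman_density_def)
    then have S0: "?S \<xi> = 0" using h by simp
    have "?S \<xi> * K z \<xi> = (\<Sum>i\<in>UNIV. x $ i * (kderiv [i] z \<xi> - jet [i] [] z * K z \<xi>))"
      using k unfolding sum_distrib_right by (intro sum.cong) (auto simp: score_rep_def kratio_def field_simps)
    also have "\<dots> = (\<Sum>i\<in>UNIV. x $ i * kderiv [i] z \<xi>) - c * K z \<xi>"
      by (simp add: c_def ring_distribs sum_subtractf sum_distrib_right mult.assoc)
    finally show "(\<Sum>i\<in>UNIV. x $ i * kderiv [i] z \<xi>) - c * K z \<xi> = 0" using S0 by simp
  qed
  have test: "(\<Sum>i\<in>UNIV. x $ i * wirt i f z) = c * f z" if f: "f \<in> A2" for f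
  proof -
    let ?T = "\<lambda>\<xi>. (\<Sum>i\<in>UNIV. x $ i * kderiv [i] z \<xi>) - c * K z \<xi>"
    have dk: "kderiv I z \<in> sq_int \<mu>" for I by (rule dominated_kernel_sq_int[OF dominated_kernel_kderiv z])
    have Ts: "?T \<in> sq_int \<mu>"
      using dk[of "[]"] by (intro sq_int_diff sq_int_sum sq_int_cmult dk) simp
    have "ip ?T (\<lambda>\<xi>. cnj (f \<xi>)) = 0"
      unfolding l2_inner_def using AE0 sq_intD(1)[OF Ts]
      by (intro integral_eq_zero_AE) (auto elim!: eventually_mono)
    moreover have "ip ?T (\<lambda>\<xi>. cnj (f \<xi>)) = (\<Sum>i\<in>UNIV. x $ i * ip (kderiv [i] z) (\<lambda>\<xi>. cnj (f \<xi>))) - c * ip (K z) (\<lambda>\<xi>. cnj (f \<xi>))"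
      using dk[of "[]"] derivative_reproducing(3)[OF z f]
      by (simp add: l2_inner_diff_left l2_inner_sum_left l2_inner_cmult_left sq_int_sum sq_int_cmult dk del: kderiv.simps(2))
    ultimately show ?thesis
      by (simp add: derivative_reproducing(2)[OF z f] flip: derivative_reproducing(1)[OF z f] del: kderiv.simps(2))
  qed
  have w1: "wirt i (\<lambda>z. if z \<in> \<Omega> then 1 else 0) z = 0" for i
    using wirt_cong_open(1)[OF open_dom z, of "\<lambda>z. if z \<in> \<Omega> then 1 else 0" "\<lambda>z. 1"] by (simp add: wirt_const)
  have c0: "c = 0" using test[OF one_A2] w1 z by simp
  have wc: "wirt i (\<lambda>z. if z \<in> \<Omega> then z $ j else 0) z = (if i = j then 1 else 0)" for i j
  proof -
    have D: "((\<lambda>w::complex^'n. w $ j) has_derivative (\<lambda>w. w $ j)) (at z)"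
      by (intro bounded_linear_imp_has_derivative bounded_linear_vec_nth)
    have "wirt i (\<lambda>w::complex^'n. w $ j) z = (if i = j then 1 else 0)"
      unfolding wirt_eq[OF D] by (simp add: axis_def)
    then show ?thesis
      using wirt_cong_open(1)[OF open_dom z, of "\<lambda>z. if z \<in> \<Omega> then z $ j else 0" "\<lambda>z. z $ j"] by simp
  qed
  have "x $ j = 0" for j using test[OF coord_A2, of j] by (simp add: wc c0 if_distrib[of "(*) _"] cong: if_cong)
  then show "x = 0" by (simp add: vec_eq_iff)
qed

text \<open>With \<open>T\<close> the transposed metric, this is
  \<open>T ** matrix_inv T = mat 1\<close>, contracting the unbarred index. The normalisation in the
  definition contracts the barred one, from the other side.\<close>

lemma metric_inverse:
  assumes z: "z \<in> \<Omega>"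
  shows "(\<Sum>i\<in>UNIV. bergman_metric_inv \<Omega> i \<epsilon> z * bergman_metric \<Omega> i j z) = (if \<epsilon> = j then 1 else 0)"
proof -
  define T where "T = transpose (\<chi> \<beta> \<delta>. bergman_metric \<Omega> \<beta> \<delta> z)"
  have "T ** matrix_inv T = mat 1"
  proof (rule matrix_inv_right')
    fix x assume "T *v x = 0"
    then have "(\<Sum>i\<in>UNIV. x $ i * bergman_metric \<Omega> i j z) = 0" for j
      by (simp add: T_def matrix_vector_mult_def transpose_def vec_eq_iff mult.commute)
    then show "x = 0" by (rule metric_nondegenerate[OF z])
  qed
  then have "(T ** matrix_inv T) $ j $ \<epsilon> = (if j = \<epsilon> then 1 else 0)" by (simp add: mat_def)
  then show ?thesis
    unfolding bergman_metric_inv_def T_def[symmetric]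
    by (simp add: matrix_matrix_mult_def T_def transpose_def mult.commute eq_commute)
qed

text \<open>Together with \<open>hessian_rep_score_rep\<close> this says that the Christoffel
  combination of scores is the orthogonal projection of the Hessian representative onto the span of
  the scores.\<close>

lemma christoffel_metric:
  assumes z: "z \<in> \<Omega>"
  shows "(\<Sum>i\<in>UNIV. bergman_christoffel \<Omega> i \<alpha> \<gamma> z * bergman_metric \<Omega> i j z) = wirt \<alpha> (bergman_metric \<Omega> \<gamma> j) z"
proof -
  have "(\<Sum>i\<in>UNIV. bergman_christoffel \<Omega> i \<alpha> \<gamma> z * bergman_metric \<Omega> i j z)
     = (\<Sum>i\<in>UNIV. \<Sum>\<epsilon>\<in>UNIV. wirt \<alpha> (bergman_metric \<Omega> \<gamma> \<epsilon>) z * (bergman_metric_inv \<Omega> i \<epsilon> z * bergman_metric \<Omega> i j z))"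
    unfolding bergman_christoffel_def sum_distrib_right by (intro sum.cong refl) (simp add: algebra_simps)
  also have "\<dots> = (\<Sum>\<epsilon>\<in>UNIV. wirt \<alpha> (bergman_metric \<Omega> \<gamma> \<epsilon>) z * (\<Sum>i\<in>UNIV. bergman_metric_inv \<Omega> i \<epsilon> z * bergman_metric \<Omega> i j z))"
    unfolding sum_distrib_left by (rule sum.swap)
  also have "\<dots> = wirt \<alpha> (bergman_metric \<Omega> \<gamma> j) z"
    unfolding metric_inverse[OF z] by (simp add: if_distrib[of "(*) _"] cong: if_cong)
  finally show ?thesis .
qed

section \<open>The normal component and the curvature\<close>

lemma normal_rep_mean: "z \<in> \<Omega> \<Longrightarrow> l2_inner (P z) (normal_rep z \<alpha> \<gamma>) (kratio z []) = 0"
  unfolding normal_rep_def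
  by (simp add: l2_inner_diff_left l2_inner_sum_left l2_inner_cmult_left hessian_rep_sq_int score_rep_sq_int sq_int_cmult
      score_rep_sum_sq_int kratio_sq_int hessian_rep_mean score_rep_mean)

lemma normal_rep_score_rep: "z \<in> \<Omega> \<Longrightarrow> l2_inner (P z) (normal_rep z \<alpha> \<gamma>) (score_rep z j) = 0"
  unfolding normal_rep_def
  by (simp add: l2_inner_diff_left l2_inner_sum_left l2_inner_cmult_left hessian_rep_sq_int score_rep_sq_int sq_int_cmult
      score_rep_sum_sq_int hessian_rep_score_rep score_rep_score_rep christoffel_metric)

text \<open>Orthogonality to the scores lets the second factor be replaced by its Hessian
  representative. A single Christoffel sum survives, the one that \<open>curvature_eq\<close> finds
  in the curvature.\<close>

lemma normal_rep_normal_rep: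
  assumes z: "z \<in> \<Omega>"
  shows "l2_inner (P z) (normal_rep z \<alpha> \<gamma>) (normal_rep z \<beta> \<delta>) = wirt \<alpha> (wirt_bar \<beta> (bergman_metric \<Omega> \<gamma> \<delta>)) z
     + bergman_metric \<Omega> \<alpha> \<beta> z * bergman_metric \<Omega> \<gamma> \<delta> z + bergman_metric \<Omega> \<alpha> \<delta> z * bergman_metric \<Omega> \<gamma> \<beta> z
     - (\<Sum>i\<in>UNIV. bergman_christoffel \<Omega> i \<alpha> \<gamma> z * wirt_bar \<beta> (bergman_metric \<Omega> i \<delta>) z)"
proof -
  have "l2_inner (P z) (normal_rep z \<alpha> \<gamma>) (normal_rep z \<beta> \<delta>) = l2_inner (P z) (normal_rep z \<alpha> \<gamma>) (hessian_rep z \<beta> \<delta>)"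
    unfolding normal_rep_def[of z \<beta> \<delta>]
    by (simp add: l2_inner_diff_right l2_inner_sum_right l2_inner_cmult_right hessian_rep_sq_int score_rep_sq_int sq_int_cmult
      score_rep_sum_sq_int normal_rep_sq_int normal_rep_score_rep z)
  also have "\<dots> = l2_inner (P z) (hessian_rep z \<alpha> \<gamma>) (hessian_rep z \<beta> \<delta>)
      - (\<Sum>i\<in>UNIV. bergman_christoffel \<Omega> i \<alpha> \<gamma> z * wirt_bar \<beta> (bergman_metric \<Omega> i \<delta>) z)"
    unfolding normal_rep_def
    by (simp add: l2_inner_diff_left l2_inner_sum_left l2_inner_cmult_left hessian_rep_sq_int score_rep_sq_int sq_int_cmult
      score_rep_sum_sq_int score_rep_hessian_rep z)
  finally show ?thesis by (simp add: hessian_rep_hessian_rep z)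
qed

lemma curvature_eq:
  "bergman_curvature \<Omega> \<alpha> \<beta> \<gamma> \<delta> z = - wirt \<alpha> (wirt_bar \<beta> (bergman_metric \<Omega> \<gamma> \<delta>)) z
     + (\<Sum>i\<in>UNIV. bergman_christoffel \<Omega> i \<alpha> \<gamma> z * wirt_bar \<beta> (bergman_metric \<Omega> i \<delta>) z)"
  unfolding bergman_curvature_def bergman_christoffel_def sum_distrib_right by simp

lemma normal_field_Cov:
  assumes z: "z \<in> \<Omega>"
  shows "Cov_exists \<Omega> z (normal_field \<Omega> z \<alpha> \<gamma>) (normal_field \<Omega> z \<beta> \<delta>)"
    "bergman_curvature \<Omega> \<alpha> \<beta> \<gamma> \<delta> z =
       bergman_metric \<Omega> \<alpha> \<beta> z * bergman_metric \<Omega> \<gamma> \<delta> z + bergman_metric \<Omega> \<alpha> \<delta> z * bergman_metric \<Omega> \<gamma> \<beta> z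
       - Cov \<Omega> z (normal_field \<Omega> z \<alpha> \<gamma>) (normal_field \<Omega> z \<beta> \<delta>)"
    "normal_field \<Omega> z \<alpha> \<gamma> \<in> tangent_prob (P z)"
    "orthogonal_to_model \<Omega> z (normal_field \<Omega> z \<alpha> \<gamma>)"
proof -
  note A = AE_representative[OF z normal_field_AE[OF z] normal_rep_sq_int[OF z] normal_field_AE[OF z] normal_rep_sq_int[OF z]]
  note B = AE_representative[OF z normal_field_AE[OF z] normal_rep_sq_int[OF z] score_AE[OF z] score_rep_sq_int[OF z]]
  show "Cov_exists \<Omega> z (normal_field \<Omega> z \<alpha> \<gamma>) (normal_field \<Omega> z \<beta> \<delta>)"
    unfolding Cov_exists_def using A(1,2) by blast
  show "bergman_curvature \<Omega> \<alpha> \<beta> \<gamma> \<delta> z =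
       bergman_metric \<Omega> \<alpha> \<beta> z * bergman_metric \<Omega> \<gamma> \<delta> z + bergman_metric \<Omega> \<alpha> \<delta> z * bergman_metric \<Omega> \<gamma> \<beta> z
       - Cov \<Omega> z (normal_field \<Omega> z \<alpha> \<gamma>) (normal_field \<Omega> z \<beta> \<delta>)"
    unfolding Cov_def A(3,5) curvature_eq by (simp add: normal_rep_mean normal_rep_normal_rep z)
  show "normal_field \<Omega> z \<alpha> \<gamma> \<in> tangent_prob (P z)"
    unfolding tangent_prob_def using A(1,4) by (simp add: normal_rep_mean z)
  show "orthogonal_to_model \<Omega> z (normal_field \<Omega> z \<alpha> \<gamma>)"
    unfolding orthogonal_to_model_def using B(2,5) by (simp add: normal_rep_score_rep z)
qed

end

section \<open>The statistical model\<close>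

lemma signed_density_diff:
  assumes "integrable M f" "integrable M g"
  shows "signed_density M f A - signed_density M g A = signed_density M (\<lambda>x. f x - g x) A"
proof (cases "A \<in> sets M")
  case True
  then have "set_integrable M A f" "set_integrable M A g"
    using assms integrable_mult_indicator unfolding set_integrable_def by blast+
  then show ?thesis using True by (simp add: signed_density_def)
qed (simp add: signed_density_def)

lemma sum_abs_signed_density_le:
  assumes \<phi>: "integrable M \<phi>" and \<A>: "finite \<A>" "\<A> \<subseteq> sets M" "disjoint \<A>"
  shows "(\<Sum>A\<in>\<A>. \<bar>signed_density M \<phi> A\<bar>) \<le> (\<integral>x. \<bar>\<phi> x\<bar> \<partial>M)"
proof -
  have i: "integrable M (\<lambda>x. indicator A x * \<bar>\<phi> x\<bar>)" if "A \<in> \<A>" for A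
    using integrable_mult_indicator[of A M "\<lambda>x. \<bar>\<phi> x\<bar>"] that \<A>(2) \<phi> by auto
  have "\<bar>signed_density M \<phi> A\<bar> \<le> (\<integral>x. indicator A x * \<bar>\<phi> x\<bar> \<partial>M)" if "A \<in> \<A>" for A
  proof -
    have "\<bar>signed_density M \<phi> A\<bar> = \<bar>\<integral>x. indicator A x * \<phi> x \<partial>M\<bar>"
      using that \<A>(2) by (auto simp: signed_density_def set_lebesgue_integral_def)
    also have "\<dots> \<le> (\<integral>x. \<bar>indicator A x * \<phi> x\<bar> \<partial>M)" by (rule integral_abs_bound)
    finally show ?thesis by (simp add: abs_mult)
  qed
  then have "(\<Sum>A\<in>\<A>. \<bar>signed_density M \<phi> A\<bar>) \<le> (\<Sum>A\<in>\<A>. \<integral>x. indicator A x * \<bar>\<phi> x\<bar> \<partial>M)"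
    by (rule sum_mono)
  also have "\<dots> = (\<integral>x. (\<Sum>A\<in>\<A>. indicator A x * \<bar>\<phi> x\<bar>) \<partial>M)"
    by (rule Bochner_Integration.integral_sum[symmetric, OF i])
  also have "\<dots> \<le> (\<integral>x. \<bar>\<phi> x\<bar> \<partial>M)"
  proof (rule integral_mono)
    show "integrable M (\<lambda>x. \<Sum>A\<in>\<A>. indicator A x * \<bar>\<phi> x\<bar>)" by (rule Bochner_Integration.integrable_sum[OF i])
    show "integrable M (\<lambda>x. \<bar>\<phi> x\<bar>)" using \<phi> by simp
    fix x
    have "disjoint_family_on (\<lambda>A. A) \<A>" using \<A>(3) by (auto simp: disjoint_def disjoint_family_on_def)
    then have "(\<Sum>A\<in>\<A>. indicator A x :: real) = indicator (\<Union>((\<lambda>A. A) ` \<A>)) x"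
      by (simp only: indicator_UN_disjoint[OF \<A>(1)])
    then have "(\<Sum>A\<in>\<A>. indicator A x :: real) \<le> 1" by (simp add: indicator_def)
    then have "(\<Sum>A\<in>\<A>. indicator A x) * \<bar>\<phi> x\<bar> \<le> 1 * \<bar>\<phi> x\<bar>" by (intro mult_right_mono) auto
    then show "(\<Sum>A\<in>\<A>. indicator A x * \<bar>\<phi> x\<bar>) \<le> \<bar>\<phi> x\<bar>" by (simp add: sum_distrib_right)
  qed
  finally show ?thesis .
qed

text \<open>Estimates in total variation are all reduced to the mean of \<open>|\<phi>|\<close>. The
  bound also keeps the supremum over partitions meaningful, and the empty family gives
  nonnegativity.\<close>

lemma tv_norm_signed_density:
  assumes "integrable M \<phi>"
  shows "tv_norm M (signed_density M \<phi>) \<le> (\<integral>x. \<bar>\<phi> x\<bar> \<partial>M)" "0 \<le> tv_norm M (signed_density M \<phi>)"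
proof -
  let ?F = "{\<A>. finite \<A> \<and> \<A> \<subseteq> sets M \<and> disjoint \<A>}"
  have b: "(\<Sum>A\<in>\<A>. \<bar>signed_density M \<phi> A\<bar>) \<le> (\<integral>x. \<bar>\<phi> x\<bar> \<partial>M)" if "\<A> \<in> ?F" for \<A>
    using that sum_abs_signed_density_le[OF assms, of \<A>] by blast
  have e: "{} \<in> ?F" by simp
  show "tv_norm M (signed_density M \<phi>) \<le> (\<integral>x. \<bar>\<phi> x\<bar> \<partial>M)"
    unfolding tv_norm_def by (rule cSUP_least) (use b e in blast)+
  have "bdd_above ((\<lambda>\<A>. \<Sum>A\<in>\<A>. \<bar>signed_density M \<phi> A\<bar>) ` ?F)"
    by (rule bdd_aboveI2) (rule b)
  then show "0 \<le> tv_norm M (signed_density M \<phi>)"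
    unfolding tv_norm_def using cSUP_upper[OF e, of "\<lambda>\<A>. \<Sum>A\<in>\<A>. \<bar>signed_density M \<phi> A\<bar>"] by simp
qed

lemma norm_product_bound:
  assumes "(norm a)\<^sup>2 \<le> A * t\<^sup>2" "(norm b)\<^sup>2 \<le> A" "t \<ge> 0"
  shows "norm a * norm b \<le> A * t"
proof -
  have A: "A \<ge> 0" using assms(2) zero_le_power2[of "norm b"] by linarith
  have "(norm a * norm b)\<^sup>2 \<le> (A * t\<^sup>2) * A"
    unfolding power_mult_distrib using assms A by (intro mult_mono) auto
  also have "\<dots> = (A * t)\<^sup>2" by (simp add: power2_eq_square)
  finally show ?thesis by (rule power2_le_imp_le) (use assms A in simp)
qed

section \<open>The derivative of the Bergman density\<close>

context bergman_domain
begin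

definition \<kappa> :: "complex^'n \<Rightarrow> real" where "\<kappa> z = Re (K z z)"

definition \<kappa>d :: "complex^'n \<Rightarrow> complex^'n \<Rightarrow> real" where
  "\<kappa>d z v = 2 * Re (ip (dir_deriv v K z) (K z))"

lemma kappa_pos: "z \<in> \<Omega> \<Longrightarrow> \<kappa> z > 0"
  by (simp add: \<kappa>_def K_diag_pos)

lemma kappa_has_derivative:
  assumes z: "z \<in> \<Omega>" shows "(\<kappa> has_derivative \<kappa>d z) (at z)"
proof -
  have "((\<lambda>w. Re (ip (K w) (K w))) has_derivative (\<lambda>v. Re (ip (dir_deriv v K z) (K z) + ip (K z) (dir_deriv v K z)))) (at z)"
    by (rule has_derivative_Re[OF has_derivative_gram[OF dominated_kernel_K dominated_kernel_K z]])
  moreover have "Re (ip (dir_deriv v K z) (K z) + ip (K z) (dir_deriv v K z)) = \<kappa>d z v" for v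
    using l2_inner_cnj[of \<mu> "dir_deriv v K z" "K z"] by (metis (no_types) \<kappa>d_def cnj.sel(1) mult_2 plus_complex.sel(1))
  ultimately have "((\<lambda>w. Re (ip (K w) (K w))) has_derivative \<kappa>d z) (at z)" by simp
  then show ?thesis
    by (rule has_derivative_transform_within_open[OF _ open_dom z])
       (simp add: \<kappa>_def l2_inner_self K_diag)
qed

lemma kappa_isCont: "z \<in> \<Omega> \<Longrightarrow> isCont \<kappa> z"
  using kappa_has_derivative has_derivative_continuous by blast

lemma kappad_isCont: "z \<in> \<Omega> \<Longrightarrow> isCont (\<lambda>w. \<kappa>d w v) z"
  unfolding \<kappa>d_def
  using has_derivative_continuous[OF has_derivative_gram[OF dominated_kernel_dir_deriv[OF dominated_kernel_K] dominated_kernel_K]]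
  by (intro continuous_intros continuous_Re) blast

definition density_deriv :: "complex^'n \<Rightarrow> complex^'n \<Rightarrow> complex^'n \<Rightarrow> real" where
  "density_deriv z \<xi> v = 2 * (K z \<xi> \<bullet> dir_deriv v K z \<xi>) / \<kappa> z - (cmod (K z \<xi>))\<^sup>2 * \<kappa>d z v / (\<kappa> z)\<^sup>2"

lemma density_kappa: "bergman_density \<Omega> z \<xi> = (cmod (K z \<xi>))\<^sup>2 / \<kappa> z"
  by (simp add: bergman_density_def \<kappa>_def)

lemma density_has_derivative:
  assumes z: "z \<in> \<Omega>" and x: "\<xi> \<in> \<Omega>"
  shows "((\<lambda>w. bergman_density \<Omega> w \<xi>) has_derivative density_deriv z \<xi>) (at z)"
proof -
  have D: "((\<lambda>w. K w \<xi>) has_derivative (\<lambda>v. dir_deriv v K z \<xi>)) (at z)"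
    unfolding dir_deriv_def by (rule holomorphic_Cn_frechet(1)[OF K_holomorphic[OF x] z])
  have "((\<lambda>w. (K w \<xi> \<bullet> K w \<xi>) / \<kappa> w) has_derivative
      (\<lambda>v. ((K z \<xi> \<bullet> dir_deriv v K z \<xi> + dir_deriv v K z \<xi> \<bullet> K z \<xi>) * \<kappa> z - (K z \<xi> \<bullet> K z \<xi>) * \<kappa>d z v) / (\<kappa> z * \<kappa> z))) (at z)"
    using kappa_pos[OF z] by (intro has_derivative_divide' has_derivative_inner D kappa_has_derivative z) simp
  moreover have "((K z \<xi> \<bullet> dir_deriv v K z \<xi> + dir_deriv v K z \<xi> \<bullet> K z \<xi>) * \<kappa> z - (K z \<xi> \<bullet> K z \<xi>) * \<kappa>d z v) / (\<kappa> z * \<kappa> z) = density_deriv z \<xi> v" for v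
    using kappa_pos[OF z]
    by (simp add: density_deriv_def inner_commute[of "dir_deriv v K z \<xi>"] diff_divide_distrib power2_eq_square dot_square_norm)
  ultimately show ?thesis by (simp add: density_kappa dot_square_norm)
qed

lemma density_deriv_linear: "z \<in> \<Omega> \<Longrightarrow> \<xi> \<in> \<Omega> \<Longrightarrow> linear (density_deriv z \<xi>)"
  using density_has_derivative has_derivative_linear by blast

lemma density_deriv_measurable: "z \<in> \<Omega> \<Longrightarrow> (\<lambda>\<xi>. density_deriv z \<xi> v) \<in> borel_measurable \<mu>"
  unfolding density_deriv_def[abs_def] using dominated_kernelD(2)[OF dominated_kernel_K, of z] dominated_kernelD(2)[OF dominated_kernel_dir_deriv[OF dominated_kernel_K, of v], of z]
  by measurable

lemma density_deriv_isCont: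
  assumes z: "z \<in> \<Omega>" and x: "\<xi> \<in> \<Omega>" shows "isCont (\<lambda>w. density_deriv w \<xi> v) z"
proof -
  have 1: "isCont (\<lambda>w. K w \<xi>) z" "isCont (\<lambda>w. dir_deriv v K w \<xi>) z"
    using holomorphic_Cn_imp_differentiable[OF dominated_kernelD(1)[OF dominated_kernel_K x] z]
      holomorphic_Cn_imp_differentiable[OF dominated_kernelD(1)[OF dominated_kernel_dir_deriv[OF dominated_kernel_K, of v] x] z]
    by (auto intro: differentiable_imp_continuous_within)
  show ?thesis unfolding density_deriv_def
    using 1 kappa_isCont[OF z] kappad_isCont[OF z] kappa_pos[OF z] by (intro continuous_intros) auto
qed

text \<open>The first bound drives differentiability in total variation. The second keeps a factor
  of the density, so that the squared derivative divided by the density, the integrand of the Fisher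
  information, stays bounded by an integrable function near the zeros of the kernel.\<close>

lemma density_deriv_bound:
  assumes z: "z \<in> \<Omega>"
  obtains r C where "r > 0" "cball z r \<subseteq> \<Omega>" "integrable \<mu> C"
    "\<And>w \<xi> v. w \<in> cball z r \<Longrightarrow> \<xi> \<in> \<Omega> \<Longrightarrow> \<bar>density_deriv w \<xi> v\<bar> \<le> C \<xi> * norm v"
    "\<And>w \<xi> v. w \<in> cball z r \<Longrightarrow> \<xi> \<in> \<Omega> \<Longrightarrow> (density_deriv w \<xi> v)\<^sup>2 \<le> C \<xi> * (norm v)\<^sup>2 * bergman_density \<Omega> w \<xi>"
proof -
  obtain r1 M where 1: "r1 > 0" "cball z r1 \<subseteq> \<Omega>" "integrable \<mu> M"
    "\<And>w \<xi>. w \<in> cball z r1 \<Longrightarrow> \<xi> \<in> \<Omega> \<Longrightarrow> (cmod (K w \<xi>))\<^sup>2 \<le> M \<xi>"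
    "\<And>w \<xi> v. w \<in> cball z r1 \<Longrightarrow> \<xi> \<in> \<Omega> \<Longrightarrow> (cmod (dir_deriv v K w \<xi>))\<^sup>2 \<le> M \<xi> * (norm v)\<^sup>2"
    unfolding dir_deriv_def by (rule dominated_kernel_deriv_bound[OF dominated_kernel_K z]) (blast intro: that)
  \<comment> \<open>By continuity the diagonal value stays above half its value at \<open>z\<close>,
    which controls the denominators.\<close>
  define k where "k = \<kappa> z / 2"
  have k: "k > 0" using kappa_pos[OF z] by (simp add: k_def)
  obtain d where d: "d > 0" "\<And>w. dist w z < d \<Longrightarrow> dist (\<kappa> w) (\<kappa> z) < k"
    using kappa_isCont[OF z] k unfolding continuous_at_eps_delta by blast
  define r where "r = min r1 (d / 2)"
  have r: "r > 0" using 1 d by (simp add: r_def)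
  have rb: "w \<in> cball z r1" "w \<in> \<Omega>" "\<kappa> w \<ge> k" if "w \<in> cball z r" for w
  proof -
    show w1: "w \<in> cball z r1" using that by (simp add: r_def)
    then show "w \<in> \<Omega>" using 1(2) by blast
    have "dist w z < d" using that d(1) by (simp add: r_def dist_commute)
    then have "\<bar>\<kappa> w - \<kappa> z\<bar> < k" using d(2) by (simp add: dist_real_def)
    then show "\<kappa> w \<ge> k" unfolding k_def by linarith
  qed
  define L where "L = 2 * (\<integral>\<xi>. M \<xi> \<partial>\<mu>)"
  have prod: "cmod (dir_deriv v K w \<xi>) * cmod (K w \<xi>) \<le> M \<xi> * norm v" if "w \<in> cball z r" "\<xi> \<in> \<Omega>" for w \<xi> v
    using 1(5)[OF rb(1)[OF that(1)] that(2)] 1(4)[OF rb(1)[OF that(1)] that(2)] by (rule norm_product_bound) simp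
  have M0: "M \<xi> \<ge> 0" if "\<xi> \<in> \<Omega>" for \<xi>
    by (rule order_trans[OF zero_le_power2 1(4)[of z]]) (use 1(1) that in auto)
  have L0: "L \<ge> 0" unfolding L_def using M0 by (intro mult_nonneg_nonneg Bochner_Integration.integral_nonneg) auto
  have kd: "\<bar>\<kappa>d w v\<bar> \<le> L * norm v" if w: "w \<in> cball z r" for w v
  proof -
    have "cmod (ip (dir_deriv v K w) (K w)) \<le> (\<integral>\<xi>. cmod (dir_deriv v K w \<xi> * cnj (K w \<xi>)) \<partial>\<mu>)"
      unfolding l2_inner_def by (rule integral_norm_bound)
    also have "\<dots> \<le> (\<integral>\<xi>. M \<xi> * norm v \<partial>\<mu>)"
    proof (rule integral_mono)
      show "integrable \<mu> (\<lambda>\<xi>. cmod (dir_deriv v K w \<xi> * cnj (K w \<xi>)))"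
        by (intro integrable_norm sq_int_mult_integrable dominated_kernel_sq_int dominated_kernel_dir_deriv dominated_kernel_K rb(2)[OF w])
      show "integrable \<mu> (\<lambda>\<xi>. M \<xi> * norm v)" using 1(3) by simp
      show "cmod (dir_deriv v K w \<xi> * cnj (K w \<xi>)) \<le> M \<xi> * norm v" if "\<xi> \<in> space \<mu>" for \<xi>
        using prod[OF w, of \<xi> v] that by (simp add: norm_mult)
    qed
    finally have "cmod (ip (dir_deriv v K w) (K w)) \<le> (\<integral>\<xi>. M \<xi> \<partial>\<mu>) * norm v" by simp
    then show ?thesis
      using abs_Re_le_cmod[of "ip (dir_deriv v K w) (K w)"] by (simp add: \<kappa>d_def L_def abs_mult)
  qed
  \<comment> \<open>\<open>c1\<close> collects the two terms of the quotient rule. \<open>c2\<close>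
    comes from squaring them with \<open>(x + y)^2 <= 2 x^2 + 2 y^2\<close>, after one factor
    \<open>1 / s\<close> has gone into the density.\<close>
  define c1 where "c1 = 2 / k + L / k\<^sup>2"
  define c2 where "c2 = 8 / k + 2 * L\<^sup>2 / k ^ 3"
  have c: "c1 \<ge> 0" "c2 \<ge> 0" using k L0 by (auto simp: c1_def c2_def)
  define C where "C = (\<lambda>\<xi>. M \<xi> * (c1 + c2))"
  have inner: "\<bar>K w \<xi> \<bullet> dir_deriv v K w \<xi>\<bar> \<le> cmod (dir_deriv v K w \<xi>) * cmod (K w \<xi>)" for w \<xi> v
    using Cauchy_Schwarz_ineq2[of "K w \<xi>" "dir_deriv v K w \<xi>"] by (simp add: mult.commute)
  have dPle: "\<bar>density_deriv w \<xi> v\<bar> \<le> C \<xi> * norm v" if w: "w \<in> cball z r" and x: "\<xi> \<in> \<Omega>" for w \<xi> v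
  proof -
    have "\<bar>density_deriv w \<xi> v\<bar> \<le> \<bar>2 * (K w \<xi> \<bullet> dir_deriv v K w \<xi>) / \<kappa> w\<bar> + \<bar>(cmod (K w \<xi>))\<^sup>2 * \<kappa>d w v / (\<kappa> w)\<^sup>2\<bar>"
      unfolding density_deriv_def by (rule abs_triangle_ineq4)
    also have "\<bar>2 * (K w \<xi> \<bullet> dir_deriv v K w \<xi>) / \<kappa> w\<bar> \<le> 2 * (M \<xi> * norm v) / k"
    proof -
      have "\<bar>2 * (K w \<xi> \<bullet> dir_deriv v K w \<xi>) / \<kappa> w\<bar> = 2 * \<bar>K w \<xi> \<bullet> dir_deriv v K w \<xi>\<bar> / \<kappa> w"
        using rb(3)[OF w] k by (simp add: abs_mult)
      also have "\<dots> \<le> 2 * (M \<xi> * norm v) / k"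
        using order_trans[OF inner prod[OF w x]] rb(3)[OF w] k M0[OF x] by (intro frac_le) auto
      finally show ?thesis .
    qed
    also have "\<bar>(cmod (K w \<xi>))\<^sup>2 * \<kappa>d w v / (\<kappa> w)\<^sup>2\<bar> \<le> M \<xi> * (L * norm v) / k\<^sup>2"
    proof -
      have "\<bar>(cmod (K w \<xi>))\<^sup>2 * \<kappa>d w v / (\<kappa> w)\<^sup>2\<bar> = (cmod (K w \<xi>))\<^sup>2 * \<bar>\<kappa>d w v\<bar> / (\<kappa> w)\<^sup>2"
        by (simp add: abs_mult)
      also have "\<dots> \<le> M \<xi> * (L * norm v) / k\<^sup>2"
        using rb(3)[OF w] k M0[OF x] L0 by (intro frac_le mult_mono 1(4) kd power_mono rb(1) w x) auto
      finally show ?thesis .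
    qed
    finally have "\<bar>density_deriv w \<xi> v\<bar> \<le> M \<xi> * c1 * norm v" by (simp add: c1_def algebra_simps)
    also have "\<dots> \<le> C \<xi> * norm v"
      unfolding C_def using c M0[OF x] by (intro mult_right_mono mult_left_mono) auto
    finally show ?thesis by simp
  qed
  have dPsq: "(density_deriv w \<xi> v)\<^sup>2 \<le> C \<xi> * (norm v)\<^sup>2 * bergman_density \<Omega> w \<xi>"
    if w: "w \<in> cball z r" and x: "\<xi> \<in> \<Omega>" for w \<xi> v
  proof -
    define a where "a = cmod (K w \<xi>)"
    define b where "b = cmod (dir_deriv v K w \<xi>)"
    define s where "s = \<kappa> w"
    have s: "s \<ge> k" "s > 0" using rb(3)[OF w] k by (auto simp: s_def)
    have a2: "a\<^sup>2 \<le> M \<xi>" unfolding a_def by (rule 1(4)[OF rb(1)[OF w] x])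
    have b2: "b\<^sup>2 \<le> M \<xi> * (norm v)\<^sup>2" unfolding b_def by (rule 1(5)[OF rb(1)[OF w] x])
    have "\<bar>density_deriv w \<xi> v\<bar> \<le> \<bar>2 * (K w \<xi> \<bullet> dir_deriv v K w \<xi>) / s\<bar> + \<bar>a\<^sup>2 * \<kappa>d w v / s\<^sup>2\<bar>"
      unfolding density_deriv_def a_def s_def by (rule abs_triangle_ineq4)
    also have "\<bar>2 * (K w \<xi> \<bullet> dir_deriv v K w \<xi>) / s\<bar> \<le> 2 * (b * a) / s"
      using inner[of w \<xi> v] s by (simp add: abs_mult a_def b_def divide_right_mono)
    also have "\<bar>a\<^sup>2 * \<kappa>d w v / s\<^sup>2\<bar> \<le> a\<^sup>2 * (L * norm v) / s\<^sup>2"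
      using kd[OF w, of v] by (simp add: abs_mult divide_right_mono mult_left_mono)
    \<comment> \<open>One factor \<open>a\<close> is split off: its square together with
      \<open>1 / s\<close> from the squared bracket is the density.\<close>
    also have "2 * (b * a) / s + a\<^sup>2 * (L * norm v) / s\<^sup>2 = a * (2 * b / s + a * L * norm v / s\<^sup>2)"
      by (simp add: algebra_simps power2_eq_square)
    finally have "\<bar>density_deriv w \<xi> v\<bar>\<^sup>2 \<le> (a * (2 * b / s + a * L * norm v / s\<^sup>2))\<^sup>2"
      by (intro power_mono) auto
    also have "\<dots> = a\<^sup>2 * (2 * b / s + a * L * norm v / s\<^sup>2)\<^sup>2" by (simp add: power_mult_distrib)
    also have "(2 * b / s + a * L * norm v / s\<^sup>2)\<^sup>2 \<le> 2 * (2 * b / s)\<^sup>2 + 2 * (a * L * norm v / s\<^sup>2)\<^sup>2"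
      using sum_squares_bound[of "2 * b / s" "a * L * norm v / s\<^sup>2"] by (simp add: power2_sum)
    also have "\<dots> = (8 * b\<^sup>2 / s + 2 * L\<^sup>2 * (a\<^sup>2 * (norm v)\<^sup>2) / s ^ 3) / s"
      using s by (simp add: power_mult_distrib power_divide add_divide_distrib power2_eq_square power3_eq_cube mult_ac)
    also have "\<dots> \<le> (8 * (M \<xi> * (norm v)\<^sup>2) / k + 2 * L\<^sup>2 * (M \<xi> * (norm v)\<^sup>2) / k ^ 3) / s"
      using s k M0[OF x] a2 b2
      by (intro divide_right_mono add_mono frac_le mult_left_mono mult_right_mono power_mono) auto
    also have "\<dots> = M \<xi> * c2 * (norm v)\<^sup>2 / s" by (simp add: c2_def algebra_simps)
    finally have "(density_deriv w \<xi> v)\<^sup>2 \<le> a\<^sup>2 * (M \<xi> * c2 * (norm v)\<^sup>2 / s)" by (simp add: mult_left_mono)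
    also have "\<dots> = M \<xi> * c2 * (norm v)\<^sup>2 * bergman_density \<Omega> w \<xi>"
      by (simp add: density_kappa a_def s_def)
    also have "\<dots> \<le> C \<xi> * (norm v)\<^sup>2 * bergman_density \<Omega> w \<xi>"
      unfolding C_def using c M0[OF x] density_nonneg[OF rb(2)[OF w]] by (intro mult_right_mono mult_left_mono) auto
    finally show ?thesis .
  qed
  have "cball z r \<subseteq> \<Omega>" using rb(2) by blast
  moreover have "integrable \<mu> C" unfolding C_def using 1(3) by simp
  ultimately show ?thesis using that[OF r _ _ dPle dPsq] by blast
qed

lemma density_deriv_integrable:
  assumes z: "z \<in> \<Omega>" shows "integrable \<mu> (\<lambda>\<xi>. density_deriv z \<xi> v)"
proof -
  obtain r C where "r > 0" "cball z r \<subseteq> \<Omega>" "integrable \<mu> C"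
    and C: "\<And>w \<xi> v. w \<in> cball z r \<Longrightarrow> \<xi> \<in> \<Omega> \<Longrightarrow> \<bar>density_deriv w \<xi> v\<bar> \<le> C \<xi> * norm v"
    and "\<And>w \<xi> v. w \<in> cball z r \<Longrightarrow> \<xi> \<in> \<Omega> \<Longrightarrow> (density_deriv w \<xi> v)\<^sup>2 \<le> C \<xi> * (norm v)\<^sup>2 * bergman_density \<Omega> w \<xi>"
    by (rule density_deriv_bound[OF z]) (blast intro: that)
  show ?thesis
  proof (rule Bochner_Integration.integrable_bound[OF _ density_deriv_measurable[OF z]])
    show "integrable \<mu> (\<lambda>\<xi>. C \<xi> * norm v)" using \<open>integrable \<mu> C\<close> by simp
    show "AE \<xi> in \<mu>. norm (density_deriv z \<xi> v) \<le> norm (C \<xi> * norm v)"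
    proof (rule AE_I2)
      fix \<xi> assume "\<xi> \<in> space \<mu>"
      then have "\<bar>density_deriv z \<xi> v\<bar> \<le> C \<xi> * norm v" using C[of z \<xi> v] \<open>r > 0\<close> by simp
      then show "norm (density_deriv z \<xi> v) \<le> norm (C \<xi> * norm v)" by simp
    qed
  qed
qed

section \<open>Differentiability in total variation\<close>

definition model_deriv :: "complex^'n \<Rightarrow> complex^'n \<Rightarrow> (complex^'n) set \<Rightarrow> real" where
  "model_deriv z v = signed_density \<mu> (\<lambda>\<xi>. density_deriv z \<xi> v)"

text \<open>The remainder is a signed measure with a density, so its total variation is at most the
  mean of the modulus and \<open>L1_derivative\<close> applies.\<close>

lemma model_has_tv_derivative:
  assumes z: "z \<in> \<Omega>"
  shows "has_tv_derivative \<mu> (bergman_model \<Omega>) (model_deriv z) z"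
proof -
  obtain r C where r: "r > 0" "cball z r \<subseteq> \<Omega>" and Ci: "integrable \<mu> C"
    and C: "\<And>w \<xi> v. w \<in> cball z r \<Longrightarrow> \<xi> \<in> \<Omega> \<Longrightarrow> \<bar>density_deriv w \<xi> v\<bar> \<le> C \<xi> * norm v"
    and "\<And>w \<xi> v. w \<in> cball z r \<Longrightarrow> \<xi> \<in> \<Omega> \<Longrightarrow> (density_deriv w \<xi> v)\<^sup>2 \<le> C \<xi> * (norm v)\<^sup>2 * bergman_density \<Omega> w \<xi>"
    by (rule density_deriv_bound[OF z]) (blast intro: that)
  have bO: "w \<in> \<Omega>" "w \<in> cball z r" if "w \<in> ball z r" for w using that r by auto
  show ?thesis
    unfolding has_tv_derivative_def
  proof (intro conjI allI)
    show "model_deriv z v \<in> ac_signed_measures \<mu>" for v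
      unfolding model_deriv_def ac_signed_measures_def using density_deriv_integrable[OF z] by blast
    show "linear (\<lambda>v. model_deriv z v A)" for A
    proof (cases "A \<in> sets \<mu>")
      case True
      have i: "integrable \<mu> (\<lambda>\<xi>. indicator A \<xi> * density_deriv z \<xi> v)" for v
        using integrable_mult_indicator[OF True density_deriv_integrable[OF z]] by simp
      show ?thesis
      proof (rule linearI)
        fix v w and c :: real
        have "(\<integral>\<xi>. indicator A \<xi> * density_deriv z \<xi> (v + w) \<partial>\<mu>) = (\<integral>\<xi>. indicator A \<xi> * density_deriv z \<xi> v + indicator A \<xi> * density_deriv z \<xi> w \<partial>\<mu>)"
          using linear_add[OF density_deriv_linear[OF z]] by (intro Bochner_Integration.integral_cong) (auto simp: algebra_simps)
        then show "model_deriv z (v + w) A = model_deriv z v A + model_deriv z w A"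
          using True i by (simp add: model_deriv_def signed_density_def set_lebesgue_integral_def)
        have "(\<integral>\<xi>. indicator A \<xi> * density_deriv z \<xi> (c *\<^sub>R v) \<partial>\<mu>) = (\<integral>\<xi>. c * (indicator A \<xi> * density_deriv z \<xi> v) \<partial>\<mu>)"
          using linear_scale[OF density_deriv_linear[OF z]] by (intro Bochner_Integration.integral_cong) (auto simp: algebra_simps)
        then show "model_deriv z (c *\<^sub>R v) A = c *\<^sub>R model_deriv z v A"
          using True i by (simp add: model_deriv_def signed_density_def set_lebesgue_integral_def)
      qed
    qed (simp add: model_deriv_def signed_density_def linear_zero)
    show "\<exists>B. \<forall>v. tv_norm \<mu> (model_deriv z v) \<le> B * norm v"
    proof (intro exI allI)
      fix v
      have "tv_norm \<mu> (model_deriv z v) \<le> (\<integral>\<xi>. \<bar>density_deriv z \<xi> v\<bar> \<partial>\<mu>)"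
        unfolding model_deriv_def by (rule tv_norm_signed_density(1)[OF density_deriv_integrable[OF z]])
      also have "\<dots> \<le> (\<integral>\<xi>. C \<xi> * norm v \<partial>\<mu>)"
        using C[of z] r density_deriv_integrable[OF z, of v] Ci by (intro integral_mono) auto
      finally show "tv_norm \<mu> (model_deriv z v) \<le> (\<integral>\<xi>. C \<xi> \<partial>\<mu>) * norm v" by simp
    qed
    have lim: "((\<lambda>h. (\<integral>\<xi>. norm (bergman_density \<Omega> (z + h) \<xi> - bergman_density \<Omega> z \<xi> - density_deriv z \<xi> h) \<partial>\<mu>) / norm h) \<longlongrightarrow> 0) (at 0)"
    proof (rule L1_derivative[OF r(1) _ _ Ci, where f' = density_deriv])
      show "((\<lambda>w. bergman_density \<Omega> w \<xi>) has_derivative density_deriv w \<xi>) (at w)" if "w \<in> ball z r" "\<xi> \<in> space \<mu>" for w \<xi>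
        using density_has_derivative[OF bO(1)[OF that(1)]] that(2) by simp
      show "norm (density_deriv w \<xi> v) \<le> C \<xi> * norm v" if "w \<in> ball z r" "\<xi> \<in> space \<mu>" for w \<xi> v
        using C[OF bO(2)[OF that(1)], of \<xi> v] that(2) by simp
      show "bergman_density \<Omega> w \<in> borel_measurable \<mu>" if "w \<in> ball z r" for w
        using density_integrable[OF bO(1)[OF that]] by auto
    qed (rule density_deriv_measurable[OF z])
    show "((\<lambda>h. tv_norm \<mu> (\<lambda>A. bergman_model \<Omega> (z + h) A - bergman_model \<Omega> z A - model_deriv z h A) / norm h) \<longlongrightarrow> 0) (at 0)"
    proof (rule Lim_null_comparison[OF _ lim])
      have "\<forall>\<^sub>F h in at 0. h \<in> ball (0::complex^'n) r"
        using r by (intro eventually_at_in_open') auto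
      then show "\<forall>\<^sub>F h in at 0. norm (tv_norm \<mu> (\<lambda>A. bergman_model \<Omega> (z + h) A - bergman_model \<Omega> z A - model_deriv z h A) / norm h)
          \<le> (\<integral>\<xi>. norm (bergman_density \<Omega> (z + h) \<xi> - bergman_density \<Omega> z \<xi> - density_deriv z \<xi> h) \<partial>\<mu>) / norm h"
      proof (rule eventually_mono)
        fix h :: "complex^'n" assume "h \<in> ball 0 r"
        then have zh: "z + h \<in> \<Omega>" using bO(1)[of "z + h"] by (simp add: dist_norm)
        let ?\<phi> = "\<lambda>\<xi>. bergman_density \<Omega> (z + h) \<xi> - bergman_density \<Omega> z \<xi> - density_deriv z \<xi> h"
        have i: "integrable \<mu> ?\<phi>"
          using density_integrable[OF zh] density_integrable[OF z] density_deriv_integrable[OF z] by simp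
        have "(\<lambda>A. bergman_model \<Omega> (z + h) A - bergman_model \<Omega> z A - model_deriv z h A) = signed_density \<mu> ?\<phi>"
          unfolding bergman_model_def model_deriv_def
          using density_integrable[OF zh] density_integrable[OF z] density_deriv_integrable[OF z]
          by (simp add: signed_density_diff fun_eq_iff)
        then show "norm (tv_norm \<mu> (\<lambda>A. bergman_model \<Omega> (z + h) A - bergman_model \<Omega> z A - model_deriv z h A) / norm h)
          \<le> (\<integral>\<xi>. norm (?\<phi> \<xi>) \<partial>\<mu>) / norm h"
          using tv_norm_signed_density[OF i] by (simp add: divide_right_mono)
      qed
    qed
  qed
qed

text \<open>Reduces uniformity over all directions \<open>v\<close>, and joint convergence in base
  point and direction, to finitely many fixed directions.\<close>

lemma density_deriv_expand:
  assumes "z \<in> \<Omega>" "\<xi> \<in> \<Omega>"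
  shows "density_deriv z \<xi> v = (\<Sum>b\<in>Basis. (v \<bullet> b) * density_deriv z \<xi> b)"
proof -
  have "density_deriv z \<xi> v = density_deriv z \<xi> (\<Sum>b\<in>Basis. (v \<bullet> b) *\<^sub>R b)" by (simp add: euclidean_representation)
  also have "\<dots> = (\<Sum>b\<in>Basis. (v \<bullet> b) * density_deriv z \<xi> b)"
    by (simp add: linear_sum[OF density_deriv_linear[OF assms]] linear_scale[OF density_deriv_linear[OF assms]])
  finally show ?thesis .
qed

lemma density_deriv_L1_continuous:
  assumes z: "z \<in> \<Omega>"
  shows "((\<lambda>w. \<integral>\<xi>. \<bar>density_deriv w \<xi> b - density_deriv z \<xi> b\<bar> \<partial>\<mu>) \<longlongrightarrow> 0) (at z)"
  unfolding tendsto_at_iff_sequentially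
proof (intro allI impI)
  fix X :: "nat \<Rightarrow> complex^'n" assume X: "\<forall>i. X i \<in> UNIV - {z}" "X \<longlonglongrightarrow> z"
  obtain r C where r: "r > 0" "cball z r \<subseteq> \<Omega>" and Ci: "integrable \<mu> C"
    and C: "\<And>w \<xi> v. w \<in> cball z r \<Longrightarrow> \<xi> \<in> \<Omega> \<Longrightarrow> \<bar>density_deriv w \<xi> v\<bar> \<le> C \<xi> * norm v"
    and "\<And>w \<xi> v. w \<in> cball z r \<Longrightarrow> \<xi> \<in> \<Omega> \<Longrightarrow> (density_deriv w \<xi> v)\<^sup>2 \<le> C \<xi> * (norm v)\<^sup>2 * bergman_density \<Omega> w \<xi>"
    by (rule density_deriv_bound[OF z]) (blast intro: that)
  obtain N where N: "\<And>i. i \<ge> N \<Longrightarrow> X i \<in> cball z r"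
    using metric_LIMSEQ_D[OF X(2) r(1)] by (force simp: dist_commute intro: less_imp_le)
  define Y where "Y i = X (i + N)" for i
  have Y: "Y i \<in> cball z r" "Y i \<in> \<Omega>" for i using N[of "i + N"] r(2) by (auto simp: Y_def)
  have Ylim: "Y \<longlonglongrightarrow> z" unfolding Y_def using X(2) by (rule LIMSEQ_ignore_initial_segment)
  have "(\<lambda>i. \<integral>\<xi>. \<bar>density_deriv (Y i) \<xi> b - density_deriv z \<xi> b\<bar> \<partial>\<mu>) \<longlonglongrightarrow> (\<integral>\<xi>. 0 \<partial>\<mu>)"
  proof (rule integral_dominated_convergence[where w = "\<lambda>\<xi>. 2 * (C \<xi> * norm b)"])
    show "integrable \<mu> (\<lambda>\<xi>. 2 * (C \<xi> * norm b))" using Ci by simp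
    show "(\<lambda>\<xi>. \<bar>density_deriv (Y i) \<xi> b - density_deriv z \<xi> b\<bar>) \<in> borel_measurable \<mu>" for i
      using density_deriv_measurable[OF Y(2)[of i], of b] density_deriv_measurable[OF z, of b] by measurable
    show "AE \<xi> in \<mu>. (\<lambda>i. \<bar>density_deriv (Y i) \<xi> b - density_deriv z \<xi> b\<bar>) \<longlonglongrightarrow> 0"
    proof (rule AE_I2)
      fix \<xi> assume "\<xi> \<in> space \<mu>"
      then have "isCont (\<lambda>w. density_deriv w \<xi> b) z" using density_deriv_isCont[OF z] by simp
      from isCont_tendsto_compose[OF this Ylim]
      have "(\<lambda>i. density_deriv (Y i) \<xi> b) \<longlonglongrightarrow> density_deriv z \<xi> b" .
      then show "(\<lambda>i. \<bar>density_deriv (Y i) \<xi> b - density_deriv z \<xi> b\<bar>) \<longlonglongrightarrow> 0"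
        by (intro tendsto_rabs_zero) (simp add: LIM_zero)
    qed
    show "AE \<xi> in \<mu>. norm (\<bar>density_deriv (Y i) \<xi> b - density_deriv z \<xi> b\<bar>) \<le> 2 * (C \<xi> * norm b)" for i
    proof (rule AE_I2)
      fix \<xi> assume "\<xi> \<in> space \<mu>"
      then have "\<bar>density_deriv (Y i) \<xi> b\<bar> \<le> C \<xi> * norm b" "\<bar>density_deriv z \<xi> b\<bar> \<le> C \<xi> * norm b"
        using C[OF Y(1)[of i], of \<xi> b] C[of z \<xi> b] r(1) by auto
      then show "norm (\<bar>density_deriv (Y i) \<xi> b - density_deriv z \<xi> b\<bar>) \<le> 2 * (C \<xi> * norm b)" by simp
    qed
  qed simp
  then have "(\<lambda>i. \<integral>\<xi>. \<bar>density_deriv (X (i + N)) \<xi> b - density_deriv z \<xi> b\<bar> \<partial>\<mu>) \<longlonglongrightarrow> 0" by (simp add: Y_def)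
  then show "((\<lambda>w. \<integral>\<xi>. \<bar>density_deriv w \<xi> b - density_deriv z \<xi> b\<bar> \<partial>\<mu>) \<circ> X) \<longlonglongrightarrow> 0"
    unfolding o_def by (rule LIMSEQ_offset)
qed

lemma model_tv_C1: "tv_C1 \<mu> \<Omega> (bergman_model \<Omega>)"
  unfolding tv_C1_def
proof (intro exI[of _ model_deriv] conjI ballI allI impI)
  fix z assume z: "z \<in> \<Omega>"
  show "has_tv_derivative \<mu> (bergman_model \<Omega>) (model_deriv z) z" by (rule model_has_tv_derivative[OF z])
  fix \<epsilon> :: real assume \<epsilon>: "\<epsilon> > 0"
  \<comment> \<open>By the basis expansion, \<open>S w\<close> bounds the operator norm of the
    difference of the derivatives at \<open>w\<close> and \<open>z\<close>.\<close>
  define S where "S w = (\<Sum>b\<in>Basis. \<integral>\<xi>. \<bar>density_deriv w \<xi> b - density_deriv z \<xi> b\<bar> \<partial>\<mu>)" for w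
  have "(S \<longlongrightarrow> (\<Sum>b\<in>(Basis::(complex^'n) set). 0)) (at z)"
    unfolding S_def by (intro tendsto_sum density_deriv_L1_continuous z)
  then have "(S \<longlongrightarrow> 0) (at z)" by simp
  then obtain d where d: "d > 0" "\<And>w. w \<noteq> z \<Longrightarrow> dist w z < d \<Longrightarrow> dist (S w) 0 < \<epsilon>"
    using \<epsilon> unfolding tendsto_iff eventually_at by (metis UNIV_I)
  have "tv_norm \<mu> (\<lambda>A. model_deriv w v A - model_deriv z v A) \<le> \<epsilon> * norm v" if w: "w \<in> \<Omega>" "dist w z < d" for w v
  proof -
    have i: "integrable \<mu> (\<lambda>\<xi>. density_deriv w \<xi> v - density_deriv z \<xi> v)" for v
      using density_deriv_integrable[OF w(1)] density_deriv_integrable[OF z] by simp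
    have "(\<lambda>A. model_deriv w v A - model_deriv z v A) = signed_density \<mu> (\<lambda>\<xi>. density_deriv w \<xi> v - density_deriv z \<xi> v)"
      unfolding model_deriv_def using signed_density_diff[OF density_deriv_integrable[OF w(1)] density_deriv_integrable[OF z]] by blast
    then have "tv_norm \<mu> (\<lambda>A. model_deriv w v A - model_deriv z v A) \<le> (\<integral>\<xi>. \<bar>density_deriv w \<xi> v - density_deriv z \<xi> v\<bar> \<partial>\<mu>)"
      using tv_norm_signed_density(1)[OF i] by simp
    also have "\<dots> \<le> (\<integral>\<xi>. (\<Sum>b\<in>Basis. norm v * \<bar>density_deriv w \<xi> b - density_deriv z \<xi> b\<bar>) \<partial>\<mu>)"
    proof (rule integral_mono)
      show "integrable \<mu> (\<lambda>\<xi>. \<bar>density_deriv w \<xi> v - density_deriv z \<xi> v\<bar>)" using i by simp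
      show "integrable \<mu> (\<lambda>\<xi>. \<Sum>b\<in>Basis. norm v * \<bar>density_deriv w \<xi> b - density_deriv z \<xi> b\<bar>)" using i by simp
      fix \<xi> assume "\<xi> \<in> space \<mu>"
      then have x: "\<xi> \<in> \<Omega>" by simp
      have "density_deriv w \<xi> v - density_deriv z \<xi> v = (\<Sum>b\<in>Basis. (v \<bullet> b) * (density_deriv w \<xi> b - density_deriv z \<xi> b))"
        using density_deriv_expand[OF w(1) x, of v] density_deriv_expand[OF z x, of v]
        by (simp add: right_diff_distrib sum_subtractf)
      also have "\<bar>\<dots>\<bar> \<le> (\<Sum>b\<in>Basis. \<bar>(v \<bullet> b) * (density_deriv w \<xi> b - density_deriv z \<xi> b)\<bar>)" by (rule sum_abs)
      also have "\<dots> \<le> (\<Sum>b\<in>Basis. norm v * \<bar>density_deriv w \<xi> b - density_deriv z \<xi> b\<bar>)"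
        unfolding abs_mult by (intro sum_mono mult_right_mono Basis_le_norm) auto
      finally show "\<bar>density_deriv w \<xi> v - density_deriv z \<xi> v\<bar> \<le> (\<Sum>b\<in>Basis. norm v * \<bar>density_deriv w \<xi> b - density_deriv z \<xi> b\<bar>)" .
    qed
    also have "\<dots> = norm v * S w" using i by (simp add: S_def sum_distrib_left)
    also have "\<dots> \<le> norm v * \<epsilon>"
    proof (cases "w = z")
      case True
      then show ?thesis using \<epsilon> by (simp add: S_def)
    next
      case False
      then have "S w \<le> \<epsilon>" using d(2)[OF False w(2)] by simp
      then show ?thesis by (intro mult_left_mono) auto
    qed
    finally show ?thesis by (simp add: mult.commute)
  qed
  then show "\<exists>\<delta>>0. \<forall>y\<in>\<Omega>. dist y z < \<delta> \<longrightarrow> (\<forall>v. tv_norm \<mu> (\<lambda>A. model_deriv y v A - model_deriv z v A) \<le> \<epsilon> * norm v)"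
    using d(1) by blast
qed

section \<open>Positivity, logarithmic derivatives and Fisher information\<close>

lemma model_statistical: "statistical_model \<mu> \<Omega> (bergman_model \<Omega>)"
  unfolding statistical_model_def
proof (intro conjI)
  show "sigma_finite_measure \<mu>" using finite_measure_dom finite_measure.axioms(1) by blast
  show "open \<Omega>" by (rule open_dom)
  show "tv_C1 \<mu> \<Omega> (bergman_model \<Omega>)" by (rule model_tv_C1)
  show "bergman_model \<Omega> ` \<Omega> \<subseteq> positive_prob_measures \<mu>"
  proof
    fix \<nu> assume "\<nu> \<in> bergman_model \<Omega> ` \<Omega>"
    then obtain z where z: "z \<in> \<Omega>" and \<nu>: "\<nu> = signed_density \<mu> (bergman_density \<Omega> z)"
      by (auto simp: bergman_model_def)
    have "AE \<xi> in \<mu>. bergman_density \<Omega> z \<xi> > 0"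
      by (rule AE_mp[OF K_zero_null[OF z]]) (use K_diag_pos[OF z] in \<open>auto simp: bergman_density_def\<close>)
    then show "\<nu> \<in> positive_prob_measures \<mu>"
      unfolding positive_prob_measures_def \<nu> using density_integrable[OF z] density_integral[OF z] by blast
  qed
qed

text \<open>On the null set where the density vanishes the value is 0, by division by zero.\<close>

definition log_deriv :: "complex^'n \<Rightarrow> complex^'n \<Rightarrow> complex^'n \<Rightarrow> real" where
  "log_deriv z v \<xi> = density_deriv z \<xi> v / bergman_density \<Omega> z \<xi>"

lemma log_deriv_measurable: "z \<in> \<Omega> \<Longrightarrow> log_deriv z v \<in> borel_measurable \<mu>"
  unfolding log_deriv_def[abs_def] using density_deriv_measurable[of z v] density_integrable[of z] by auto

lemma density_log_deriv: "z \<in> \<Omega> \<Longrightarrow> K z \<xi> \<noteq> 0 \<Longrightarrow> bergman_density \<Omega> z \<xi> * log_deriv z v \<xi> = density_deriv z \<xi> v"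
  using K_diag_pos[of z] by (auto simp: log_deriv_def bergman_density_def)

lemma log_deriv_is_log_derivative:
  assumes z: "z \<in> \<Omega>"
  shows "is_log_derivative \<mu> (bergman_model \<Omega>) z v (log_deriv z v)"
proof -
  have eq: "AE \<xi> in \<mu>. bergman_density \<Omega> z \<xi> *\<^sub>R log_deriv z v \<xi> = density_deriv z \<xi> v"
    by (rule AE_mp[OF K_zero_null[OF z]]) (simp add: density_log_deriv z)
  have m: "(\<lambda>\<xi>. bergman_density \<Omega> z \<xi> *\<^sub>R log_deriv z v \<xi>) \<in> borel_measurable \<mu>"
    using log_deriv_measurable[OF z] density_integrable[OF z] by auto
  have i: "integrable (P z) (log_deriv z v)"
    unfolding integrable_prob[OF z log_deriv_measurable[OF z]]
    using density_deriv_integrable[OF z] by (subst integrable_cong_AE[OF m density_deriv_measurable[OF z] eq])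
  have "model_deriv z v A = signed_density (P z) (log_deriv z v) A" for A
  proof (cases "A \<in> sets \<mu>")
    case True
    have mA: "(\<lambda>\<xi>. indicator A \<xi> *\<^sub>R log_deriv z v \<xi>) \<in> borel_measurable \<mu>"
      using True log_deriv_measurable[OF z] by measurable
    have "(LINT \<xi>:A|P z. log_deriv z v \<xi>) = (\<integral>\<xi>. bergman_density \<Omega> z \<xi> *\<^sub>R (indicator A \<xi> *\<^sub>R log_deriv z v \<xi>) \<partial>\<mu>)"
      unfolding set_lebesgue_integral_def by (rule integral_prob[OF z mA])
    also have "\<dots> = (\<integral>\<xi>. indicator A \<xi> *\<^sub>R density_deriv z \<xi> v \<partial>\<mu>)"
    proof (rule integral_cong_AE)
      show "(\<lambda>\<xi>. bergman_density \<Omega> z \<xi> *\<^sub>R (indicator A \<xi> *\<^sub>R log_deriv z v \<xi>)) \<in> borel_measurable \<mu>"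
        using mA density_integrable[OF z] by auto
      show "(\<lambda>\<xi>. indicator A \<xi> *\<^sub>R density_deriv z \<xi> v) \<in> borel_measurable \<mu>"
        using True density_deriv_measurable[OF z, of v] by measurable
      show "AE \<xi> in \<mu>. bergman_density \<Omega> z \<xi> *\<^sub>R (indicator A \<xi> *\<^sub>R log_deriv z v \<xi>) = indicator A \<xi> *\<^sub>R density_deriv z \<xi> v"
        using eq by eventually_elim (simp add: algebra_simps indicator_def)
    qed
    finally show ?thesis
      using True z by (simp add: model_deriv_def signed_density_def set_lebesgue_integral_def)
  qed (simp add: model_deriv_def signed_density_def z)
  then have "is_signed_RN_deriv \<mu> (model_deriv z v) (bergman_model \<Omega> z) (log_deriv z v)"
    unfolding is_signed_RN_deriv_def using i by blast
  then show ?thesis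
    unfolding is_log_derivative_def using model_has_tv_derivative[OF z] by blast
qed

lemma log_deriv_sq_bound:
  assumes "(density_deriv z \<xi> v)\<^sup>2 \<le> c * bergman_density \<Omega> z \<xi>" "z \<in> \<Omega>" "c \<ge> 0"
  shows "bergman_density \<Omega> z \<xi> * (log_deriv z v \<xi>)\<^sup>2 \<le> c"
proof (cases "bergman_density \<Omega> z \<xi> = 0")
  case False
  then have p: "bergman_density \<Omega> z \<xi> > 0" using density_nonneg[OF assms(2), of \<xi>] by linarith
  have "bergman_density \<Omega> z \<xi> * (log_deriv z v \<xi>)\<^sup>2 = (density_deriv z \<xi> v)\<^sup>2 / bergman_density \<Omega> z \<xi>"
    using p by (simp add: log_deriv_def power_divide power2_eq_square)
  also have "\<dots> \<le> c" using assms(1) p by (simp add: pos_divide_le_eq)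
  finally show ?thesis .
qed (use assms in simp)

lemma log_deriv_sq_measurable: "z \<in> \<Omega> \<Longrightarrow> (\<lambda>\<xi>. bergman_density \<Omega> z \<xi> * (log_deriv z v \<xi>)\<^sup>2) \<in> borel_measurable \<mu>"
  using log_deriv_measurable[of z v] density_integrable[of z] by auto

lemma log_deriv_sq_integrable:
  assumes z: "z \<in> \<Omega>"
  shows "integrable \<mu> (\<lambda>\<xi>. bergman_density \<Omega> z \<xi> * (log_deriv z v \<xi>)\<^sup>2)"
proof -
  obtain r C where r: "r > 0" "cball z r \<subseteq> \<Omega>" and Ci: "integrable \<mu> C"
    and C1: "\<And>w \<xi> v. w \<in> cball z r \<Longrightarrow> \<xi> \<in> \<Omega> \<Longrightarrow> \<bar>density_deriv w \<xi> v\<bar> \<le> C \<xi> * norm v"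
    and C: "\<And>w \<xi> v. w \<in> cball z r \<Longrightarrow> \<xi> \<in> \<Omega> \<Longrightarrow> (density_deriv w \<xi> v)\<^sup>2 \<le> C \<xi> * (norm v)\<^sup>2 * bergman_density \<Omega> w \<xi>"
    by (rule density_deriv_bound[OF z]) (blast intro: that)
  show ?thesis
  proof (rule Bochner_Integration.integrable_bound[OF _ log_deriv_sq_measurable[OF z]])
    show "integrable \<mu> (\<lambda>\<xi>. \<bar>C \<xi>\<bar> * (norm v)\<^sup>2)" using Ci by simp
    show "AE \<xi> in \<mu>. norm (bergman_density \<Omega> z \<xi> * (log_deriv z v \<xi>)\<^sup>2) \<le> norm (\<bar>C \<xi>\<bar> * (norm v)\<^sup>2)"
    proof (rule AE_I2)
      fix \<xi> assume "\<xi> \<in> space \<mu>"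
      then have "(density_deriv z \<xi> v)\<^sup>2 \<le> C \<xi> * (norm v)\<^sup>2 * bergman_density \<Omega> z \<xi>" using C[of z \<xi> v] r(1) by simp
      also have "\<dots> \<le> \<bar>C \<xi>\<bar> * (norm v)\<^sup>2 * bergman_density \<Omega> z \<xi>"
        using density_nonneg[OF z, of \<xi>] by (intro mult_right_mono) auto
      finally have "bergman_density \<Omega> z \<xi> * (log_deriv z v \<xi>)\<^sup>2 \<le> \<bar>C \<xi>\<bar> * (norm v)\<^sup>2"
        by (rule log_deriv_sq_bound[OF _ z]) simp
      then show "norm (bergman_density \<Omega> z \<xi> * (log_deriv z v \<xi>)\<^sup>2) \<le> norm (\<bar>C \<xi>\<bar> * (norm v)\<^sup>2)"
        using density_nonneg[OF z, of \<xi>] by simp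
    qed
  qed
qed

text \<open>The second moment of the logarithmic derivative is the Fisher information, as a function
  on the tangent bundle. Dominated convergence applies along sequences, with \<open>B\<close>
  bounding the convergent directions and \<open>C\<close> locally uniform in the base point.\<close>

lemma Fisher_continuous:
  "continuous_on (\<Omega> \<times> UNIV) (\<lambda>(z, v). \<integral>\<xi>. bergman_density \<Omega> z \<xi> * (log_deriv z v \<xi>)\<^sup>2 \<partial>\<mu>)"
  unfolding continuous_on_sequentially
proof (intro allI ballI impI)
  fix X :: "nat \<Rightarrow> (complex^'n) \<times> (complex^'n)" and a
  assume a: "a \<in> \<Omega> \<times> UNIV" and X: "(\<forall>n. X n \<in> \<Omega> \<times> UNIV) \<and> X \<longlonglongrightarrow> a"
  obtain z v where a: "a = (z, v)" and z: "z \<in> \<Omega>" using a by auto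
  have lim: "(\<lambda>n. fst (X n)) \<longlonglongrightarrow> z" "(\<lambda>n. snd (X n)) \<longlonglongrightarrow> v"
    using tendsto_fst[of X a sequentially] tendsto_snd[of X a sequentially] X by (simp_all add: a)
  obtain r C where r: "r > 0" "cball z r \<subseteq> \<Omega>" and Ci: "integrable \<mu> C"
    and C1: "\<And>w \<xi> v. w \<in> cball z r \<Longrightarrow> \<xi> \<in> \<Omega> \<Longrightarrow> \<bar>density_deriv w \<xi> v\<bar> \<le> C \<xi> * norm v"
    and C: "\<And>w \<xi> v. w \<in> cball z r \<Longrightarrow> \<xi> \<in> \<Omega> \<Longrightarrow> (density_deriv w \<xi> v)\<^sup>2 \<le> C \<xi> * (norm v)\<^sup>2 * bergman_density \<Omega> w \<xi>"
    by (rule density_deriv_bound[OF z]) (blast intro: that)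
  obtain N where N: "\<And>i. i \<ge> N \<Longrightarrow> fst (X i) \<in> cball z r"
    using metric_LIMSEQ_D[OF lim(1) r(1)] by (force simp: dist_commute intro: less_imp_le)
  obtain B where B: "\<And>i. norm (snd (X i)) \<le> B"
    using convergent_imp_Bseq[OF convergentI[OF lim(2)]] by (auto simp: Bseq_def)
  define Y where "Y i = fst (X (i + N))" for i
  define W where "W i = snd (X (i + N))" for i
  have Y: "Y i \<in> cball z r" "Y i \<in> \<Omega>" for i using N[of "i + N"] r(2) by (auto simp: Y_def)
  have Ylim: "Y \<longlonglongrightarrow> z" unfolding Y_def using lim(1) by (rule LIMSEQ_ignore_initial_segment)
  have Wlim: "W \<longlonglongrightarrow> v" unfolding W_def using lim(2) by (rule LIMSEQ_ignore_initial_segment)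
  have WB: "norm (W i) \<le> B" for i unfolding W_def by (rule B)
  have "(\<lambda>i. \<integral>\<xi>. bergman_density \<Omega> (Y i) \<xi> * (log_deriv (Y i) (W i) \<xi>)\<^sup>2 \<partial>\<mu>)
      \<longlonglongrightarrow> (\<integral>\<xi>. bergman_density \<Omega> z \<xi> * (log_deriv z v \<xi>)\<^sup>2 \<partial>\<mu>)"
  proof (rule integral_dominated_convergence[where w = "\<lambda>\<xi>. \<bar>C \<xi>\<bar> * B\<^sup>2"])
    show "integrable \<mu> (\<lambda>\<xi>. \<bar>C \<xi>\<bar> * B\<^sup>2)" using Ci by simp
    show "(\<lambda>\<xi>. bergman_density \<Omega> (Y i) \<xi> * (log_deriv (Y i) (W i) \<xi>)\<^sup>2) \<in> borel_measurable \<mu>" for i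
      by (rule log_deriv_sq_measurable[OF Y(2)])
    show "(\<lambda>\<xi>. bergman_density \<Omega> z \<xi> * (log_deriv z v \<xi>)\<^sup>2) \<in> borel_measurable \<mu>"
      by (rule log_deriv_sq_measurable[OF z])
    show "AE \<xi> in \<mu>. (\<lambda>i. bergman_density \<Omega> (Y i) \<xi> * (log_deriv (Y i) (W i) \<xi>)\<^sup>2)
        \<longlonglongrightarrow> bergman_density \<Omega> z \<xi> * (log_deriv z v \<xi>)\<^sup>2"
    \<comment> \<open>Off the zeros of \<open>K z\<close> the limiting density is nonzero, so the
      division in \<open>log_deriv\<close> is continuous there.\<close>
    proof (rule AE_mp[OF K_zero_null[OF z]], rule AE_I2, rule impI)
      fix \<xi> assume "\<xi> \<in> space \<mu>" and k: "K z \<xi> \<noteq> 0"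
      then have x: "\<xi> \<in> \<Omega>" by simp
      have "isCont (\<lambda>w. bergman_density \<Omega> w \<xi>) z"
        using density_has_derivative[OF z x] has_derivative_continuous by blast
      from isCont_tendsto_compose[OF this Ylim]
      have dl: "(\<lambda>i. bergman_density \<Omega> (Y i) \<xi>) \<longlonglongrightarrow> bergman_density \<Omega> z \<xi>" .
      have "(\<lambda>i. \<Sum>b\<in>Basis. (W i \<bullet> b) * density_deriv (Y i) \<xi> b) \<longlonglongrightarrow> (\<Sum>b\<in>Basis. (v \<bullet> b) * density_deriv z \<xi> b)"
        by (intro tendsto_intros Wlim isCont_tendsto_compose[OF density_deriv_isCont[OF z x] Ylim])
      then have pl: "(\<lambda>i. density_deriv (Y i) \<xi> (W i)) \<longlonglongrightarrow> density_deriv z \<xi> v"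
        by (simp flip: density_deriv_expand[OF Y(2) x] density_deriv_expand[OF z x])
      have "bergman_density \<Omega> z \<xi> \<noteq> 0" using k K_diag_pos[OF z] by (simp add: bergman_density_def)
      then show "(\<lambda>i. bergman_density \<Omega> (Y i) \<xi> * (log_deriv (Y i) (W i) \<xi>)\<^sup>2)
        \<longlonglongrightarrow> bergman_density \<Omega> z \<xi> * (log_deriv z v \<xi>)\<^sup>2"
        unfolding log_deriv_def by (intro tendsto_intros dl pl)
    qed
    show "AE \<xi> in \<mu>. norm (bergman_density \<Omega> (Y i) \<xi> * (log_deriv (Y i) (W i) \<xi>)\<^sup>2) \<le> \<bar>C \<xi>\<bar> * B\<^sup>2" for i
    proof (rule AE_I2)
      fix \<xi> assume "\<xi> \<in> space \<mu>"
      then have "(density_deriv (Y i) \<xi> (W i))\<^sup>2 \<le> C \<xi> * (norm (W i))\<^sup>2 * bergman_density \<Omega> (Y i) \<xi>"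
        using C[OF Y(1)] by simp
      also have "\<dots> \<le> \<bar>C \<xi>\<bar> * B\<^sup>2 * bergman_density \<Omega> (Y i) \<xi>"
        using density_nonneg[OF Y(2)[of i], of \<xi>] WB[of i] by (intro mult_right_mono mult_mono power_mono) auto
      finally have "bergman_density \<Omega> (Y i) \<xi> * (log_deriv (Y i) (W i) \<xi>)\<^sup>2 \<le> \<bar>C \<xi>\<bar> * B\<^sup>2"
        by (rule log_deriv_sq_bound[OF _ Y(2)]) simp
      then show "norm (bergman_density \<Omega> (Y i) \<xi> * (log_deriv (Y i) (W i) \<xi>)\<^sup>2) \<le> \<bar>C \<xi>\<bar> * B\<^sup>2"
        using density_nonneg[OF Y(2)[of i], of \<xi>] by simp
    qed
  qed
  then have "(\<lambda>i. (case X (i + N) of (z, v) \<Rightarrow> \<integral>\<xi>. bergman_density \<Omega> z \<xi> * (log_deriv z v \<xi>)\<^sup>2 \<partial>\<mu>))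
      \<longlonglongrightarrow> (\<integral>\<xi>. bergman_density \<Omega> z \<xi> * (log_deriv z v \<xi>)\<^sup>2 \<partial>\<mu>)"
    by (simp add: Y_def W_def case_prod_unfold)
  from LIMSEQ_offset[OF this]
  show "((\<lambda>(z, v). \<integral>\<xi>. bergman_density \<Omega> z \<xi> * (log_deriv z v \<xi>)\<^sup>2 \<partial>\<mu>) \<circ> X)
      \<longlonglongrightarrow> (case a of (z, v) \<Rightarrow> \<integral>\<xi>. bergman_density \<Omega> z \<xi> * (log_deriv z v \<xi>)\<^sup>2 \<partial>\<mu>)"
    by (simp add: o_def a)
qed

lemma model_2_integrable: "k_integrable_model 2 \<mu> \<Omega> (bergman_model \<Omega>)"
  unfolding k_integrable_model_def
proof (intro conjI exI[of _ log_deriv] ballI allI)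
  show "statistical_model \<mu> \<Omega> (bergman_model \<Omega>)" by (rule model_statistical)
  fix z v assume z: "z \<in> \<Omega>"
  show "is_log_derivative \<mu> (bergman_model \<Omega>) z v (log_deriv z v)" by (rule log_deriv_is_log_derivative[OF z])
  have m: "(\<lambda>\<xi>. \<bar>log_deriv z v \<xi>\<bar>\<^sup>2) \<in> borel_measurable \<mu>" using log_deriv_measurable[OF z, of v] by measurable
  show "integrable (P z) (\<lambda>\<xi>. \<bar>log_deriv z v \<xi>\<bar>\<^sup>2)"
    unfolding integrable_prob[OF z m] using log_deriv_sq_integrable[OF z] by simp
next
  have eq: "(\<integral>\<xi>. \<bar>log_deriv z v \<xi>\<bar>\<^sup>2 \<partial>P z) = (\<integral>\<xi>. bergman_density \<Omega> z \<xi> * (log_deriv z v \<xi>)\<^sup>2 \<partial>\<mu>)" if z: "z \<in> \<Omega>" for z v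
  proof -
    have m: "(\<lambda>\<xi>. \<bar>log_deriv z v \<xi>\<bar>\<^sup>2) \<in> borel_measurable \<mu>" using log_deriv_measurable[OF z, of v] by measurable
    show ?thesis unfolding integral_prob[OF z m] by simp
  qed
  have "continuous_on (\<Omega> \<times> UNIV) (\<lambda>p. root 2 ((\<lambda>(z, v). \<integral>\<xi>. bergman_density \<Omega> z \<xi> * (log_deriv z v \<xi>)\<^sup>2 \<partial>\<mu>) p))"
    by (intro continuous_on_real_root Fisher_continuous)
  then show "continuous_on (\<Omega> \<times> UNIV) (\<lambda>(z, v). root 2 (\<integral>\<xi>. \<bar>log_deriv z v \<xi>\<bar>\<^sup>2 \<partial>P z))"
    by (rule continuous_on_eq) (auto simp: eq[simplified])
qed

end

theorem theorem1:
  fixes \<Omega> :: "(complex ^ 'n::finite) set"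
  assumes "open \<Omega>" and "connected \<Omega>" and "\<Omega> \<noteq> {}" and "bounded \<Omega>"
  shows "(k_integrable_model 2 (lebesgue_on \<Omega>) \<Omega> (bergman_model \<Omega>)
          \<and> (\<forall>z\<in>\<Omega>. \<forall>\<alpha> \<beta>. Cov_exists \<Omega> z (score \<Omega> z \<alpha>) (score \<Omega> z \<beta>)
                \<and> bergman_metric \<Omega> \<alpha> \<beta> z = Cov \<Omega> z (score \<Omega> z \<alpha>) (score \<Omega> z \<beta>)))
       \<and> (condition_C 4 \<Omega> \<longrightarrow>
            (\<forall>z\<in>\<Omega>. \<forall>\<alpha> \<beta> \<gamma> \<delta>.
                Cov_exists \<Omega> z (normal_field \<Omega> z \<alpha> \<gamma>) (normal_field \<Omega> z \<beta> \<delta>)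
                \<and> bergman_curvature \<Omega> \<alpha> \<beta> \<gamma> \<delta> z =
                    bergman_metric \<Omega> \<alpha> \<beta> z * bergman_metric \<Omega> \<gamma> \<delta> z
                  + bergman_metric \<Omega> \<alpha> \<delta> z * bergman_metric \<Omega> \<gamma> \<beta> z
                  - Cov \<Omega> z (normal_field \<Omega> z \<alpha> \<gamma>) (normal_field \<Omega> z \<beta> \<delta>))
            \<and> (\<forall>z\<in>\<Omega>. \<forall>\<alpha> \<gamma>.
                normal_field \<Omega> z \<alpha> \<gamma> \<in> tangent_prob (bergman_prob \<Omega> z)
                \<and> orthogonal_to_model \<Omega> z (normal_field \<Omega> z \<alpha> \<gamma>)))"
proof -
  interpret bergman_domain \<Omega> using assms by unfold_locales
  show ?thesis
    by (intro conjI ballI allI impI model_2_integrable score_Cov normal_field_Cov)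
qed

end
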